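(* Fix a nonsquare $\varepsilon\in\mathrm{GF}(\kappa)$. Let $\mathcal{D}_\varepsilon$ be the set of pairs $(a,b)\in\mathbb{K}\times\mathbb{K}$ for which there exist $c,d\in\mathbb{K}$ of opposite parity in degree and $\delta\in\mathrm{GF}(\kappa)^\times$ such that either ($c$ is a square in $\mathbb{K}_\infty$, $a=\varepsilon c$ and $b=\delta d$) or ($d$ is a square in $\mathbb{K}_\infty$, $b=\varepsilon d$ and $a=\delta c$). For $a,b$ let $\widetilde{\mathcal{R}_{a,b}}=\bigcup_{P\in\Delta_{a,b}\cap(\mathbb{P}(a)\cup\mathbb{P}(b))}\mathbb{A}_P$. Then $$\mathbb{A}\cup\mathbb{A}_\infty=\bigcap_{(a,b)\in\mathcal{D}_\varepsilon}\widetilde{\mathcal{R}_{a,b}}.$$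
   Context: Let $S$ be an infinite set, $\mathcal{D}$ a nonprincipal ultrafilter on $S$, $q_s$ prime powers unbounded along $\mathcal{D}$, $\mathrm{GF}(\kappa)=\prod_s\mathbb{F}_{q_s}/\mathcal{D}$, $\mathbb{A}=\mathrm{GF}(\kappa)[t]$, $\mathbb{K}=\mathrm{GF}(\kappa)(t)$. $\mathbb{P}$ is the set of monic irreducible polynomials of positive degree in $\mathbb{A}$; $\infty=1/t$ the infinite prime with valuation $v_\infty=-\deg$, where $\deg(A/B)=\deg A-\deg B$ for nonzero $A,B\in\mathbb{A}$; $\mathbb{K}_\infty=\mathrm{GF}(\kappa)((1/t))$. For $P\in\mathbb{P}\cup\{\infty\}$, $v_P$ is the $P$-adic valuation, $\mathbb{K}_P$ the completion, and $\mathbb{A}_P=\{\alpha\in\mathbb{K}:v_P(\alpha)\ge0\}$. $\mathbb{P}(a)=\{P\in\mathbb{P}\cup\{\infty\}:v_P(a)\text{ odd}\}$. $\mathbb{H}_{a,b}$ is the quaternion algebra over $\mathbb{K}$ with basis $1,\alpha,\beta,\alpha\beta$, $\alpha^2=a,\beta^2=b,\alpha\beta=-\beta\alpha$, and $\Delta_{a,b}=\{P\in\mathbb{P}\cup\{\infty\}:\mathbb{H}_{a,b}\otimes\mathbb{K}_P\text{ is a division algebra}\}$. *)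

theory Defs
  imports
    "HOL-Algebra.Algebraic_Closure_Type"
    "HOL-Algebra.QuotRing"
    "HOL-Computational_Algebra.Computational_Algebra"
    "HOL-Number_Theory.Prime_Powers"
    "HOL-Library.Poly_Mapping"
    "HOL-Library.FuncSet"
begin

section \<open>Ultraproducts of rings\<close>

text \<open>A filter \<open>D\<close> on the type \<open>'s\<close> with \<open>D \<le> principal S\<close> is the same thing as a filter on the set
  \<open>S\<close>; a subset \<open>U\<close> of \<open>S\<close> is in the filter iff \<open>\<forall>\<^sub>F s in D. s \<in> U\<close>.\<close>

definition nonprincipal_ultrafilter_on :: "'s set \<Rightarrow> 's filter \<Rightarrow> bool" where
  "nonprincipal_ultrafilter_on S D \<longleftrightarrow>
     D \<le> principal S \<and> D \<noteq> bot \<and>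
     (\<forall>U. (\<forall>\<^sub>F s in D. s \<in> U) \<or> (\<forall>\<^sub>F s in D. s \<notin> U)) \<and>
     (\<forall>x\<in>S. D \<noteq> principal {x})"

definition product_ring :: "'s set \<Rightarrow> ('s \<Rightarrow> 'f ring) \<Rightarrow> ('s \<Rightarrow> 'f) ring" where
  "product_ring S F =
     \<lparr>carrier = (\<Pi>\<^sub>E s\<in>S. carrier (F s)),
      monoid.mult = (\<lambda>x y. \<lambda>s\<in>S. x s \<otimes>\<^bsub>F s\<^esub> y s),
      one = (\<lambda>s\<in>S. \<one>\<^bsub>F s\<^esub>),
      ring.zero = (\<lambda>s\<in>S. \<zero>\<^bsub>F s\<^esub>),
      add = (\<lambda>x y. \<lambda>s\<in>S. x s \<oplus>\<^bsub>F s\<^esub> y s)\<rparr>"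

definition ultraproduct :: "'s set \<Rightarrow> ('s \<Rightarrow> 'f ring) \<Rightarrow> 's filter \<Rightarrow> ('s \<Rightarrow> 'f) set ring" where
  "ultraproduct S F D =
     product_ring S F Quot {x \<in> carrier (product_ring S F). \<forall>\<^sub>F s in D. x s = \<zero>\<^bsub>F s\<^esub>}"


section \<open>Degree, primes and valuations of the rational function field\<close>

text \<open>The extension \<open>A/B \<mapsto> f A - f B\<close> to nonzero fractions of a function \<open>f\<close> satisfying
  \<open>f (A * B) = f A + f B\<close> for nonzero \<open>A\<close> and \<open>B\<close>.  The value at \<open>0\<close>, where valuations are
  infinite, is irrelevant: every use below treats \<open>0\<close> separately.\<close>

definition fract_ext :: "('b::idom \<Rightarrow> nat) \<Rightarrow> 'b fract \<Rightarrow> int" where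
  "fract_ext f x = (THE n. \<exists>A B. A \<noteq> 0 \<and> B \<noteq> 0 \<and> x = Fract A B \<and> n = int (f A) - int (f B))"

lemma fract_ext_Fract:
  assumes "\<And>A B. A \<noteq> 0 \<Longrightarrow> B \<noteq> 0 \<Longrightarrow> f (A * B) = f A + f B" "A \<noteq> 0" "B \<noteq> 0"
  shows "fract_ext f (Fract A B) = int (f A) - int (f B)"
  unfolding fract_ext_def
proof (rule the_equality)
  fix n assume "\<exists>A' B'. A' \<noteq> 0 \<and> B' \<noteq> 0 \<and> Fract A B = Fract A' B' \<and> n = int (f A') - int (f B')"
  then obtain A' B' where *: "A' \<noteq> 0" "B' \<noteq> 0" "Fract A B = Fract A' B'" "n = int (f A') - int (f B')"
    by blast
  from *(1-3) assms(3) have "A * B' = A' * B" by (simp add: eq_fract)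
  then have "f A + f B' = f A' + f B" by (metis assms *(1,2))
  with *(4) show "n = int (f A) - int (f B)" by simp
qed (use assms(2,3) in blast)

definition fract_degree :: "'a::field poly fract \<Rightarrow> int" where
  "fract_degree = fract_ext degree"

lemma fract_degree_Fract:
  "A \<noteq> 0 \<Longrightarrow> B \<noteq> 0 \<Longrightarrow> fract_degree (Fract A B) = int (degree A) - int (degree B)"
  unfolding fract_degree_def by (rule fract_ext_Fract) (auto simp: degree_mult_eq)

datatype 'p place = Fin 'p | Infty

definition finite_primes :: "'a::field poly set" where
  "finite_primes = {P. lead_coeff P = 1 \<and> irreducible P \<and> degree P > 0}"

definition places :: "'a::field poly place set" where
  "places = insert Infty (Fin ` finite_primes)"

text \<open>Restated from \<open>Factorial_Ring.multiplicity\<close>, which would require the coefficient field to come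
  with a \<open>normalize\<close> operation.\<close>

definition poly_multiplicity :: "'a::field poly \<Rightarrow> 'a poly \<Rightarrow> nat" where
  "poly_multiplicity P A = (GREATEST n. P ^ n dvd A)"

lemma finite_primesD:
  assumes "P \<in> finite_primes"
  shows "lead_coeff P = 1" "irreducible P" "degree P > 0" "P \<noteq> 0" "prime_elem P"
  using assms by (auto simp: finite_primes_def field_poly_irreducible_imp_prime)

lemma power_dvd_degree_bound:
  fixes P :: "'a::field poly"
  assumes "degree P > 0" "A \<noteq> 0" "P ^ n dvd A"
  shows "n \<le> degree A"
proof -
  have "P \<noteq> 0" using assms(1) by auto
  with dvd_imp_degree_le[OF assms(3,2)] have "n * degree P \<le> degree A"
    by (simp add: degree_power_eq)
  moreover have "n \<le> n * degree P" using assms(1) by simp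
  ultimately show ?thesis by linarith
qed

lemma poly_multiplicity_decompose:
  assumes P: "P \<in> finite_primes" and A: "A \<noteq> 0"
  obtains A' where "A = P ^ poly_multiplicity P A * A'" "\<not> P dvd A'"
proof -
  have bound: "n \<le> degree A" if "P ^ n dvd A" for n
    using power_dvd_degree_bound finite_primesD(3)[OF P] A that by blast
  have "P ^ poly_multiplicity P A dvd A"
    unfolding poly_multiplicity_def by (rule GreatestI_nat[where k = 0 and b = "degree A"]) (use bound in auto)
  then obtain A' where A': "A = P ^ poly_multiplicity P A * A'" by (elim dvdE)
  have "\<not> P dvd A'"
  proof
    assume "P dvd A'"
    then have "P ^ Suc (poly_multiplicity P A) dvd A"
      by (subst A') (simp add: mult.commute mult_dvd_mono)
    then have "Suc (poly_multiplicity P A) \<le> poly_multiplicity P A"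
      using bound unfolding poly_multiplicity_def by (intro Greatest_le_nat[where b = "degree A"]) auto
    then show False by simp
  qed
  with A' that show ?thesis by blast
qed

lemma poly_multiplicity_eqI:
  assumes P: "P \<in> finite_primes" and A': "\<not> P dvd A'"
  shows "poly_multiplicity P (P ^ n * A') = n"
  unfolding poly_multiplicity_def
proof (rule Greatest_equality)
  fix m assume *: "P ^ m dvd P ^ n * A'"
  show "m \<le> n"
  proof (rule ccontr)
    assume "\<not> m \<le> n"
    then have "P ^ n * P dvd P ^ m" using le_imp_power_dvd[of "Suc n" m P] by (simp add: mult.commute)
    with * have "P ^ n * P dvd P ^ n * A'" by (rule dvd_trans[rotated])
    with A' finite_primesD(4)[OF P] show False by simp
  qed
qed simp

lemma poly_multiplicity_mult:
  assumes P: "P \<in> finite_primes" and "A \<noteq> 0" "B \<noteq> 0"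
  shows "poly_multiplicity P (A * B) = poly_multiplicity P A + poly_multiplicity P B"
proof -
  obtain A' where A': "A = P ^ poly_multiplicity P A * A'" "\<not> P dvd A'"
    using poly_multiplicity_decompose assms(1,2) by blast
  obtain B' where B': "B = P ^ poly_multiplicity P B * B'" "\<not> P dvd B'"
    using poly_multiplicity_decompose assms(1,3) by blast
  have "\<not> P dvd A' * B'"
    using A'(2) B'(2) finite_primesD(5)[OF P] by (simp add: prime_elem_dvd_mult_iff)
  moreover have "A * B = P ^ (poly_multiplicity P A + poly_multiplicity P B) * (A' * B')"
    by (subst A'(1), subst B'(1)) (simp add: power_add mult_ac)
  ultimately show ?thesis using poly_multiplicity_eqI[OF P] by metis
qed

primrec valuation :: "'a::field poly place \<Rightarrow> 'a poly fract \<Rightarrow> int" where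
  "valuation (Fin P) = fract_ext (poly_multiplicity P)"
| "valuation Infty = (\<lambda>x. - fract_degree x)"

lemma valuation_Fin_Fract:
  assumes "P \<in> finite_primes" "A \<noteq> 0" "B \<noteq> 0"
  shows "valuation (Fin P) (Fract A B) = int (poly_multiplicity P A) - int (poly_multiplicity P B)"
  unfolding valuation.simps using assms
  by (intro fract_ext_Fract) (auto simp: poly_multiplicity_mult)

definition valuation_ge :: "'a::field poly place \<Rightarrow> int \<Rightarrow> 'a poly fract \<Rightarrow> bool" where
  "valuation_ge p n x \<longleftrightarrow> x = 0 \<or> valuation p x \<ge> n"

definition valuation_ring :: "'a::field poly place \<Rightarrow> 'a poly fract set" where
  "valuation_ring p = {x. valuation_ge p 0 x}"

definition odd_places :: "'a::field poly fract \<Rightarrow> 'a poly place set" where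
  "odd_places x = {p \<in> places. x \<noteq> 0 \<and> odd (valuation p x)}"


section \<open>Completions\<close>

text \<open>At a finite prime \<open>P\<close>, the completion is the ring of \<open>P\<close>-adic Cauchy sequences modulo the ideal
  of null sequences.\<close>

definition cauchy_ring :: "'a::field poly \<Rightarrow> (nat \<Rightarrow> 'a poly fract) ring" where
  "cauchy_ring P =
     \<lparr>carrier = {x. \<forall>N. \<exists>M. \<forall>m\<ge>M. \<forall>n\<ge>M. valuation_ge (Fin P) N (x m - x n)},
      monoid.mult = (\<lambda>x y n. x n * y n),
      one = (\<lambda>n. 1),
      ring.zero = (\<lambda>n. 0),
      add = (\<lambda>x y n. x n + y n)\<rparr>"

definition null_seqs :: "'a::field poly \<Rightarrow> (nat \<Rightarrow> 'a poly fract) set" where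
  "null_seqs P = {x. \<forall>N. \<exists>M. \<forall>n\<ge>M. valuation_ge (Fin P) N (x n)}"

definition completion :: "'a::field poly \<Rightarrow> (nat \<Rightarrow> 'a poly fract) set ring" where
  "completion P = cauchy_ring P Quot null_seqs P"

definition to_completion :: "'a::field poly \<Rightarrow> 'a poly fract \<Rightarrow> (nat \<Rightarrow> 'a poly fract) set" where
  "to_completion P c = null_seqs P +>\<^bsub>cauchy_ring P\<^esub> (\<lambda>n. c)"

text \<open>At the infinite prime, the completion is the field of formal Laurent series in \<open>1/t\<close>: the variable
  \<open>fls_X\<close> plays the role of \<open>1/t\<close>, so that \<open>t\<close> is mapped to \<open>fls_X_inv\<close>.\<close>

definition poly_to_fls :: "'a::field poly \<Rightarrow> 'a fls" where
  "poly_to_fls A = (\<Sum>i\<le>degree A. fls_const (coeff A i) * fls_X_inv ^ i)"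

definition fract_to_fls :: "'a::field poly fract \<Rightarrow> 'a fls" where
  "fract_to_fls x = (THE z. \<exists>A B. B \<noteq> 0 \<and> x = Fract A B \<and> z = poly_to_fls A / poly_to_fls B)"

lemma poly_to_fls_nth: "fls_nth (poly_to_fls A) n = (if n \<le> 0 then coeff A (nat (- n)) else 0)"
proof -
  have "fls_nth (poly_to_fls A) n = (\<Sum>i\<le>degree A. if n = - int i then coeff A i else 0)"
    unfolding poly_to_fls_def fls_nth_sum
    by (intro sum.cong) (auto simp: fls_X_inv_power_conv_shift_1)
  also have "\<dots> = (\<Sum>i\<le>degree A. if i = nat (- n) then (if n \<le> 0 then coeff A i else 0) else 0)"
    by (intro sum.cong) auto
  also have "\<dots> = (if n \<le> 0 then coeff A (nat (- n)) else 0)"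
    by (auto simp: sum.delta coeff_eq_0)
  finally show ?thesis .
qed

lemma poly_to_fls_add: "poly_to_fls (A + B) = poly_to_fls A + poly_to_fls B"
  by (rule fls_eqI) (simp add: poly_to_fls_nth)

lemma poly_to_fls_pCons:
  "poly_to_fls (pCons c A) = fls_const c + fls_X_inv * poly_to_fls A"
  by (rule fls_eqI)
     (auto simp: poly_to_fls_nth fls_X_inv_times_conv_shift coeff_pCons nat_diff_distrib split: nat.split)

lemma poly_to_fls_smult: "poly_to_fls (smult c A) = fls_const c * poly_to_fls A"
  by (rule fls_eqI) (simp add: poly_to_fls_nth)

lemma poly_to_fls_mult: "poly_to_fls (A * B) = poly_to_fls A * poly_to_fls B"
proof (induction A)
  case 0
  show ?case by (simp add: poly_to_fls_def)
next
  case (pCons c A)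
  then show ?case
    by (simp add: poly_to_fls_add poly_to_fls_pCons poly_to_fls_smult distrib_right mult.assoc)
qed

lemma poly_to_fls_eq_0_iff: "poly_to_fls A = 0 \<longleftrightarrow> A = 0"
proof
  assume *: "poly_to_fls A = 0"
  have "coeff A n = 0" for n
    using poly_to_fls_nth[of A "- int n"] * by simp
  then show "A = 0" by (simp add: poly_eq_iff)
qed (simp add: poly_to_fls_def)

lemma fract_to_fls_Fract:
  assumes "B \<noteq> 0"
  shows "fract_to_fls (Fract A B) = poly_to_fls A / poly_to_fls B"
  unfolding fract_to_fls_def
proof (rule the_equality)
  fix z assume "\<exists>A' B'. B' \<noteq> 0 \<and> Fract A B = Fract A' B' \<and> z = poly_to_fls A' / poly_to_fls B'"
  then obtain A' B' where *: "B' \<noteq> 0" "Fract A B = Fract A' B'" "z = poly_to_fls A' / poly_to_fls B'"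
    by blast
  from * assms have "A * B' = A' * B" by (simp add: eq_fract)
  then have "poly_to_fls A * poly_to_fls B' = poly_to_fls A' * poly_to_fls B"
    by (metis poly_to_fls_mult)
  with * assms show "z = poly_to_fls A / poly_to_fls B"
    by (simp add: poly_to_fls_eq_0_iff frac_eq_eq)
qed (use assms in blast)


section \<open>Tensor products of algebras\<close>

text \<open>Let \<open>A\<close> and \<open>B\<close> be algebras over the field \<open>'k\<close> with structure maps \<open>f\<close> and \<open>g\<close>.  Their tensor
  product is the quotient of the integral monoid ring of \<open>A \<times> B\<close>, in which
  \<open>[x, y] [x', y'] = [x x', y y']\<close>, by the ideal generated by the relations of a \<open>'k\<close>-balanced map.\<close>

definition pair_ring ::
  "('x, 'm) ring_scheme \<Rightarrow> ('y, 'n) ring_scheme \<Rightarrow> ('x \<times> 'y \<Rightarrow>\<^sub>0 int) ring" where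
  "pair_ring A B =
     \<lparr>carrier = {u. Poly_Mapping.keys u \<subseteq> carrier A \<times> carrier B},
      monoid.mult = (\<lambda>u v. frag_extend (\<lambda>(x, y).
        frag_extend (\<lambda>(x', y'). frag_of (x \<otimes>\<^bsub>A\<^esub> x', y \<otimes>\<^bsub>B\<^esub> y')) v) u),
      one = frag_of (\<one>\<^bsub>A\<^esub>, \<one>\<^bsub>B\<^esub>),
      ring.zero = 0,
      add = (+)\<rparr>"

definition tensor_relations ::
  "('k \<Rightarrow> 'x) \<Rightarrow> ('x, 'm) ring_scheme \<Rightarrow> ('k \<Rightarrow> 'y) \<Rightarrow> ('y, 'n) ring_scheme \<Rightarrow> ('x \<times> 'y \<Rightarrow>\<^sub>0 int) set" where
  "tensor_relations f A g B =
     {frag_of (x \<oplus>\<^bsub>A\<^esub> x', y) - frag_of (x, y) - frag_of (x', y) | x x' y.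
        x \<in> carrier A \<and> x' \<in> carrier A \<and> y \<in> carrier B} \<union>
     {frag_of (x, y \<oplus>\<^bsub>B\<^esub> y') - frag_of (x, y) - frag_of (x, y') | x y y'.
        x \<in> carrier A \<and> y \<in> carrier B \<and> y' \<in> carrier B} \<union>
     {frag_of (f c \<otimes>\<^bsub>A\<^esub> x, y) - frag_of (x, g c \<otimes>\<^bsub>B\<^esub> y) | c x y.
        x \<in> carrier A \<and> y \<in> carrier B}"

definition tensor_algebra ::
  "('k \<Rightarrow> 'x) \<Rightarrow> ('x, 'm) ring_scheme \<Rightarrow> ('k \<Rightarrow> 'y) \<Rightarrow> ('y, 'n) ring_scheme \<Rightarrow> ('x \<times> 'y \<Rightarrow>\<^sub>0 int) set ring" where
  "tensor_algebra f A g B = pair_ring A B Quot (Idl\<^bsub>pair_ring A B\<^esub> (tensor_relations f A g B))"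

definition division_algebra :: "('x, 'm) ring_scheme \<Rightarrow> bool" where
  "division_algebra R \<longleftrightarrow> ring R \<and> \<one>\<^bsub>R\<^esub> \<noteq> \<zero>\<^bsub>R\<^esub> \<and> Units R = carrier R - {\<zero>\<^bsub>R\<^esub>}"


section \<open>Quaternion algebras\<close>

text \<open>\<open>(w, x, y, z)\<close> stands for \<open>w + x \<alpha> + y \<beta> + z \<alpha>\<beta>\<close>; the multiplication is the one determined by
  \<open>\<alpha>\<alpha> = a\<close>, \<open>\<beta>\<beta> = b\<close> and \<open>\<alpha>\<beta> = - \<beta>\<alpha>\<close>.\<close>

definition quaternion_algebra :: "'k::field \<Rightarrow> 'k \<Rightarrow> ('k \<times> 'k \<times> 'k \<times> 'k) ring" where
  "quaternion_algebra a b =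
     \<lparr>carrier = UNIV,
      monoid.mult = (\<lambda>(w, x, y, z) (w', x', y', z').
        (w * w' + a * x * x' + b * y * y' - a * b * z * z',
         w * x' + x * w' - b * y * z' + b * z * y',
         w * y' + y * w' + a * x * z' - a * z * x',
         w * z' + z * w' + x * y' - y * x')),
      one = (1, 0, 0, 0),
      ring.zero = (0, 0, 0, 0),
      add = (\<lambda>(w, x, y, z) (w', x', y', z'). (w + w', x + x', y + y', z + z'))\<rparr>"

definition quaternion_scalar :: "'k::field \<Rightarrow> 'k \<times> 'k \<times> 'k \<times> 'k" where
  "quaternion_scalar c = (c, 0, 0, 0)"

lemma ring_quaternion_algebra: "ring (quaternion_algebra a b)"
proof (rule ringI)
  show "abelian_group (quaternion_algebra a b)"
  proof (rule abelian_groupI)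
    fix u assume "u \<in> carrier (quaternion_algebra a b)"
    obtain w x y z where u: "u = (w, x, y, z)" by (cases u)
    show "\<exists>v\<in>carrier (quaternion_algebra a b).
            v \<oplus>\<^bsub>quaternion_algebra a b\<^esub> u = \<zero>\<^bsub>quaternion_algebra a b\<^esub>"
      by (rule bexI[of _ "(-w, -x, -y, -z)"]) (auto simp: quaternion_algebra_def u)
  qed (auto simp: quaternion_algebra_def)
  show "monoid (quaternion_algebra a b)"
    by (rule monoidI) (auto simp: quaternion_algebra_def algebra_simps)
qed (auto simp: quaternion_algebra_def algebra_simps)

lemma quaternion_relations:
  fixes a b :: "'k::field"
  defines "H \<equiv> quaternion_algebra a b"
    and "\<alpha> \<equiv> (0, 1, 0, 0)" and "\<beta> \<equiv> (0, 0, 1, 0)"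
  shows "\<alpha> \<otimes>\<^bsub>H\<^esub> \<alpha> = quaternion_scalar a" "\<beta> \<otimes>\<^bsub>H\<^esub> \<beta> = quaternion_scalar b"
    and "\<alpha> \<otimes>\<^bsub>H\<^esub> \<beta> = (0, 0, 0, 1)" "\<beta> \<otimes>\<^bsub>H\<^esub> \<alpha> = \<ominus>\<^bsub>H\<^esub> (\<alpha> \<otimes>\<^bsub>H\<^esub> \<beta>)"
proof -
  interpret H: ring H unfolding H_def by (rule ring_quaternion_algebra)
  show "\<beta> \<otimes>\<^bsub>H\<^esub> \<alpha> = \<ominus>\<^bsub>H\<^esub> (\<alpha> \<otimes>\<^bsub>H\<^esub> \<beta>)"
    by (intro H.minus_equality[symmetric])
       (auto simp: H_def \<alpha>_def \<beta>_def quaternion_algebra_def)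
qed (auto simp: H_def \<alpha>_def \<beta>_def quaternion_algebra_def quaternion_scalar_def)

primrec quaternion_localization_is_division ::
  "'a::field poly fract \<Rightarrow> 'a poly fract \<Rightarrow> 'a poly place \<Rightarrow> bool" where
  "quaternion_localization_is_division a b (Fin P) =
     division_algebra
       (tensor_algebra quaternion_scalar (quaternion_algebra a b) (to_completion P) (completion P))"
| "quaternion_localization_is_division a b Infty =
     division_algebra
       (tensor_algebra quaternion_scalar (quaternion_algebra a b)
          fract_to_fls (ring_of_type_algebra :: 'a fls ring))"

definition ramified_places :: "'a::field poly fract \<Rightarrow> 'a poly fract \<Rightarrow> 'a poly place set" where
  "ramified_places a b = {p \<in> places. quaternion_localization_is_division a b p}"


section \<open>The pairs and the sets in the theorem\<close>

definition polynomials :: "'a::field poly fract set" where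
  "polynomials = range to_fract"

definition const_fract :: "'a::field \<Rightarrow> 'a poly fract" where
  "const_fract c = to_fract [:c:]"

definition square_at_infinity :: "'a::field poly fract \<Rightarrow> bool" where
  "square_at_infinity c \<longleftrightarrow> (\<exists>y. fract_to_fls c = y ^ 2)"

text \<open>The degree is only defined for nonzero elements, so \<open>c\<close> and \<open>d\<close> are nonzero.\<close>

definition D_pairs :: "'a::field \<Rightarrow> ('a poly fract \<times> 'a poly fract) set" where
  "D_pairs \<epsilon> =
     {(a, b). \<exists>c d \<delta>. c \<noteq> 0 \<and> d \<noteq> 0 \<and> (even (fract_degree c) \<longleftrightarrow> odd (fract_degree d)) \<and> \<delta> \<noteq> 0 \<and>
        (square_at_infinity c \<and> a = const_fract \<epsilon> * c \<and> b = const_fract \<delta> * d \<or>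
         square_at_infinity d \<and> b = const_fract \<epsilon> * d \<and> a = const_fract \<delta> * c)}"

definition R_tilde :: "'a::field poly fract \<Rightarrow> 'a poly fract \<Rightarrow> 'a poly fract set" where
  "R_tilde a b = (\<Union>p \<in> ramified_places a b \<inter> (odd_places a \<union> odd_places b). valuation_ring p)"

end

(*
If (a, b) is in D_eps with c a square at infinity, then a has even degree, its leading coefficient is
a nonsquare, and b has odd degree; so infinity is ramified, which takes care of A_infinity. If no
finite prime were ramified, then every odd place of a or b would give a square residue; writing a, b
up to squares as constants times products of primes and multiplying the corresponding resultants, the
symmetry Res(A, B) = +-Res(B, A) would turn eps into a square. So some finite prime is ramified,
which takes care of A.

Conversely, if x has a pole at infinity and at a finite prime Q, it suffices to find a pair whose
ramified odd places all lie in {infinity, Q}. If deg Q is odd, (eps, Q) works. If deg Q is even, take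
(eps Q, t - l) with Q(l) a nonsquare: then eps Q(l) is a nonzero square, by Hensel eps Q becomes a
square in the completion at t - l, and the algebra splits there. Such an l exists: over a finite field
whose size is large compared with deg Q, a polynomial of even degree with only nonzero square values
is a square (Stepanov's method, with square roots of f(t + Y) truncated modulo powers of Y), and this
passes to the ultraproduct by Los's theorem.
*)
theory Submission
  imports Defs "HOL-Algebra.Free_Abelian_Groups"
begin

subsection \<open>Congruences modulo an ideal\<close>

text \<open>The first inclusion is proved over an arbitrary field with a nonsquare constant: it
  rests on the one-sided fact that a square modulo a prime has a square resultant. The ultraproduct
  enters only in the other inclusion, through three facts: 2 is nonzero, a product of two nonsquares
  is a square, and a polynomial with only nonzero square values is a square. For the third, the
  bound on q must depend on the degree alone, so the truncated square root is built without division
  and with a degree constant independent of the polynomial. Ramification is also treated one side at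
  a time. A parity argument on valuations makes the norm form anisotropic and yields division
  algebras; a square root of the first entry in the completion yields zero divisors. Anisotropy is
  stated over the uncompleted field with an explicit loss in valuation, because this is what makes a
  null sequence of norms force null sequences of coordinates.\<close>

definition ring_ideal :: "'a::comm_ring_1 set \<Rightarrow> bool" where
  "ring_ideal J \<longleftrightarrow> 0 \<in> J \<and> (\<forall>a\<in>J. \<forall>b\<in>J. a + b \<in> J) \<and> (\<forall>c. \<forall>a\<in>J. c * a \<in> J)"

text \<open>The extension of \<open>J\<close> to the polynomial ring. Iterating it gives the
  corresponding ideal of polynomials in two variables, where identities in \<open>t\<close> and
  \<open>Y\<close> are compared.\<close>

definition coeffs_in :: "'a::comm_ring_1 set \<Rightarrow> 'a poly set" where
  "coeffs_in J = {A. \<forall>i. coeff A i \<in> J}"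

context
  fixes J :: "'a::comm_ring_1 set"
  assumes J: "ring_ideal J"
begin

lemma ideal_zero: "0 \<in> J" using J by (auto simp: ring_ideal_def)
lemma ideal_add: "a \<in> J \<Longrightarrow> b \<in> J \<Longrightarrow> a + b \<in> J" using J by (auto simp: ring_ideal_def)
lemma ideal_mult: "a \<in> J \<Longrightarrow> c * a \<in> J" using J by (auto simp: ring_ideal_def)
lemma ideal_mult': "a \<in> J \<Longrightarrow> a * c \<in> J" using ideal_mult by (simp add: mult.commute)
lemma ideal_minus: "a \<in> J \<Longrightarrow> - a \<in> J" using ideal_mult[of a "-1"] by simp
lemma ideal_diff: "a \<in> J \<Longrightarrow> b \<in> J \<Longrightarrow> a - b \<in> J"
  using ideal_add[of a "-b"] ideal_minus[of b] by simp
lemma ideal_sum: "(\<And>x. x \<in> Z \<Longrightarrow> g x \<in> J) \<Longrightarrow> sum g Z \<in> J"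
  by (induction Z rule: infinite_finite_induct) (auto simp: ideal_zero ideal_add)

lemma ideal_cong_sym: "a - b \<in> J \<Longrightarrow> b - a \<in> J"
  using ideal_minus[of "a - b"] by simp

lemma ideal_cong_trans: "a - b \<in> J \<Longrightarrow> b - c \<in> J \<Longrightarrow> a - c \<in> J"
  using ideal_add[of "a - b" "b - c"] by simp

lemma ideal_cong_mult: "a - b \<in> J \<Longrightarrow> c - d \<in> J \<Longrightarrow> a * c - b * d \<in> J"
  using ideal_add[of "c * (a - b)" "b * (c - d)"] ideal_mult[of "a - b" c] ideal_mult[of "c - d" b]
  by (simp add: algebra_simps)

lemma ideal_cong_power: "a - b \<in> J \<Longrightarrow> a ^ n - b ^ n \<in> J"
  by (induction n) (auto simp: ideal_zero ideal_cong_mult)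

lemma ideal_cong_iff: "a - b \<in> J \<Longrightarrow> a \<in> J \<longleftrightarrow> b \<in> J"
  using ideal_add[of "a - b" b] ideal_diff[of a "a - b"] by auto

lemma ring_ideal_coeffs_in: "ring_ideal (coeffs_in J)"
  unfolding ring_ideal_def coeffs_in_def
  by (auto simp: ideal_zero ideal_add coeff_mult intro!: ideal_sum ideal_mult)

lemma const_in_coeffs_in: "c \<in> J \<Longrightarrow> [:c:] \<in> coeffs_in J"
  by (auto simp: coeffs_in_def coeff_pCons ideal_zero split: nat.split)

lemma poly_coeffs_in: "A \<in> coeffs_in J \<Longrightarrow> poly A x \<in> J"
  unfolding poly_altdef by (auto simp: coeffs_in_def intro!: ideal_sum ideal_mult')

text \<open>The ambient ring has characteristic zero in the application, so additivity of the
  \<open>p\<close>-th power is only a congruence: \<open>p\<close> divides the inner binomial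
  coefficients and lies in \<open>J\<close>.\<close>

lemma freshmans_dream_ideal:
  assumes "prime p" "of_nat p \<in> J"
  shows "(a + b) ^ p - (a ^ p + b ^ p) \<in> J"
proof -
  let ?t = "\<lambda>k. of_nat (p choose k) * a ^ k * b ^ (p - k)"
  have p: "p > 0" using assms(1) by (simp add: prime_gt_0_nat)
  have "(a + b) ^ p = (\<Sum>k\<le>p. ?t k)" by (rule binomial_ring)
  also have "{..p} = insert 0 (insert p {1..<p})" using p by auto
  also have "(\<Sum>k\<in>insert 0 (insert p {1..<p}). ?t k) = b ^ p + (a ^ p + (\<Sum>k=1..<p. ?t k))"
    using p by (subst sum.insert, simp, simp)+ simp
  finally have "(a + b) ^ p - (a ^ p + b ^ p) = (\<Sum>k=1..<p. ?t k)" by simp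
  moreover have "(\<Sum>k=1..<p. ?t k) \<in> J"
  proof (rule ideal_sum)
    fix k assume k: "k \<in> {1..<p}"
    then have "p dvd (p choose k)" using assms(1) by (intro dvd_choose_prime) auto
    then obtain c where "p choose k = p * c" by (elim dvdE)
    then show "?t k \<in> J" using ideal_mult[OF assms(2), of "of_nat c * a ^ k * b ^ (p - k)"]
      by (simp add: mult_ac)
  qed
  ultimately show ?thesis by simp
qed

lemma freshmans_dream_ideal_power:
  assumes "prime p" "of_nat p \<in> J"
  shows "(a + b) ^ (p ^ e) - (a ^ (p ^ e) + b ^ (p ^ e)) \<in> J"
proof (induction e)
  case (Suc e)
  let ?q = "p ^ e"
  have "((a + b) ^ ?q) ^ p - (a ^ ?q + b ^ ?q) ^ p \<in> J" by (rule ideal_cong_power[OF Suc])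
  then show ?case
    using ideal_cong_trans freshmans_dream_ideal[OF assms, of "a ^ ?q" "b ^ ?q"]
    by (metis power_Suc2 power_mult)
qed (simp add: ideal_zero)

end

section \<open>Monic division and roots modulo an ideal\<close>

definition prime_ring_ideal :: "'a::comm_ring_1 set \<Rightarrow> bool" where
  "prime_ring_ideal J \<longleftrightarrow> ring_ideal J \<and> 1 \<notin> J \<and> (\<forall>a b. a * b \<in> J \<longrightarrow> a \<in> J \<or> b \<in> J)"

lemma prime_ring_ideal_power:
  assumes "prime_ring_ideal J" "a ^ n \<in> J" shows "a \<in> J"
  using assms(2) by (induction n) (use assms(1) in \<open>auto simp: prime_ring_ideal_def\<close>)

text \<open>Uniqueness of division with remainder by a monic \<open>H\<close>: a highest coefficient
  of \<open>C\<close> outside \<open>J\<close> would reappear in \<open>H * C\<close> in a degree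
  where \<open>A\<close> has its coefficient in \<open>J\<close>.\<close>

lemma monic_mult_cong:
  fixes H :: "'a::comm_ring_1 poly"
  assumes J: "ring_ideal J" and H: "lead_coeff H = 1" "degree H = d"
    and A: "\<And>i. i \<ge> d \<Longrightarrow> coeff A i \<in> J" and HC: "H * C - A \<in> coeffs_in J"
  shows "C \<in> coeffs_in J" "A \<in> coeffs_in J"
proof -
  show C: "C \<in> coeffs_in J"
  proof (rule ccontr)
    assume "C \<notin> coeffs_in J"
    then have ex: "\<exists>n. coeff C n \<notin> J" by (auto simp: coeffs_in_def)
    have bound: "n \<le> degree C" if "coeff C n \<notin> J" for n
      using that ideal_zero[OF J] by (metis le_degree)
    define n where "n = (GREATEST n. coeff C n \<notin> J)"
    have n: "coeff C n \<notin> J" unfolding n_def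
      using ex bound by (metis (mono_tags, lifting) GreatestI_nat)
    have gt: "coeff C i \<in> J" if "i > n" for i
      using Greatest_le_nat[of "\<lambda>n. coeff C n \<notin> J" i "degree C"] bound that
      unfolding n_def by fastforce
    \<comment> \<open>In degree \<open>n + d\<close> only \<open>i = d\<close> matters: for
      \<open>i < d\<close> the factor from \<open>C\<close> has index above \<open>n\<close> and
      lies in \<open>J\<close>, and for \<open>i > d\<close> the coefficient of \<open>H\<close> is
      zero.\<close>
    have "coeff (H * C) (n + d) = (\<Sum>i\<le>n + d. coeff H i * coeff C (n + d - i))"
      by (simp add: coeff_mult)
    also have "\<dots> = coeff C n + (\<Sum>i\<in>{..n + d} - {d}. coeff H i * coeff C (n + d - i))"
      using H by (subst sum.remove[of _ d]) auto
    finally have eq: "coeff (H * C) (n + d) = \<dots>" .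
    have "(\<Sum>i\<in>{..n + d} - {d}. coeff H i * coeff C (n + d - i)) \<in> J"
    proof (rule ideal_sum[OF J])
      fix i assume i: "i \<in> {..n + d} - {d}"
      show "coeff H i * coeff C (n + d - i) \<in> J"
      proof (cases "i < d")
        case True
        then show ?thesis by (intro ideal_mult[OF J] gt) auto
      next
        case False
        then show ?thesis using i H(2) by (simp add: coeff_eq_0 ideal_zero[OF J])
      qed
    qed
    moreover have "coeff (H * C) (n + d) - coeff A (n + d) \<in> J"
      using HC by (auto simp: coeffs_in_def)
    ultimately have "coeff C n \<in> J"
      using eq A[of "n + d"] ideal_cong_iff[OF J] by (metis add_diff_cancel_left' le_add2 ideal_diff[OF J])
    with n show False by simp
  qed
  note PJ = ring_ideal_coeffs_in[OF J]
  show "A \<in> coeffs_in J"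
    using ideal_cong_iff[OF PJ HC] ideal_mult[OF PJ C] by simp
qed

text \<open>Uniqueness of base-\<open>H\<close> digits: the lowest digit is a remainder modulo
  \<open>H\<close>, so it vanishes modulo \<open>J\<close> together with the cofactor, to which the
  same argument applies. This later lifts an identity at \<open>Y = H\<close> to an identity in
  \<open>Y\<close>.\<close>

lemma poly_digits_in_ideal:
  fixes H :: "'a::comm_ring_1 poly"
  assumes J: "ring_ideal J" and H: "lead_coeff H = 1"
    and E: "\<And>j. degree (coeff E j) < degree H" and "poly E H \<in> coeffs_in J"
  shows "E \<in> coeffs_in (coeffs_in J)"
  using assms(3,4)
proof (induction E)
  case 0
  then show ?case by (simp add: coeffs_in_def ideal_zero[OF J])
next
  case (pCons e E)
  note PJ = ring_ideal_coeffs_in[OF J]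
  have "degree (- e) < degree H" using pCons.prems(1)[of 0] by simp
  then have deg: "coeff (- e) i \<in> J" if "i \<ge> degree H" for i
    using that by (subst coeff_eq_0) (auto simp: ideal_zero[OF J])
  have "H * poly E H - (- e) \<in> coeffs_in J" using pCons.prems(2) by (simp add: algebra_simps)
  note * = monic_mult_cong[OF J H refl deg this]
  have "E \<in> coeffs_in (coeffs_in J)"
  proof (rule pCons.IH)
    show "degree (coeff E j) < degree H" for j using pCons.prems(1)[of "Suc j"] by simp
  qed (use *(1) in simp)
  then show ?case using ideal_minus[OF PJ *(2)]
    by (auto simp: coeffs_in_def coeff_pCons split: nat.split)
qed

text \<open>Primality of \<open>J\<close> lets a further root pass from \<open>A\<close> to the
  cofactor \<open>B\<close>: the product of the differences of the roots stays outside
  \<open>J\<close>.\<close>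

lemma root_product_dvd_cong:
  fixes A :: "'a::comm_ring_1 poly"
  assumes J: "prime_ring_ideal J" and "finite Z" and "\<And>x. x \<in> Z \<Longrightarrow> poly A x \<in> J"
    and "\<And>x y. x \<in> Z \<Longrightarrow> y \<in> Z \<Longrightarrow> x - y \<in> J \<Longrightarrow> x = y"
  shows "\<exists>B. A - (\<Prod>x\<in>Z. [:- x, 1:]) * B \<in> coeffs_in J"
  using assms(2-)
proof (induction Z)
  case empty
  then show ?case using J by (intro exI[of _ A]) (auto simp: coeffs_in_def prime_ring_ideal_def ideal_zero)
next
  case (insert x Z)
  have J': "ring_ideal J" using J by (simp add: prime_ring_ideal_def)
  note PJ = ring_ideal_coeffs_in[OF J']
  note sep = insert.prems(2)
  obtain B where B: "A - (\<Prod>x\<in>Z. [:- x, 1:]) * B \<in> coeffs_in J" using insert by auto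
  let ?P = "\<Prod>x\<in>Z. [:- x, 1:]"
  have "poly ?P x * poly B x \<in> J"
    using poly_coeffs_in[OF J' B, of x] insert.prems(1)[of x] ideal_cong_iff[OF J'] by fastforce
  moreover have "poly ?P x \<notin> J"
  proof
    assume "poly ?P x \<in> J"
    then have "(\<Prod>y\<in>Z. x - y) \<in> J" by (simp add: poly_prod)
    moreover have "(\<Prod>y\<in>Y. x - y) \<notin> J" if "Y \<subseteq> Z" for Y
      using finite_subset[OF that insert.hyps(1)] that
    proof (induction Y)
      case empty
      then show ?case using J by (simp add: prime_ring_ideal_def)
    next
      case (insert y Y)
      then have "x - y \<notin> J" using sep[of x y] \<open>x \<notin> Z\<close> by auto
      then show ?case using insert J by (auto simp: prime_ring_ideal_def)
    qed
    ultimately show False by blast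
  qed
  ultimately have "poly B x \<in> J" using J by (auto simp: prime_ring_ideal_def)
  then have "[:poly B x:] \<in> coeffs_in J" by (rule const_in_coeffs_in[OF J'])
  then have "?P * [:poly B x:] \<in> coeffs_in J" by (rule ideal_mult[OF PJ])
  moreover have "B = [:- x, 1:] * synthetic_div B x + [:poly B x:]"
    using synthetic_div_correct'[of x B] by simp
  then have eq: "?P * B = ?P * ([:- x, 1:] * synthetic_div B x) + ?P * [:poly B x:]"
    by (metis distrib_left)
  have "A - ?P * ([:- x, 1:] * synthetic_div B x) = A - ?P * B + ?P * [:poly B x:]"
    by (subst eq) (simp only: diff_diff_eq[symmetric] diff_add_cancel)
  ultimately have "A - ?P * ([:- x, 1:] * synthetic_div B x) \<in> coeffs_in J"
    using ideal_add[OF PJ B, of "?P * [:poly B x:]"] by (simp only:)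
  then show ?case
    by (intro exI[of _ "synthetic_div B x"]) (simp only: prod.insert[OF insert.hyps] mult_ac)
qed

subsection \<open>Square roots of a shifted polynomial to finite order\<close>

text \<open>A bound on the degree in \<open>t\<close> of a polynomial in \<open>Y\<close> over the
  polynomials in \<open>t\<close>. It has to stay below \<open>q\<close> for the coefficients to act
  as digits.\<close>

definition coeff_degree_le :: "nat \<Rightarrow> 'a::comm_ring_1 poly poly \<Rightarrow> bool" where
  "coeff_degree_le C E \<longleftrightarrow> (\<forall>j. degree (coeff E j) \<le> C)"

lemma coeff_degree_le_mono: "coeff_degree_le C E \<Longrightarrow> C \<le> C' \<Longrightarrow> coeff_degree_le C' E"
  by (auto simp: coeff_degree_le_def intro: le_trans)

lemma coeff_degree_le_add: "coeff_degree_le C E \<Longrightarrow> coeff_degree_le C E' \<Longrightarrow> coeff_degree_le C (E + E')"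
  by (auto simp: coeff_degree_le_def intro: degree_add_le)

lemma coeff_degree_le_diff: "coeff_degree_le C E \<Longrightarrow> coeff_degree_le C E' \<Longrightarrow> coeff_degree_le C (E - E')"
  by (auto simp: coeff_degree_le_def intro: degree_diff_le)

lemma coeff_degree_le_mult:
  assumes "coeff_degree_le C E" "coeff_degree_le D E'"
  shows "coeff_degree_le (C + D) (E * E')"
  unfolding coeff_degree_le_def coeff_mult
proof (intro allI degree_sum_le)
  fix j i
  have "degree (coeff E i * coeff E' (j - i)) \<le> degree (coeff E i) + degree (coeff E' (j - i))"
    by (rule degree_mult_le)
  also have "\<dots> \<le> C + D" using assms by (simp add: coeff_degree_le_def add_mono)
  finally show "degree (coeff E i * coeff E' (j - i)) \<le> C + D" .
qed simp

lemma coeff_degree_le_pCons: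
  "coeff_degree_le C (pCons e E) \<longleftrightarrow> degree e \<le> C \<and> coeff_degree_le C E"
proof -
  have "(\<forall>j. degree (coeff (pCons e E) j) \<le> C) \<longleftrightarrow> degree (coeff (pCons e E) 0) \<le> C \<and>
      (\<forall>j. degree (coeff (pCons e E) (Suc j)) \<le> C)"
    by (metis not0_implies_Suc)
  then show ?thesis by (simp add: coeff_degree_le_def)
qed

lemma coeff_degree_le_0 [simp]: "coeff_degree_le C 0"
  by (simp add: coeff_degree_le_def)

lemma coeff_degree_le_monom [simp]: "coeff_degree_le 0 (monom 1 n)"
  by (simp add: coeff_degree_le_def)

text \<open>The polynomial \<open>f (t + Y)\<close> as a polynomial in \<open>Y\<close> over the polynomials in \<open>t\<close>.\<close>

definition shifted :: "'a::comm_ring_1 poly \<Rightarrow> 'a poly poly" where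
  "shifted f = pcompose (map_poly (\<lambda>c. [:c:]) f) [:[:0, 1:], 1:]"

lemma shifted_pCons: "shifted (pCons c f) = [:[:c:]:] + [:[:0, 1:], 1:] * shifted f"
  by (simp add: shifted_def map_poly_pCons pcompose_pCons)

lemma shifted_0 [simp]: "shifted 0 = 0"
  by (simp add: shifted_def)

lemma coeff_degree_le_shifted: "coeff_degree_le (degree f) (shifted f)"
proof (induction f)
  case (pCons c f)
  show ?case
  proof (cases "f = 0")
    case False
    have "coeff_degree_le (1 + degree f) ([:[:0, 1:], 1:] * shifted f)"
      by (intro coeff_degree_le_mult pCons) (simp add: coeff_degree_le_pCons)
    moreover have "coeff_degree_le (1 + degree f) [:[:c:]:]" by (simp add: coeff_degree_le_pCons)
    ultimately show ?thesis using False by (simp add: shifted_pCons coeff_degree_le_add del: mult_pCons_left)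
  qed (simp add: shifted_pCons coeff_degree_le_pCons)
qed simp

lemma coeff_shifted_0: "coeff (shifted f) 0 = f"
  by (induction f) (simp_all add: shifted_pCons)

lemma poly_shifted: "poly (shifted f) h = pcompose f ([:0, 1:] + h)"
  by (induction f) (simp_all add: shifted_pCons pcompose_pCons algebra_simps)

text \<open>The specialisation \<open>t = 0\<close>, which recovers a statement about
  \<open>f\<close> alone from an identity in \<open>t\<close> and \<open>Y\<close>.\<close>

lemma map_poly_shifted: "map_poly (\<lambda>A. poly A 0) (shifted f) = f"
proof (induction f)
  case (pCons c f)
  have "map_poly (\<lambda>A. poly A 0) ([:[:0, 1:], 1:] * E) = pCons 0 (map_poly (\<lambda>A. poly A 0) E)"
    for E :: "'a poly poly"
    by (rule poly_eqI) (simp add: coeff_map_poly coeff_pCons split: nat.split)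
  moreover have "map_poly (\<lambda>A. poly A 0) (E + E') =
      map_poly (\<lambda>A. poly A 0) E + map_poly (\<lambda>A. poly A 0) E'" for E E' :: "'a poly poly"
    by (rule poly_eqI) (simp add: coeff_map_poly)
  ultimately show ?case by (simp add: shifted_pCons pCons map_poly_pCons del: mult_pCons_left)
qed simp

text \<open>Up to the factor \<open>u\<close>, \<open>G\<close> is a square root of \<open>f f (t + Y)\<close> modulo \<open>Y ^ Suc n\<close> with constant
  coefficient \<open>f\<close>; the factor clears denominators, and \<open>C\<close> does not depend on \<open>f\<close>.\<close>

lemma truncated_sqrt_shifted:
  "\<exists>C. \<forall>f::'a::comm_ring_1 poly. degree f \<le> N \<longrightarrow> (\<exists>a b G1 R.
     let u = 2 ^ a * f ^ b; G = pCons (u * f) G1 in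
       G ^ 2 = [:u ^ 2 * f:] * shifted f + monom 1 (Suc n) * R \<and>
       degree G \<le> n \<and> coeff_degree_le C G \<and> coeff_degree_le C R \<and> degree u \<le> C)"
proof (induction n)
  case 0
  show ?case
  proof (rule exI[of _ "2 * N"], intro allI impI)
    \<comment> \<open>Here \<open>u = 1\<close> and \<open>G = f\<close>. Writing f(t + Y) as f + Y
      g, the error is \<open>R = - f g\<close>, of degree at most \<open>2 * N\<close> in
      \<open>t\<close>.\<close>
    fix f :: "'a poly" assume f: "degree f \<le> N"
    obtain g where g: "shifted f = pCons f g"
      using coeff_shifted_0[of f] by (metis coeff_pCons_0 pCons_cases)
    have "coeff_degree_le N g"
      using coeff_degree_le_shifted[of f] f by (auto simp: g coeff_degree_le_pCons intro: coeff_degree_le_mono)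
    then have R: "coeff_degree_le (N + N) ([:- f:] * g)"
      using f by (intro coeff_degree_le_mult) (auto simp: coeff_degree_le_pCons)
    show "\<exists>a b G1 R. let u = 2 ^ a * f ^ b; G = pCons (u * f) G1 in
       G ^ 2 = [:u ^ 2 * f:] * shifted f + monom 1 (Suc 0) * R \<and>
       degree G \<le> 0 \<and> coeff_degree_le (2 * N) G \<and> coeff_degree_le (2 * N) R \<and> degree u \<le> 2 * N"
      using f R by (intro exI[of _ 0] exI[of _ "0::'a poly poly"] exI[of _ "[:- f:] * g"])
        (auto simp: g power2_eq_square monom_altdef coeff_degree_le_pCons mult_2)
  qed
next
  case (Suc n)
  then obtain C where C: "\<And>f::'a poly. degree f \<le> N \<Longrightarrow> \<exists>a b G1 R.
     let u = 2 ^ a * f ^ b; G = pCons (u * f) G1 in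
       G ^ 2 = [:u ^ 2 * f:] * shifted f + monom 1 (Suc n) * R \<and>
       degree G \<le> n \<and> coeff_degree_le C G \<and> coeff_degree_le C R \<and> degree u \<le> C" by blast
  \<comment> \<open>The largest of the degree bounds below, namely \<open>2 * (C + N) + C\<close>
    for the product of the squared factor c = 2 u f with \<open>R1\<close>.\<close>
  define C' where "C' = 3 * C + 2 * N"
  show ?case
  proof (rule exI[of _ C'], intro allI impI)
    fix f :: "'a poly" assume f: "degree f \<le> N"
    obtain a b G1 R u G where u: "u = 2 ^ a * f ^ b" and G: "G = pCons (u * f) G1"
      and eq: "G ^ 2 = [:u ^ 2 * f:] * shifted f + monom 1 (Suc n) * R"
      and bds: "degree G \<le> n" "coeff_degree_le C G" "coeff_degree_le C R" "degree u \<le> C"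
      using C[OF f] unfolding Let_def by blast
    obtain R0 R1 where R: "R = pCons R0 R1" by (cases R)
    \<comment> \<open>The new root is \<open>c G - R0 Y^(n+1)\<close> with c = 2 u f, so
      \<open>u\<close> is replaced by c u = 2 u^2 f. In degree n + 1 the error c^2 \<open>R0\<close>
      cancels against the cross term 2 c \<open>R0\<close> u f, and no division occurs.\<close>
    define v where "v = 2 ^ (2 * a + 1) * f ^ (2 * b + 1)"
    have v: "v = 2 * u ^ 2 * f" by (simp add: v_def u power_mult_distrib power_mult mult_ac power2_eq_square)
    let ?Y = "[:0, 1:] :: 'a poly poly"
    let ?c = "2 * u * f"
    define H1 where "H1 = [:?c:] * G1 - monom R0 n"
    define R' where "R' = [:?c\<^sup>2:] * R1 - [:2 * ?c * R0:] * G1 + monom (R0 ^ 2) n"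
    define H where "H = pCons (v * f) H1"
    have mon: "monom c k = [:c:] * ?Y ^ k" for c k by (simp add: monom_altdef)
    have H': "H = [:?c:] * G - [:R0:] * ?Y ^ Suc n"
      by (simp add: H_def H1_def G v mon power2_eq_square algebra_simps)
    have G': "G = [:u * f:] + ?Y * G1" and R'': "R = [:R0:] + ?Y * R1" by (simp_all add: G R)
    have "H ^ 2 = [:?c:] ^ 2 * G ^ 2 - 2 * [:?c:] * [:R0:] * ?Y ^ Suc n * G + [:R0:] ^ 2 * (?Y ^ Suc n) ^ 2"
      unfolding H' by (simp only: power2_eq_square) (simp only: algebra_simps mult_2 mult_2_right)
    also have "[:?c:] ^ 2 * G ^ 2 = [:?c:] ^ 2 * ([:u ^ 2 * f:] * shifted f) + [:?c:] ^ 2 * (?Y ^ Suc n * R)"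
      unfolding eq by (simp only: mon distrib_left) (simp only: one_pCons[symmetric] mult_1_left)
    also have "[:?c:] ^ 2 * ([:u ^ 2 * f:] * shifted f) = [:v ^ 2 * f:] * shifted f"
    proof -
      have "[:?c:] ^ 2 * [:u ^ 2 * f:] = [:v ^ 2 * f:]"
        by (simp add: v power2_eq_square mult_ac)
      then show ?thesis by (simp only: mult.assoc[symmetric])
    qed
    finally have H2: "H ^ 2 = [:v ^ 2 * f:] * shifted f + [:?c:] ^ 2 * (?Y ^ Suc n * R)
        - 2 * [:?c:] * [:R0:] * ?Y ^ Suc n * G + [:R0:] ^ 2 * (?Y ^ Suc n) ^ 2" .
    have two: "(2 :: 'a poly poly) = [:2:]" by (simp only: numeral_poly)
    have *: "[:?c:] ^ 2 * [:R0:] = 2 * [:?c:] * [:R0:] * [:u * f:]"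
      by (simp add: two power2_eq_square mult_ac)
    have "[:?c:] ^ 2 * (?Y ^ Suc n * R) - 2 * [:?c:] * [:R0:] * ?Y ^ Suc n * G + [:R0:] ^ 2 * (?Y ^ Suc n) ^ 2
      = ?Y ^ Suc n * ([:?c:] ^ 2 * [:R0:] - 2 * [:?c:] * [:R0:] * [:u * f:])
        + ?Y ^ Suc (Suc n) * ([:?c:] ^ 2 * R1 - 2 * [:?c:] * [:R0:] * G1 + [:R0:] ^ 2 * ?Y ^ n)"
      unfolding G' R'' power_Suc by (simp only: power2_eq_square) (simp only: algebra_simps)
    also have "[:?c:] ^ 2 * R1 - 2 * [:?c:] * [:R0:] * G1 + [:R0:] ^ 2 * ?Y ^ n = R'"
      by (simp add: R'_def mon two power2_eq_square mult_ac)
    finally have tail: "[:?c:] ^ 2 * (?Y ^ Suc n * R) - 2 * [:?c:] * [:R0:] * ?Y ^ Suc n * G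
      + [:R0:] ^ 2 * (?Y ^ Suc n) ^ 2 = monom 1 (Suc (Suc n)) * R'"
      by (simp only: * monom_altdef smult_1_left) (simp only: algebra_simps)
    have "H ^ 2 = [:v ^ 2 * f:] * shifted f + ([:?c:] ^ 2 * (?Y ^ Suc n * R)
      - 2 * [:?c:] * [:R0:] * ?Y ^ Suc n * G + [:R0:] ^ 2 * (?Y ^ Suc n) ^ 2)"
      unfolding H2 by (simp only: algebra_simps)
    then have "H ^ 2 = [:v ^ 2 * f:] * shifted f + monom 1 (Suc (Suc n)) * R'"
      unfolding tail .
    moreover have degH: "degree H \<le> Suc n"
    proof -
      have "degree ([:?c:] * G) \<le> Suc n"
        using degree_mult_le[of "[:?c:]" G] bds(1) by simp
      moreover have "degree ([:R0:] * ?Y ^ Suc n) \<le> Suc n"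
        by (metis degree_monom_le mon)
      ultimately show ?thesis unfolding H' by (rule degree_diff_le)
    qed
    have dc: "degree ?c \<le> C + N"
      using degree_mult_le[of "2 * u" f] degree_mult_le[of 2 u] bds(4) f by simp
    have dR0: "degree R0 \<le> C" "coeff_degree_le C R1" "coeff_degree_le C G1"
      using bds by (auto simp: R G coeff_degree_le_pCons)
    have dY: "coeff_degree_le 0 (?Y ^ k)" for k
      by (metis coeff_degree_le_monom monom_altdef smult_1_left)
    moreover have "coeff_degree_le C' H"
      unfolding H' C'_def
    proof (rule coeff_degree_le_diff)
      show "coeff_degree_le (3 * C + 2 * N) ([:?c:] * G)"
        using coeff_degree_le_mult[of "C + N" "[:?c:]" C G] dc bds(2)
        by (auto simp: coeff_degree_le_pCons elim: coeff_degree_le_mono)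
      show "coeff_degree_le (3 * C + 2 * N) ([:R0:] * ?Y ^ Suc n)"
        using coeff_degree_le_mult[of C "[:R0:]" 0 "?Y ^ Suc n"] dR0 dY
        by (auto simp: coeff_degree_le_pCons elim: coeff_degree_le_mono)
    qed
    moreover have "coeff_degree_le C' R'"
    proof -
      have 1: "coeff_degree_le (2 * (C + N) + C) ([:?c\<^sup>2:] * R1)"
        by (intro coeff_degree_le_mult dR0)
          (use dc degree_power_le[of ?c 2] in \<open>auto simp: coeff_degree_le_pCons\<close>)
      have "degree (2 * ?c * R0) \<le> (C + N) + C"
        using degree_mult_le[of "2 * ?c" R0] degree_mult_le[of 2 ?c] dc dR0 by simp
      then have 2: "coeff_degree_le ((C + N) + C + C) ([:2 * ?c * R0:] * G1)"
        by (intro coeff_degree_le_mult dR0) (auto simp: coeff_degree_le_pCons)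
      have 3: "coeff_degree_le (2 * C + 0) ([:R0 ^ 2:] * ?Y ^ n)"
        by (intro coeff_degree_le_mult dY)
          (use dR0 degree_power_le[of R0 2] in \<open>auto simp: coeff_degree_le_pCons\<close>)
      show ?thesis unfolding R'_def mon C'_def
        by (intro coeff_degree_le_add coeff_degree_le_diff)
          (rule coeff_degree_le_mono[OF 1] coeff_degree_le_mono[OF 2] coeff_degree_le_mono[OF 3]; simp)+
    qed
    moreover have "degree v \<le> C'"
    proof -
      have "degree v \<le> degree (2 * u ^ 2) + degree f" unfolding v by (rule degree_mult_le)
      moreover have "degree (2 * u ^ 2) \<le> degree (u ^ 2)" using degree_mult_le[of 2 "u ^ 2"] by simp
      moreover have "degree (u ^ 2) \<le> 2 * degree u" using degree_power_le[of u 2] by (simp add: mult.commute)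
      ultimately show ?thesis using bds(4) f by (simp add: C'_def)
    qed
    ultimately have "let u = 2 ^ (2 * a + 1) * f ^ (2 * b + 1); G = pCons (u * f) H1 in
       G ^ 2 = [:u ^ 2 * f:] * shifted f + monom 1 (Suc (Suc n)) * R' \<and>
       degree G \<le> Suc n \<and> coeff_degree_le C' G \<and> coeff_degree_le C' R' \<and> degree u \<le> C'"
      unfolding Let_def v_def[symmetric] H_def[symmetric] using degH by blast
    then show "\<exists>a b G1 R. let u = 2 ^ a * f ^ b; G = pCons (u * f) G1 in
       G ^ 2 = [:u ^ 2 * f:] * shifted f + monom 1 (Suc (Suc n)) * R \<and>
       degree G \<le> Suc n \<and> coeff_degree_le C' G \<and> coeff_degree_le C' R \<and> degree u \<le> C'"
      by blast
  qed
qed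

text \<open>The coefficient ring may have zero divisors; the leading coefficient 1 keeps degrees
  additive.\<close>

lemma monic_mult_degree:
  fixes A B :: "'a::comm_ring_1 poly"
  assumes "lead_coeff A = 1" "lead_coeff B = 1"
  shows "degree (A * B) = degree A + degree B" "lead_coeff (A * B) = 1"
proof -
  have c: "coeff (A * B) (degree A + degree B) = 1"
    using assms by (simp add: coeff_mult_degree_sum)
  show "degree (A * B) = degree A + degree B"
    using c degree_mult_le[of A B] by (metis le_antisym le_degree one_neq_zero)
  then show "lead_coeff (A * B) = 1" using c by simp
qed

subsection \<open>Polynomials with square values\<close>

text \<open>A finite field is represented as the quotient of a ring of class \<open>comm_ring_1\<close> by the prime ideal
  \<open>I\<close>, because the type-class polynomials are not available over a record of type \<open>'f ring\<close>.\<close>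

locale finite_residue_field =
  fixes I :: "'a::comm_ring_1 set" and q :: nat
  assumes prime_I: "prime_ring_ideal I"
    and fermat: "z ^ q - z \<in> I"
    and primepow_q: "primepow q"
    and of_nat_q: "of_nat q \<in> I"
    and representatives: "\<exists>Z. finite Z \<and> card Z = q \<and> (\<forall>x\<in>Z. \<forall>y\<in>Z. x - y \<in> I \<longrightarrow> x = y)"
begin

lemma ideal_I: "ring_ideal I" and one_notin: "1 \<notin> I"
  using prime_I by (auto simp: prime_ring_ideal_def)

lemma mult_in_I_iff: "a * b \<in> I \<longleftrightarrow> a \<in> I \<or> b \<in> I"
  using prime_I ideal_mult[OF ideal_I] ideal_mult'[OF ideal_I] by (auto simp: prime_ring_ideal_def)

lemma ideal_coeffs: "ring_ideal (coeffs_in I)"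
  by (rule ring_ideal_coeffs_in[OF ideal_I])

lemma q_gt_1: "q > 1"
  using primepow_q primepow_gt_Suc_0 by auto

lemma fermat': assumes "z \<notin> I" shows "z ^ (q - 1) - 1 \<in> I"
proof -
  have "z * (z ^ (q - 1) - 1) = z ^ q - z"
    using q_gt_1 by (cases q) (auto simp: algebra_simps)
  then show ?thesis using fermat[of z] assms mult_in_I_iff by metis
qed

lemma inverse_mod: assumes "z \<notin> I" shows "\<exists>z'. z * z' - 1 \<in> I"
proof (cases "q = 2")
  case True
  then show ?thesis using fermat'[OF assms] by (intro exI[of _ 1]) simp
next
  case False
  then have "z * z ^ (q - 2) = z ^ (q - 1)"
    using q_gt_1 by (metis Suc_diff_Suc diff_Suc_1 numeral_2_eq_2 power_Suc less_antisym not_less_eq One_nat_def)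
  then show ?thesis using fermat'[OF assms] by metis
qed

definition frob_poly :: "'a poly" where "frob_poly = monom 1 q - monom 1 1"

lemma frob_poly_props: "degree frob_poly = q" "lead_coeff frob_poly = 1"
  "poly frob_poly x = x ^ q - x" "[:0, 1:] + frob_poly = monom 1 q"
proof -
  have "degree (monom (1::'a) 1) < degree (monom (1::'a) q)" using q_gt_1 by (simp add: degree_monom_eq)
  then show "degree frob_poly = q"
    unfolding frob_poly_def diff_conv_add_uminus
    by (subst degree_add_eq_left) (auto simp: degree_monom_eq)
  then show "lead_coeff frob_poly = 1" using q_gt_1 by (simp add: frob_poly_def)
  show "poly frob_poly x = x ^ q - x" by (simp add: frob_poly_def poly_monom)
  show "[:0, 1:] + frob_poly = monom 1 q" by (simp add: frob_poly_def monom_altdef)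
qed

text \<open>Modulo \<open>I\<close>, \<open>frob_poly\<close> is the product of the linear factors
  over \<open>q\<close> representatives, and roots that are distinct modulo a prime ideal can be
  split off together.\<close>

lemma frob_poly_dvd_cong:
  assumes "\<And>x. poly A x \<in> I" shows "\<exists>B. A - frob_poly * B \<in> coeffs_in I"
proof -
  obtain Z where Z: "finite Z" "card Z = q" "\<And>x y. x \<in> Z \<Longrightarrow> y \<in> Z \<Longrightarrow> x - y \<in> I \<Longrightarrow> x = y"
    using representatives by blast
  let ?P = "\<Prod>x\<in>Z. [:- x, 1:]"
  have P: "degree ?P = q \<and> lead_coeff ?P = 1"
  proof -
    have "degree (\<Prod>x\<in>Y. [:- x, 1:]) = card Y \<and> lead_coeff (\<Prod>x\<in>Y. [:- x, 1:]) = 1"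
      if "finite Y" for Y :: "'a set"
      using that
    proof (induction Y)
      case (insert y Y)
      let ?Q = "\<Prod>x\<in>Y. [:- x, 1:]"
      have 1: "lead_coeff [:- y, 1:] = 1" "degree [:- y, 1:] = 1" by simp_all
      show ?case
        unfolding prod.insert[OF insert.hyps] card_insert_disjoint[OF insert.hyps]
        using monic_mult_degree[OF 1(1), of ?Q] insert.IH 1(2) by (metis plus_1_eq_Suc)
    qed simp
    then show ?thesis using Z by metis
  qed
  \<comment> \<open>The leading terms cancel, so \<open>A'\<close> has degree below \<open>q\<close>
    but \<open>q\<close> roots modulo \<open>I\<close>; hence it vanishes modulo
    \<open>I\<close>.\<close>
  define A' where "A' = frob_poly - ?P"
  have deg: "coeff A' i \<in> I" if "i \<ge> q" for i
  proof (cases "i = q")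
    case True
    then show ?thesis using P frob_poly_props by (auto simp: A'_def ideal_zero[OF ideal_I])
  next
    case False
    then show ?thesis using P frob_poly_props that by (simp add: A'_def coeff_eq_0 ideal_zero[OF ideal_I])
  qed
  have "\<exists>B. A' - ?P * B \<in> coeffs_in I"
  proof (rule root_product_dvd_cong[OF prime_I Z(1) _ Z(3)])
    fix x assume "x \<in> Z"
    then have "poly ?P x = 0" using Z(1) by (auto simp: poly_prod intro!: prod_zero)
    then show "poly A' x \<in> I" using fermat by (simp add: A'_def frob_poly_props)
  qed
  then obtain B' where "?P * B' - A' \<in> coeffs_in I" using ideal_cong_sym[OF ideal_coeffs] by blast
  then have A': "A' \<in> coeffs_in I"
    using monic_mult_cong(2)[OF ideal_I _ _ deg] P by blast
  obtain B where B: "A - ?P * B \<in> coeffs_in I"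
    using root_product_dvd_cong[OF prime_I Z(1) assms Z(3)] by blast
  have "A - frob_poly * B = (A - ?P * B) - A' * B" by (simp add: A'_def algebra_simps)
  then have "A - frob_poly * B \<in> coeffs_in I"
    using ideal_diff[OF ideal_coeffs B ideal_mult'[OF ideal_coeffs A', of B]] by (simp only:)
  then show ?thesis by blast
qed

lemma frob_poly_cancel: "frob_poly * A \<in> coeffs_in I \<Longrightarrow> A \<in> coeffs_in I"
  using monic_mult_cong(1)[OF ideal_I frob_poly_props(2) refl, of 0 A] ideal_zero[OF ideal_I] by simp

text \<open>\<open>B\<close> has no zero modulo \<open>I\<close>, so every residue is a zero of
  \<open>A\<close>. One factor \<open>frob_poly\<close> is split off \<open>A\<close> and cancelled,
  and the argument repeats.\<close>

lemma frob_poly_power_dvd_cong: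
  assumes "A * B - frob_poly ^ n * C \<in> coeffs_in I" and "\<And>x. poly B x \<notin> I"
  shows "\<exists>D. A - frob_poly ^ n * D \<in> coeffs_in I"
  using assms(1)
proof (induction n arbitrary: A C)
  case 0
  then show ?case using ideal_zero[OF ideal_coeffs] by (intro exI[of _ A]) simp
next
  case (Suc n)
  have "poly A x \<in> I" for x
  proof -
    have "poly (A * B - frob_poly ^ Suc n * C) x \<in> I" by (rule poly_coeffs_in[OF ideal_I Suc.prems])
    moreover have "poly (frob_poly ^ Suc n * C) x \<in> I"
      using fermat by (simp add: frob_poly_props mult_in_I_iff)
    ultimately have "poly A x * poly B x \<in> I"
      using ideal_add[OF ideal_I] by fastforce
    then show ?thesis using assms(2) mult_in_I_iff by blast
  qed
  then obtain A' where A': "A - frob_poly * A' \<in> coeffs_in I" using frob_poly_dvd_cong by blast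
  have "frob_poly * (A' * B - frob_poly ^ n * C) =
      (A * B - frob_poly ^ Suc n * C) - (A - frob_poly * A') * B" by (simp add: algebra_simps)
  then have "frob_poly * (A' * B - frob_poly ^ n * C) \<in> coeffs_in I"
    using ideal_diff[OF ideal_coeffs Suc.prems ideal_mult'[OF ideal_coeffs A', of B]] by (simp only:)
  then obtain D where D: "A' - frob_poly ^ n * D \<in> coeffs_in I"
    using Suc.IH frob_poly_cancel by blast
  have "A - frob_poly ^ Suc n * D = (A - frob_poly * A') + frob_poly * (A' - frob_poly ^ n * D)"
    by (simp add: algebra_simps)
  then have "A - frob_poly ^ Suc n * D \<in> coeffs_in I"
    using ideal_add[OF ideal_coeffs A' ideal_mult[OF ideal_coeffs D, of frob_poly]] by (simp only:)
  then show ?case by blast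
qed

text \<open>The \<open>q\<close>-th power is additive modulo \<open>I\<close> and fixes the
  constants, so its only effect on \<open>f\<close> is to replace the variable by its
  \<open>q\<close>-th power.\<close>

lemma poly_power_q: "f ^ q - pcompose f (monom 1 q) \<in> coeffs_in I"
proof (induction f)
  case 0
  then show ?case using q_gt_1 ideal_zero[OF ideal_coeffs] by (simp add: power_0_left)
next
  case (pCons a f)
  obtain p e where pe: "prime p" "q = p ^ e" using primepow_q by (auto simp: primepow_def)
  \<comment> \<open>\<open>I\<close> is prime and contains \<open>q = p ^ e\<close>, hence
    \<open>p\<close>.\<close>
  have "(of_nat p :: 'a) ^ e \<in> I" using of_nat_q pe(2) by simp
  then have "of_nat p \<in> I" by (rule prime_ring_ideal_power[OF prime_I])
  then have "of_nat p \<in> coeffs_in I"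
    using const_in_coeffs_in[OF ideal_I] by (simp add: of_nat_poly)
  note fd = freshmans_dream_ideal_power[OF ideal_coeffs pe(1) this, of "[:a:]" "[:0, 1:] * f" e]
  have "pCons a f = [:a:] + [:0, 1:] * f" by simp
  then have 1: "pCons a f ^ q - ([:a:] ^ q + ([:0, 1:] * f) ^ q) \<in> coeffs_in I"
    using fd pe(2) by (simp only:)
  have "[:a ^ q:] - [:a:] \<in> coeffs_in I" using const_in_coeffs_in[OF ideal_I fermat[of a]] by simp
  moreover have "[:a:] ^ q = [:a ^ q:]" by (simp add: poly_const_pow)
  ultimately have 2: "[:a:] ^ q - [:a:] \<in> coeffs_in I" by simp
  have 3: "monom 1 q * (f ^ q - pcompose f (monom 1 q)) \<in> coeffs_in I"
    by (rule ideal_mult[OF ideal_coeffs pCons.IH])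
  have "([:0, 1:] * f) ^ q = monom 1 q * f ^ q" by (simp only: power_mult_distrib) (simp add: monom_altdef)
  then have "pCons a f ^ q - pcompose (pCons a f) (monom 1 q) =
     (pCons a f ^ q - ([:a:] ^ q + ([:0, 1:] * f) ^ q)) + ([:a:] ^ q - [:a:])
      + monom 1 q * (f ^ q - pcompose f (monom 1 q))"
    by (simp add: pcompose_pCons algebra_simps)
  then show ?case using ideal_add[OF ideal_coeffs ideal_add[OF ideal_coeffs 1 2] 3] by (simp only:)
qed

end

lemma map_poly_eval_mult:
  fixes E E' :: "'a::comm_ring_1 poly poly"
  shows "map_poly (\<lambda>A. poly A c) (E * E') = map_poly (\<lambda>A. poly A c) E * map_poly (\<lambda>A. poly A c) E'"
  by (rule poly_eqI) (simp add: coeff_map_poly coeff_mult poly_sum)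

lemma map_poly_eval_diff:
  fixes E E' :: "'a::comm_ring_1 poly poly"
  shows "map_poly (\<lambda>A. poly A c) (E - E') = map_poly (\<lambda>A. poly A c) E - map_poly (\<lambda>A. poly A c) E'"
  by (rule poly_eqI) (simp add: coeff_map_poly)

lemma map_poly_eval_smult:
  fixes E :: "'a::comm_ring_1 poly poly"
  shows "map_poly (\<lambda>A. poly A c) (smult A E) = smult (poly A c) (map_poly (\<lambda>A. poly A c) E)"
  by (rule poly_eqI) (simp add: coeff_map_poly)

lemma degree_poly_le:
  fixes G :: "'a::comm_ring_1 poly poly"
  assumes "coeff_degree_le C G"
  shows "degree (poly G h) \<le> degree G * degree h + C"
  unfolding poly_altdef
proof (rule degree_sum_le)
  fix i assume i: "i \<in> {..degree G}"
  have "degree (coeff G i * h ^ i) \<le> degree (coeff G i) + degree (h ^ i)" by (rule degree_mult_le)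
  moreover have "degree (h ^ i) \<le> degree h * i" by (rule degree_power_le)
  moreover have "degree h * i \<le> degree G * degree h" using i by (simp add: mult.commute)
  moreover have "degree (coeff G i) \<le> C" using assms by (simp add: coeff_degree_le_def)
  ultimately show "degree (coeff G i * h ^ i) \<le> degree G * degree h + C" by linarith
qed simp

text \<open>Put \<open>w = f ^ ((q + 1) / 2)\<close> and \<open>h = t ^ q - t\<close>. Then \<open>w\<^sup>2 = f f (t + h)\<close> and \<open>w \<equiv> f\<close> modulo \<open>h\<close>, hence
  \<open>h ^ (m + 1)\<close> divides \<open>u w - G (h)\<close>, which vanishes for degree reasons. So \<open>u\<^sup>2 f f (t + Y) = G\<^sup>2\<close> at \<open>Y = h\<close>;
  as the coefficients have degree less than \<open>q\<close>, this holds identically in \<open>Y\<close>, and \<open>t = 0\<close> gives the claim.\<close>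

lemma square_of_square_values:
  "\<exists>B. \<forall>(I::'a::comm_ring_1 set) q f. finite_residue_field I q \<longrightarrow> 2 \<notin> I \<longrightarrow> odd q \<longrightarrow> q > B \<longrightarrow>
     degree f \<le> 2 * m \<longrightarrow> (\<forall>x. poly f x \<notin> I \<and> (\<exists>y. poly f x - y ^ 2 \<in> I)) \<longrightarrow>
     (\<exists>s. degree s \<le> m \<and> f - s ^ 2 \<in> coeffs_in I)"
proof -
  obtain C where C: "\<And>f::'a poly. degree f \<le> 2 * m \<Longrightarrow> \<exists>a b G1 R.
     let u = 2 ^ a * f ^ b; G = pCons (u * f) G1 in
       G ^ 2 = [:u ^ 2 * f:] * shifted f + monom 1 (Suc m) * R \<and>
       degree G \<le> m \<and> coeff_degree_le C G \<and> coeff_degree_le C R \<and> degree u \<le> C"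
    using truncated_sqrt_shifted[of "2 * m" m] by blast
  show ?thesis
  \<comment> \<open>The bound serves two comparisons: \<open>C + m < q\<close>, to make a multiple
    of the power \<open>Suc m\<close> of \<open>frob_poly\<close> vanish, and
    \<open>2 * C + 4 * m < q\<close>, to read off the coefficients of \<open>E\<close> as
    digits.\<close>
  proof (rule exI[of _ "4 * C + 4 * m"], intro allI impI)
    fix I :: "'a set" and q f
    assume "finite_residue_field I q" and two: "2 \<notin> I" and "odd q" and large: "q > 4 * C + 4 * m"
      and f: "degree f \<le> 2 * m" and sq: "\<forall>x. poly f x \<notin> I \<and> (\<exists>y. poly f x - y ^ 2 \<in> I)"
    interpret finite_residue_field I q by fact
    note PI = ideal_coeffs and h = frob_poly_props
    let ?h = "frob_poly"
    obtain a b G1 R u G where u: "u = 2 ^ a * f ^ b" and G: "G = pCons (u * f) G1"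
      and eq: "G ^ 2 = [:u ^ 2 * f:] * shifted f + monom 1 (Suc m) * R"
      and bds: "degree G \<le> m" "coeff_degree_le C G" "degree u \<le> C"
      using C[OF f] unfolding Let_def by blast
    define w where "w = f ^ ((q + 1) div 2)"
    have "(q + 1) div 2 * 2 = q + 1" using \<open>odd q\<close> by (auto elim!: oddE)
    then have "w ^ 2 = f * f ^ q" by (simp only: w_def power_mult[symmetric]) simp
    then have "w ^ 2 - f * pcompose f (monom 1 q) = f * (f ^ q - pcompose f (monom 1 q))"
      by (simp only: right_diff_distrib)
    then have w2: "w ^ 2 - f * pcompose f (monom 1 q) \<in> coeffs_in I"
      using ideal_mult[OF PI poly_power_q[of f], of f] by simp
    have "poly (G ^ 2) ?h = u ^ 2 * f * pcompose f (monom 1 q) + ?h ^ Suc m * poly R ?h"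
      unfolding eq by (simp add: poly_shifted h(4) poly_monom)
    then have "(u * w - poly G ?h) * (u * w + poly G ?h) - ?h ^ Suc m * (- poly R ?h)
        = u ^ 2 * (w ^ 2 - f * pcompose f (monom 1 q))"
      by (simp add: power2_eq_square algebra_simps)
    then have fac: "(u * w - poly G ?h) * (u * w + poly G ?h) - ?h ^ Suc m * (- poly R ?h) \<in> coeffs_in I"
      using ideal_mult[OF PI w2, of "u ^ 2"] by simp
    \<comment> \<open>At every residue \<open>?h\<close> vanishes, and \<open>w\<close> takes the
      value of \<open>f\<close>, because a nonzero square has ((q - 1) / 2)-th power 1. Both
      summands thus equal u f, and their sum 2 u f is nonzero modulo \<open>I\<close>.\<close>
    have nz: "poly (u * w + poly G ?h) x \<notin> I" for x
    proof -
      obtain y where y: "poly f x - y ^ 2 \<in> I" using sq by blast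
      have "y \<notin> I"
      proof
        assume "y \<in> I"
        then have "y ^ 2 \<in> I" by (simp add: power2_eq_square mult_in_I_iff)
        then show False using y sq ideal_cong_iff[OF ideal_I] by blast
      qed
      have "poly f x ^ ((q - 1) div 2) - (y ^ 2) ^ ((q - 1) div 2) \<in> I"
        by (rule ideal_cong_power[OF ideal_I y])
      moreover have "2 * ((q - 1) div 2) = q - 1" using \<open>odd q\<close> by simp
      then have "(y ^ 2) ^ ((q - 1) div 2) = y ^ (q - 1)" by (simp only: power_mult[symmetric])
      ultimately have 1: "poly f x ^ ((q - 1) div 2) - 1 \<in> I"
        using ideal_cong_trans[OF ideal_I] fermat'[OF \<open>y \<notin> I\<close>] by metis
      have "(q + 1) div 2 = Suc ((q - 1) div 2)" using \<open>odd q\<close> by (auto elim!: oddE)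
      then have half: "w = f * f ^ ((q - 1) div 2)" by (simp only: w_def power_Suc)
      define v where "v = poly u x * poly f x"
      have "poly (u * w + poly G ?h) x - 2 * v
          = v * (poly f x ^ ((q - 1) div 2) - 1) + (x ^ q - x) * poly (poly G1 ?h) x"
        by (simp add: half G v_def h(3) algebra_simps)
      then have "poly (u * w + poly G ?h) x - 2 * v \<in> I"
        using ideal_add[OF ideal_I ideal_mult[OF ideal_I 1] ideal_mult'[OF ideal_I fermat]] by (simp only:)
      moreover have "2 * v \<notin> I"
        using two sq prime_ring_ideal_power[OF prime_I]
        by (auto simp: v_def u mult_in_I_iff poly_power poly_numeral)
      ultimately show ?thesis using ideal_cong_iff[OF ideal_I] by blast
    qed
    obtain D where D: "(u * w - poly G ?h) - ?h ^ Suc m * D \<in> coeffs_in I"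
      using frob_poly_power_dvd_cong[OF fac nz] by blast
    have hm: "degree (?h ^ Suc m) = Suc m * q" "lead_coeff (?h ^ Suc m) = 1"
    proof -
      have "lead_coeff (?h ^ n) = 1 \<and> degree (?h ^ n) = n * q" for n
      proof (induction n)
        case (Suc n)
        then show ?case using monic_mult_degree[of ?h "?h ^ n"] h by (metis mult_Suc power_Suc)
      qed simp
      then show "degree (?h ^ Suc m) = Suc m * q" "lead_coeff (?h ^ Suc m) = 1" by blast+
    qed
    have "degree (u * w) \<le> C + m * (q + 1)"
    proof -
      have "degree w \<le> degree f * ((q + 1) div 2)" unfolding w_def by (rule degree_power_le)
      also have "\<dots> \<le> 2 * m * ((q + 1) div 2)" using f by (intro mult_right_mono) auto
      also have "\<dots> = m * (q + 1)" using \<open>odd q\<close> by (auto elim!: oddE)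
      finally show ?thesis using degree_mult_le[of u w] bds(3) by linarith
    qed
    moreover have "degree (poly G ?h) \<le> m * q + C"
    proof -
      have "degree G * q \<le> m * q" using bds(1) by simp
      then show ?thesis using degree_poly_le[OF bds(2), of ?h] unfolding h(1) by linarith
    qed
    ultimately have "degree (u * w - poly G ?h) \<le> m * q + (C + m)"
      by (intro degree_diff_le) (auto simp: algebra_simps)
    then have deg: "degree (u * w - poly G ?h) < Suc m * q" using large by simp
    have "u * w - poly G ?h \<in> coeffs_in I"
    proof (rule monic_mult_cong(2)[OF ideal_I hm(2) hm(1)])
      show "coeff (u * w - poly G ?h) i \<in> I" if "i \<ge> Suc m * q" for i
        using that deg by (subst coeff_eq_0) (auto simp: ideal_zero[OF ideal_I])
      show "?h ^ Suc m * D - (u * w - poly G ?h) \<in> coeffs_in I"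
        by (rule ideal_cong_sym[OF PI D])
    qed
    then have "(u * w - poly G ?h) * (u * w + poly G ?h) - u ^ 2 * (w ^ 2 - f * pcompose f (monom 1 q))
        \<in> coeffs_in I"
      by (rule ideal_diff[OF PI ideal_mult'[OF PI] ideal_mult[OF PI w2]])
    define E where "E = [:u ^ 2 * f:] * shifted f - G ^ 2"
    have "poly E ?h = (u * w - poly G ?h) * (u * w + poly G ?h) - u ^ 2 * (w ^ 2 - f * pcompose f (monom 1 q))"
      by (simp add: E_def poly_shifted h(4)) (simp add: power2_eq_square algebra_simps)
    with \<open>_ - u ^ 2 * (w ^ 2 - f * pcompose f (monom 1 q)) \<in> coeffs_in I\<close>
    have Eh: "poly E ?h \<in> coeffs_in I" by (simp only:)
    have "coeff_degree_le (2 * C + 4 * m) E"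
      unfolding E_def
    proof (rule coeff_degree_le_diff)
      have "degree (u ^ 2 * f) \<le> 2 * C + 2 * m"
        using degree_mult_le[of "u ^ 2" f] degree_power_le[of u 2] bds(3) f by simp
      then have "coeff_degree_le ((2 * C + 2 * m) + 2 * m) ([:u ^ 2 * f:] * shifted f)"
        by (intro coeff_degree_le_mult)
          (use f in \<open>auto simp: coeff_degree_le_pCons intro: coeff_degree_le_mono[OF coeff_degree_le_shifted]\<close>)
      then show "coeff_degree_le (2 * C + 4 * m) ([:u ^ 2 * f:] * shifted f)"
        by (rule coeff_degree_le_mono) simp
      show "coeff_degree_le (2 * C + 4 * m) (G ^ 2)"
        using coeff_degree_le_mult[OF bds(2) bds(2)]
        by (auto simp: power2_eq_square elim: coeff_degree_le_mono)
    qed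
    then have "degree (coeff E j) < degree ?h" for j
      using large h(1) by (auto simp: coeff_degree_le_def intro: le_less_trans)
    then have E: "E \<in> coeffs_in (coeffs_in I)"
      by (rule poly_digits_in_ideal[OF ideal_I h(2) _ Eh])
    let ?ev = "map_poly (\<lambda>A. poly A (0::'a))"
    have "?ev E \<in> coeffs_in I"
      using E poly_coeffs_in[OF ideal_I] by (simp add: coeffs_in_def[of "coeffs_in I"] coeffs_in_def[of I] coeff_map_poly)
        (auto simp: coeffs_in_def)
    moreover have "?ev E = smult (poly u 0 ^ 2 * poly f 0) f - ?ev G ^ 2"
      by (simp add: E_def map_poly_eval_mult map_poly_eval_diff map_poly_shifted
          map_poly_eval_smult power2_eq_square)
    ultimately have ev: "smult (poly u 0 ^ 2 * poly f 0) f - ?ev G ^ 2 \<in> coeffs_in I" by simp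
    \<comment> \<open>At \<open>t = 0\<close> the identity says that u(0)^2 f(0) f is a square.
      Since f(0) is a nonzero square y^2 modulo \<open>I\<close>, multiplying by the inverse square
      of u(0) y leaves \<open>f\<close> itself as a square.\<close>
    obtain y where y: "poly f 0 - y ^ 2 \<in> I" using sq by blast
    have "y \<notin> I"
    proof
      assume "y \<in> I"
      then have "y ^ 2 \<in> I" by (simp add: power2_eq_square mult_in_I_iff)
      then show False using y sq ideal_cong_iff[OF ideal_I] by blast
    qed
    moreover have "poly u 0 \<notin> I"
      using two sq prime_ring_ideal_power[OF prime_I] by (auto simp: u mult_in_I_iff poly_power poly_numeral)
    ultimately obtain z where z: "poly u 0 * y * z - 1 \<in> I" using inverse_mod mult_in_I_iff by blast
    define s where "s = smult z (?ev G)"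
    have "(poly u 0 ^ 2 * poly f 0) * z ^ 2 - 1 =
        (poly u 0 * z) ^ 2 * (poly f 0 - y ^ 2) + ((poly u 0 * y * z) ^ 2 - 1 ^ 2)"
      by (simp add: power2_eq_square algebra_simps)
    then have "(poly u 0 ^ 2 * poly f 0) * z ^ 2 - 1 \<in> I"
      using ideal_add[OF ideal_I ideal_mult[OF ideal_I y] ideal_cong_power[OF ideal_I z]] by (simp only:)
    then have "[:(poly u 0 ^ 2 * poly f 0) * z ^ 2 - 1:] * f \<in> coeffs_in I"
      by (intro ideal_mult'[OF PI] const_in_coeffs_in[OF ideal_I])
    from ideal_diff[OF PI ideal_mult[OF PI ev, of "[:z ^ 2:]"] this]
    have "f - s ^ 2 \<in> coeffs_in I"
      by (simp add: s_def power2_eq_square algebra_simps smult_diff_left smult_diff_right)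
    moreover have "degree s \<le> m"
    proof -
      have "degree (?ev G) \<le> degree G" by (intro degree_le) (simp add: coeff_map_poly coeff_eq_0)
      then show ?thesis using bds(1) unfolding s_def by (meson degree_smult_le le_trans)
    qed
    ultimately show "\<exists>s. degree s \<le> m \<and> f - s ^ 2 \<in> coeffs_in I" by blast
  qed
qed

subsection \<open>Finite fields as residue rings of the polynomials over the integers\<close>

text \<open>Evaluation at \<gamma> by Horner's rule. It links the type-class polynomials over the
  integers to a ring given as a record.\<close>

lemma (in cring) int_poly_eval_hom:
  assumes \<gamma>: "\<gamma> \<in> carrier R"
  obtains \<phi> :: "int poly \<Rightarrow> 'a" where "\<And>p. \<phi> p \<in> carrier R" "\<And>p r. \<phi> (p + r) = \<phi> p \<oplus> \<phi> r"
    "\<And>p r. \<phi> (p * r) = \<phi> p \<otimes> \<phi> r" "\<phi> 1 = \<one>" "\<phi> 0 = \<zero>" "\<And>i. \<phi> (Polynomial.monom 1 i) = \<gamma> [^] i"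
proof -
  define \<iota> where "\<iota> = (\<lambda>a::int. [a] \<cdot> \<one>)"
  have \<iota>: "\<iota> a \<in> carrier R" "\<iota> 0 = \<zero>" "\<iota> 1 = \<one>" "\<iota> (a + b) = \<iota> a \<oplus> \<iota> b" "\<iota> (a * b) = \<iota> a \<otimes> \<iota> b" for a b
    unfolding \<iota>_def
    by (simp_all add: add.int_pow_mult add_pow_ldistr_int add.int_pow_pow mult.commute add_pow_int_ge)
  define \<phi> where "\<phi> = (\<lambda>p. fold_coeffs (\<lambda>a r. \<iota> a \<oplus> \<gamma> \<otimes> r) p \<zero>)"
  have 0: "\<phi> 0 = \<zero>" by (simp add: \<phi>_def)
  have pC: "\<phi> (pCons a p) = \<iota> a \<oplus> \<gamma> \<otimes> \<phi> p" for a p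
    by (cases "p = 0"; cases "a = 0") (auto simp: \<phi>_def \<iota>(2) \<gamma>)
  have cl: "\<phi> p \<in> carrier R" for p
    by (induction p) (auto simp: 0 pC \<iota> \<gamma>)
  have add: "\<phi> (p + r) = \<phi> p \<oplus> \<phi> r" for p r
  proof (induction p r rule: poly_induct2)
    case (pCons a p b r)
    then show ?case using \<gamma> \<iota>(1) cl
      by (simp add: pC \<iota>(4) r_distr) (simp add: a_ac)
  qed (simp add: 0)
  have sm: "\<phi> (smult c p) = \<iota> c \<otimes> \<phi> p" for c p
  proof (induction p)
    case (pCons a p)
    then show ?case using \<gamma> \<iota>(1) cl by (simp add: pC \<iota>(5) r_distr m_lcomm)
  qed (simp add: 0 \<iota>)
  have mult: "\<phi> (p * r) = \<phi> p \<otimes> \<phi> r" for p r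
  proof (induction p)
    case (pCons a p)
    then show ?case using \<gamma> \<iota> cl by (simp add: add sm pC l_distr m_assoc)
  qed (simp add: 0 cl)
  have 1: "\<phi> 1 = \<one>" using \<gamma> by (simp add: one_pCons pC 0 \<iota>)
  have "\<phi> (Polynomial.monom 1 i) = \<gamma> [^] i" for i
  proof (induction i)
    case 0
    then show ?case using 1 by simp
  next
    case (Suc i)
    then show ?case using \<gamma> by (simp add: Polynomial.monom_Suc pC \<iota> m_comm)
  qed
  with that cl add mult 1 0 show ?thesis by blast
qed

text \<open>The variable is sent to a generator of the cyclic group of units, so the image contains
  every nonzero element. The last clause records that each nonzero residue is a power of the
  variable, so that squares can be detected by the parity of exponents.\<close>

lemma (in field) finite_residue_field_presentation:
  assumes card: "card (carrier R) = q" and q: "primepow q"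
  obtains \<phi> :: "int poly \<Rightarrow> 'a" where "\<And>p. \<phi> p \<in> carrier R" "\<And>p r. \<phi> (p + r) = \<phi> p \<oplus> \<phi> r"
    "\<And>p r. \<phi> (p * r) = \<phi> p \<otimes> \<phi> r" "\<phi> 1 = \<one>" "\<phi> ` UNIV = carrier R"
    "finite_residue_field {p. \<phi> p = \<zero>} q"
    "\<And>p. \<phi> p \<noteq> \<zero> \<Longrightarrow> \<exists>i. \<phi> (p - Polynomial.monom 1 i) = \<zero>"
proof -
  have q1: "q > 1" using q primepow_gt_Suc_0 by auto
  then have fin: "finite (carrier R)" using card by (metis card.infinite not_less_zero)
  obtain \<gamma> where \<gamma>: "\<gamma> \<in> carrier (Multiplicative_Group.mult_of R)" "carrier (Multiplicative_Group.mult_of R) = {\<gamma> [^] i | i::nat. i \<in> UNIV}"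
    using finite_field_mult_group_has_gen[OF fin] by (elim bexE)
  then have \<gamma>R: "\<gamma> \<in> carrier R" by simp
  obtain \<phi> :: "int poly \<Rightarrow> 'a" where \<phi>: "\<And>p. \<phi> p \<in> carrier R" "\<And>p r. \<phi> (p + r) = \<phi> p \<oplus> \<phi> r"
    "\<And>p r. \<phi> (p * r) = \<phi> p \<otimes> \<phi> r" "\<phi> 1 = \<one>" "\<phi> 0 = \<zero>" "\<And>i. \<phi> (Polynomial.monom 1 i) = \<gamma> [^] i"
    by (rule int_poly_eval_hom[OF \<gamma>R]) (rule that)
  have minus: "\<phi> (p - r) = \<phi> p \<ominus> \<phi> r" for p r
  proof -
    have "\<phi> (p - r) \<oplus> \<phi> r = \<phi> p" using \<phi>(2)[of "p - r" r] by simp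
    moreover have "\<phi> (p - r) = (\<phi> (p - r) \<oplus> \<phi> r) \<ominus> \<phi> r"
      using \<phi>(1) by (simp add: a_minus_def a_assoc r_neg)
    ultimately show ?thesis by simp
  qed
  have eq_iff: "\<phi> (p - r) = \<zero> \<longleftrightarrow> \<phi> p = \<phi> r" for p r
    using \<phi>(1) by (simp add: minus r_right_minus_eq)
  have gen: "\<exists>i. \<phi> (p - Polynomial.monom 1 i) = \<zero>" if "\<phi> p \<noteq> \<zero>" for p
    using that \<phi>(1)[of p] \<gamma>(2) by (auto simp: eq_iff \<phi>(6))
  have surj: "\<phi> ` UNIV = carrier R"
  proof (intro equalityI subsetI)
    fix y assume y: "y \<in> carrier R"
    show "y \<in> \<phi> ` UNIV"
    proof (cases "y = \<zero>")
      case True then show ?thesis using \<phi>(5) by (metis rangeI)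
    next
      case False
      then have "y \<in> carrier (Multiplicative_Group.mult_of R)" using y by simp
      then obtain i :: nat where "y = \<gamma> [^] i" using \<gamma>(2) by auto
      then show ?thesis using \<phi>(6)[of i] by (metis rangeI)
    qed
  qed (use \<phi>(1) in auto)
  have pow: "\<phi> (p ^ n) = \<phi> p [^] n" for p n
    by (induction n) (simp_all add: \<phi> m_comm)
  have nat: "\<phi> (of_nat n) = [n] \<cdot> \<one>" for n
    by (induction n) (simp_all add: \<phi> add.m_comm)
  have "finite_residue_field {p. \<phi> p = \<zero>} q"
  proof
    show "prime_ring_ideal {p. \<phi> p = \<zero>}"
      unfolding prime_ring_ideal_def ring_ideal_def
      using \<phi> one_not_zero by (auto dest!: integral)
    show "z ^ q - z \<in> {p. \<phi> p = \<zero>}" for z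
    proof -
      have "\<phi> z [^] q = \<phi> z"
      proof (cases "\<phi> z = \<zero>")
        case True
        then show ?thesis using q1 by (simp add: nat_pow_zero)
      next
        case False
        then have U: "\<phi> z \<in> Units R" using \<phi>(1) by (simp add: field_Units)
        have "card (Units R) = q - 1" using card fin by (simp add: field_Units)
        then have "\<phi> z [^] (q - 1) = \<one>"
          using units_power_order_eq_one[of "\<phi> z"] U fin by (metis finite_Diff field_Units)
        then have "\<phi> z [^] Suc (q - 1) = \<phi> z" using \<phi>(1) by simp
        then show ?thesis using q1 by simp
      qed
      then show ?thesis by (simp add: eq_iff pow)
    qed
    show "of_nat q \<in> {p. \<phi> p = \<zero>}"
    proof -
      have "[Coset.order (add_monoid R)] \<cdot> \<one> = \<zero>"
        using add.pow_order_eq_1[of \<one>] by simp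
      then show ?thesis using card by (simp add: nat Coset.order_def)
    qed
    show "\<exists>Z. finite Z \<and> card Z = q \<and> (\<forall>x\<in>Z. \<forall>y\<in>Z. x - y \<in> {p. \<phi> p = \<zero>} \<longrightarrow> x = y)"
    proof -
      define \<sigma> where "\<sigma> = inv_into UNIV \<phi>"
      have \<sigma>: "\<phi> (\<sigma> y) = y" if "y \<in> carrier R" for y
        using that surj f_inv_into_f unfolding \<sigma>_def by metis
      then have "inj_on \<sigma> (carrier R)" by (metis inj_onI)
      then have "card (\<sigma> ` carrier R) = q" using card by (simp add: card_image)
      then show ?thesis using fin \<sigma> by (intro exI[of _ "\<sigma> ` carrier R"]) (auto simp: eq_iff)
    qed
  qed (rule q)
  with that \<phi> surj gen show ?thesis by blast
qed

subsection \<open>Ultraproducts\<close>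

lemma cring_product_ring:
  assumes "\<And>s. s \<in> S \<Longrightarrow> cring (F s)" shows "cring (product_ring S F)"
proof -
  let ?P = "product_ring S F"
  have r: "ring (F s)" "Group.monoid (F s)" "cring (F s)" if "s \<in> S" for s
    using assms[OF that] by (auto simp: cring_def ring_def)
  have mem: "x s \<in> carrier (F s)" if "x \<in> carrier ?P" "s \<in> S" for x s
    using that by (auto simp: product_ring_def)
  have memI: "(\<lambda>s\<in>S. g s) \<in> carrier ?P" if "\<And>s. s \<in> S \<Longrightarrow> g s \<in> carrier (F s)" for g
    using that by (auto simp: product_ring_def)
  have ops: "x \<oplus>\<^bsub>?P\<^esub> y = (\<lambda>s\<in>S. x s \<oplus>\<^bsub>F s\<^esub> y s)" "x \<otimes>\<^bsub>?P\<^esub> y = (\<lambda>s\<in>S. x s \<otimes>\<^bsub>F s\<^esub> y s)"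
    "\<zero>\<^bsub>?P\<^esub> = (\<lambda>s\<in>S. \<zero>\<^bsub>F s\<^esub>)" "\<one>\<^bsub>?P\<^esub> = (\<lambda>s\<in>S. \<one>\<^bsub>F s\<^esub>)" for x y
    by (simp_all add: product_ring_def)
  have ext: "x = (\<lambda>s\<in>S. x s)" if "x \<in> carrier ?P" for x
    using that by (auto simp: product_ring_def PiE_def extensional_def)
  have closed: "x \<oplus>\<^bsub>?P\<^esub> y \<in> carrier ?P" "x \<otimes>\<^bsub>?P\<^esub> y \<in> carrier ?P"
    if "x \<in> carrier ?P" "y \<in> carrier ?P" for x y
    unfolding ops using mem[OF that(1)] mem[OF that(2)] r
    by (auto intro!: memI simp: ring.ring_simprules)
  have neutral: "\<zero>\<^bsub>?P\<^esub> \<in> carrier ?P" "\<one>\<^bsub>?P\<^esub> \<in> carrier ?P"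
    unfolding ops using r by (auto intro!: memI simp: ring.ring_simprules)
  have assoc: "x \<oplus>\<^bsub>?P\<^esub> y \<oplus>\<^bsub>?P\<^esub> z = x \<oplus>\<^bsub>?P\<^esub> (y \<oplus>\<^bsub>?P\<^esub> z)"
    "x \<otimes>\<^bsub>?P\<^esub> y \<otimes>\<^bsub>?P\<^esub> z = x \<otimes>\<^bsub>?P\<^esub> (y \<otimes>\<^bsub>?P\<^esub> z)"
    "(x \<oplus>\<^bsub>?P\<^esub> y) \<otimes>\<^bsub>?P\<^esub> z = x \<otimes>\<^bsub>?P\<^esub> z \<oplus>\<^bsub>?P\<^esub> y \<otimes>\<^bsub>?P\<^esub> z"
    if "x \<in> carrier ?P" "y \<in> carrier ?P" "z \<in> carrier ?P" for x y z
    unfolding ops using mem[OF that(1)] mem[OF that(2)] mem[OF that(3)] r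
    by (auto intro!: restrict_ext simp: ring.ring_simprules)
  have comm: "x \<oplus>\<^bsub>?P\<^esub> y = y \<oplus>\<^bsub>?P\<^esub> x" "x \<otimes>\<^bsub>?P\<^esub> y = y \<otimes>\<^bsub>?P\<^esub> x"
    if "x \<in> carrier ?P" "y \<in> carrier ?P" for x y
    unfolding ops using mem[OF that(1)] mem[OF that(2)] r
    by (auto intro!: restrict_ext simp: cring.cring_simprules)
  have unit: "\<zero>\<^bsub>?P\<^esub> \<oplus>\<^bsub>?P\<^esub> x = x" "\<one>\<^bsub>?P\<^esub> \<otimes>\<^bsub>?P\<^esub> x = x" if "x \<in> carrier ?P" for x
  proof -
    have "\<zero>\<^bsub>?P\<^esub> \<oplus>\<^bsub>?P\<^esub> x = (\<lambda>s\<in>S. x s)" "\<one>\<^bsub>?P\<^esub> \<otimes>\<^bsub>?P\<^esub> x = (\<lambda>s\<in>S. x s)"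
      unfolding ops using mem[OF that] r by (auto intro!: restrict_ext simp: ring.ring_simprules)
    then show "\<zero>\<^bsub>?P\<^esub> \<oplus>\<^bsub>?P\<^esub> x = x" "\<one>\<^bsub>?P\<^esub> \<otimes>\<^bsub>?P\<^esub> x = x" by (simp_all only: ext[OF that, symmetric])
  qed
  have inv: "\<exists>y\<in>carrier ?P. y \<oplus>\<^bsub>?P\<^esub> x = \<zero>\<^bsub>?P\<^esub>" if "x \<in> carrier ?P" for x
  proof (rule bexI)
    show "(\<lambda>s\<in>S. \<ominus>\<^bsub>F s\<^esub> x s) \<in> carrier ?P"
      using mem[OF that] r by (auto intro!: memI simp: ring.ring_simprules)
    show "(\<lambda>s\<in>S. \<ominus>\<^bsub>F s\<^esub> x s) \<oplus>\<^bsub>?P\<^esub> x = \<zero>\<^bsub>?P\<^esub>"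
      unfolding ops using mem[OF that] r by (auto intro!: restrict_ext simp: ring.ring_simprules)
  qed
  show ?thesis
    by (intro cringI abelian_groupI comm_monoidI closed neutral assoc comm unit inv)
qed

lemma ideal_eventually_zero:
  assumes F: "\<And>s. s \<in> S \<Longrightarrow> cring (F s)" and D: "D \<le> principal S"
  shows "ideal {x \<in> carrier (product_ring S F). \<forall>\<^sub>F s in D. x s = \<zero>\<^bsub>F s\<^esub>} (product_ring S F)"
    (is "ideal ?I _")
proof -
  let ?P = "product_ring S F"
  interpret P: cring ?P by (rule cring_product_ring[OF F])
  \<comment> \<open>The filter lives on \<open>S\<close>; outside \<open>S\<close> the restricted
    functions are \<open>undefined\<close> and satisfy no equation.\<close>
  have evS: "\<forall>\<^sub>F s in D. s \<in> S" using D by (simp add: le_principal)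
  have r: "ring (F s)" "abelian_monoid (F s)" "cring (F s)" if "s \<in> S" for s
    using F[OF that] by (auto simp: cring_def ring_def comm_monoid_def abelian_group_def)
  have mul: "c \<otimes>\<^bsub>?P\<^esub> x \<in> ?I" if "x \<in> ?I" "c \<in> carrier ?P" for c x
  proof -
    have c: "c s \<in> carrier (F s)" if "s \<in> S" for s using \<open>c \<in> carrier ?P\<close> that by (auto simp: product_ring_def)
    have "\<forall>\<^sub>F s in D. (c \<otimes>\<^bsub>?P\<^esub> x) s = \<zero>\<^bsub>F s\<^esub>"
      using evS that(1) [simplified, THEN conjunct2]
    proof eventually_elim
      case (elim s)
      then show ?case using c[of s] r(1)[of s] by (simp add: product_ring_def ring.ring_simprules)
    qed
    then show ?thesis using that by auto
  qed
  show ?thesis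
  proof (rule idealI)
    show "ring ?P" by (rule P.ring_axioms)
    show "subgroup ?I (add_monoid ?P)"
    proof (rule P.add.subgroupI)
      show "?I \<noteq> {}"
      proof -
        have "\<zero>\<^bsub>?P\<^esub> \<in> ?I" using evS by (auto simp: product_ring_def elim!: eventually_mono)
          (use P.zero_closed in \<open>auto simp: product_ring_def\<close>)
        then show ?thesis by blast
      qed
      fix x assume x: "x \<in> ?I"
      have "\<ominus>\<^bsub>?P\<^esub> x = (\<ominus>\<^bsub>?P\<^esub> \<one>\<^bsub>?P\<^esub>) \<otimes>\<^bsub>?P\<^esub> x" using x by (simp add: P.l_minus)
      then show "\<ominus>\<^bsub>?P\<^esub> x \<in> ?I" using mul[OF x, of "\<ominus>\<^bsub>?P\<^esub> \<one>\<^bsub>?P\<^esub>"] by simp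
    next
      fix x y assume xy: "x \<in> ?I" "y \<in> ?I"
      have "\<forall>\<^sub>F s in D. (x \<oplus>\<^bsub>?P\<^esub> y) s = \<zero>\<^bsub>F s\<^esub>"
        using evS xy(1)[simplified, THEN conjunct2] xy(2)[simplified, THEN conjunct2]
      proof eventually_elim
        case (elim s)
        then show ?case using r by (auto simp: product_ring_def ring.ring_simprules)
      qed
      then show "x \<oplus>\<^bsub>?P\<^esub> y \<in> ?I" using xy by auto
    qed auto
    show "c \<otimes>\<^bsub>?P\<^esub> x \<in> ?I" if "x \<in> ?I" "c \<in> carrier ?P" for c x by (rule mul[OF that])
    show "x \<otimes>\<^bsub>?P\<^esub> c \<in> ?I" if "x \<in> ?I" "c \<in> carrier ?P" for c x
      using mul[OF that] that by (simp add: P.m_comm)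
  qed
qed

text \<open>\<open>F s\<close> is presented as \<open>\<int>[x]\<close> modulo \<open>I s\<close>, with \<open>x\<close> mapped to a generator of its multiplicative group.\<close>

lemma ultraproduct_presentation:
  fixes S :: "'s set" and D :: "'s filter" and q :: "'s \<Rightarrow> nat" and F :: "'s \<Rightarrow> 'f ring"
  assumes D: "D \<le> principal S"
    and q: "\<And>s. s \<in> S \<Longrightarrow> primepow (q s)"
    and F: "\<And>s. s \<in> S \<Longrightarrow> field (F s)" "\<And>s. s \<in> S \<Longrightarrow> card (carrier (F s)) = q s"
    and iso: "ultraproduct S F D \<simeq> (ring_of_type_algebra :: 'g::field ring)"
 obtains \<Phi> :: "('s \<Rightarrow> int poly) \<Rightarrow> 'g::field" and I :: "'s \<Rightarrow> int poly set" where
    "\<And>z w. \<Phi> (\<lambda>s. z s + w s) = \<Phi> z + \<Phi> w" "\<And>z w. \<Phi> (\<lambda>s. z s * w s) = \<Phi> z * \<Phi> w"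
    "\<Phi> (\<lambda>s. 1) = 1" "surj \<Phi>" "\<And>z. \<Phi> z = 0 \<longleftrightarrow> (\<forall>\<^sub>F s in D. z s \<in> I s)"
    "\<And>s. s \<in> S \<Longrightarrow> finite_residue_field (I s) (q s)"
    "\<And>s z. s \<in> S \<Longrightarrow> z \<notin> I s \<Longrightarrow> \<exists>i. z - Polynomial.monom 1 i \<in> I s"
proof -
  have evS: "\<forall>\<^sub>F s in D. s \<in> S" using D by (simp add: le_principal)
  have cr: "cring (F s)" if "s \<in> S" for s using F(1)[OF that] by (simp add: field_def domain_def)
  let ?P = "product_ring S F"
  define J where "J = {x \<in> carrier ?P. \<forall>\<^sub>F s in D. x s = \<zero>\<^bsub>F s\<^esub>}"
  interpret J: ideal J ?P unfolding J_def by (rule ideal_eventually_zero[OF cr D])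
  define pres where "pres s \<phi> \<longleftrightarrow> (\<forall>p. \<phi> p \<in> carrier (F s)) \<and> (\<forall>p r. \<phi> (p + r) = \<phi> p \<oplus>\<^bsub>F s\<^esub> \<phi> r)
    \<and> (\<forall>p r. \<phi> (p * r) = \<phi> p \<otimes>\<^bsub>F s\<^esub> \<phi> r) \<and> \<phi> 1 = \<one>\<^bsub>F s\<^esub> \<and> \<phi> ` UNIV = carrier (F s)
    \<and> finite_residue_field {p. \<phi> p = \<zero>\<^bsub>F s\<^esub>} (q s)
    \<and> (\<forall>p. \<phi> p \<noteq> \<zero>\<^bsub>F s\<^esub> \<longrightarrow> (\<exists>i. \<phi> (p - Polynomial.monom 1 i) = \<zero>\<^bsub>F s\<^esub>))"
    for s and \<phi> :: "int poly \<Rightarrow> 'f"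
  have "\<forall>s\<in>S. \<exists>\<phi>. pres s \<phi>"
  proof
    fix s assume s: "s \<in> S"
    interpret field "F s" by (rule F(1)[OF s])
    obtain \<phi> :: "int poly \<Rightarrow> 'f" where \<phi>: "\<And>p. \<phi> p \<in> carrier (F s)"
        "\<And>p r. \<phi> (p + r) = \<phi> p \<oplus>\<^bsub>F s\<^esub> \<phi> r"
        "\<And>p r. \<phi> (p * r) = \<phi> p \<otimes>\<^bsub>F s\<^esub> \<phi> r" "\<phi> 1 = \<one>\<^bsub>F s\<^esub>" "\<phi> ` UNIV = carrier (F s)"
        "finite_residue_field {p. \<phi> p = \<zero>\<^bsub>F s\<^esub>} (q s)"
        "\<And>p. \<phi> p \<noteq> \<zero>\<^bsub>F s\<^esub> \<Longrightarrow> \<exists>i. \<phi> (p - Polynomial.monom 1 i) = \<zero>\<^bsub>F s\<^esub>"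
      by (rule finite_residue_field_presentation[OF F(2)[OF s] q[OF s]]) (rule that)
    show "\<exists>\<phi>. pres s \<phi>"
      unfolding pres_def by (rule exI[of _ \<phi>]) (simp add: \<phi>)
  qed
  then obtain \<phi> where "\<forall>s\<in>S. pres s (\<phi> s)" by (rule bchoice[THEN exE])
  then have \<phi>: "\<And>s p. s \<in> S \<Longrightarrow> \<phi> s p \<in> carrier (F s)"
      "\<And>s p r. s \<in> S \<Longrightarrow> \<phi> s (p + r) = \<phi> s p \<oplus>\<^bsub>F s\<^esub> \<phi> s r"
      "\<And>s p r. s \<in> S \<Longrightarrow> \<phi> s (p * r) = \<phi> s p \<otimes>\<^bsub>F s\<^esub> \<phi> s r"
      "\<And>s. s \<in> S \<Longrightarrow> \<phi> s 1 = \<one>\<^bsub>F s\<^esub>" "\<And>s. s \<in> S \<Longrightarrow> \<phi> s ` UNIV = carrier (F s)"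
      "\<And>s. s \<in> S \<Longrightarrow> finite_residue_field {p. \<phi> s p = \<zero>\<^bsub>F s\<^esub>} (q s)"
      "\<And>s p. s \<in> S \<Longrightarrow> \<phi> s p \<noteq> \<zero>\<^bsub>F s\<^esub> \<Longrightarrow> \<exists>i. \<phi> s (p - Polynomial.monom 1 i) = \<zero>\<^bsub>F s\<^esub>"
    unfolding pres_def by blast+
  obtain h where h: "h \<in> ring_iso (?P Quot J) (ring_of_type_algebra :: 'g ring)"
    using iso unfolding is_ring_iso_def ultraproduct_def J_def by blast
  define \<psi> where "\<psi> v = h (J +>\<^bsub>?P\<^esub> v)" for v
  note hh = ring_iso_memE[OF h] and qh = ring_hom_memE[OF J.rcos_ring_hom]
  have \<psi>: "\<psi> (v \<oplus>\<^bsub>?P\<^esub> w) = \<psi> v + \<psi> w" "\<psi> (v \<otimes>\<^bsub>?P\<^esub> w) = \<psi> v * \<psi> w"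
    if vw: "v \<in> carrier ?P" "w \<in> carrier ?P" for v w
    using hh(2,3)[OF qh(1)[OF vw(1)] qh(1)[OF vw(2)]] unfolding \<psi>_def qh(2)[OF vw] qh(3)[OF vw]
    by (simp_all only: ring_of_type_algebra_def ring.simps monoid.simps)
  have \<psi>1: "\<psi> \<one>\<^bsub>?P\<^esub> = 1"
    unfolding \<psi>_def qh(4) hh(4) by (simp add: ring_of_type_algebra_def)
  have \<psi>surj: "\<exists>v\<in>carrier ?P. \<psi> v = y" for y
  proof -
    have "y \<in> h ` carrier (?P Quot J)"
      using hh(5) by (simp add: bij_betw_def ring_of_type_algebra_def)
    then show ?thesis by (auto simp: \<psi>_def FactRing_def A_RCOSETS_def')
  qed
  have \<psi>0: "\<psi> v = 0 \<longleftrightarrow> v \<in> J" if v: "v \<in> carrier ?P" for v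
  proof -
    interpret Q: ring "?P Quot J" by (rule J.quotient_is_ring)
    interpret G: ring "ring_of_type_algebra :: 'g ring" by (rule ring_from_type_algebra)
    have "h \<in> ring_hom (?P Quot J) (ring_of_type_algebra :: 'g ring)" using h by (simp add: ring_iso_def)
    from ring_hom_zero[OF this Q.ring_axioms G.ring_axioms]
    have "h J = 0" by (simp add: FactRing_def ring_of_type_algebra_def)
    moreover have "J +>\<^bsub>?P\<^esub> v \<in> carrier (?P Quot J)" "J \<in> carrier (?P Quot J)"
      using v qh(1) Q.zero_closed by (auto simp: FactRing_def)
    ultimately have "\<psi> v = 0 \<longleftrightarrow> J +>\<^bsub>?P\<^esub> v = J"
      using hh(5) unfolding \<psi>_def bij_betw_def by (metis inj_onD)
    also have "\<dots> \<longleftrightarrow> v \<in> J"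
      using v J.a_rcos_self J.a_rcos_const by blast
    finally show ?thesis .
  qed
  define I where "I s = {p. \<phi> s p = \<zero>\<^bsub>F s\<^esub>}" for s
  define \<Phi> where "\<Phi> z = \<psi> (\<lambda>s\<in>S. \<phi> s (z s))" for z
  have cl: "(\<lambda>s\<in>S. \<phi> s (z s)) \<in> carrier ?P" for z
    using \<phi>(1) by (auto simp: product_ring_def)
  show ?thesis
  proof (rule that[of \<Phi> I])
    show "\<Phi> (\<lambda>s. z s + w s) = \<Phi> z + \<Phi> w" for z w
      unfolding \<Phi>_def \<psi>(1)[OF cl cl, symmetric]
      by (rule arg_cong[of _ _ \<psi>]) (auto simp: product_ring_def \<phi>(2))
    show "\<Phi> (\<lambda>s. z s * w s) = \<Phi> z * \<Phi> w" for z w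
      unfolding \<Phi>_def \<psi>(2)[OF cl cl, symmetric]
      by (rule arg_cong[of _ _ \<psi>]) (auto simp: product_ring_def \<phi>(3))
    have "(\<lambda>s\<in>S. \<phi> s 1) = \<one>\<^bsub>?P\<^esub>" by (auto simp: product_ring_def \<phi>(4))
    then show "\<Phi> (\<lambda>s. 1) = 1" using \<psi>1 by (simp add: \<Phi>_def)
    show "surj \<Phi>"
      unfolding surj_def
    proof
      fix y
      obtain v where v: "v \<in> carrier ?P" "\<psi> v = y" using \<psi>surj by blast
      have "\<forall>s\<in>S. \<exists>p. \<phi> s p = v s"
      proof
        fix s assume "s \<in> S"
        then have "v s \<in> \<phi> s ` UNIV" using v(1) \<phi>(5) by (auto simp: product_ring_def)
        then show "\<exists>p. \<phi> s p = v s" by (metis imageE)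
      qed
      then obtain z where "\<And>s. s \<in> S \<Longrightarrow> \<phi> s (z s) = v s" by metis
      then have "(\<lambda>s\<in>S. \<phi> s (z s)) = v" using v(1) by (auto simp: product_ring_def PiE_def extensional_def)
      then show "\<exists>z. y = \<Phi> z" using v(2) by (auto simp: \<Phi>_def)
    qed
    show "\<Phi> z = 0 \<longleftrightarrow> (\<forall>\<^sub>F s in D. z s \<in> I s)" for z
    proof -
      have "\<Phi> z = 0 \<longleftrightarrow> (\<lambda>s\<in>S. \<phi> s (z s)) \<in> J"
        unfolding \<Phi>_def by (rule \<psi>0[OF cl])
      also have "\<dots> \<longleftrightarrow> (\<forall>\<^sub>F s in D. (\<lambda>s\<in>S. \<phi> s (z s)) s = \<zero>\<^bsub>F s\<^esub>)"
        unfolding J_def mem_Collect_eq using cl by blast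
      also have "\<dots> \<longleftrightarrow> (\<forall>\<^sub>F s in D. z s \<in> I s)"
        by (rule eventually_cong[OF evS]) (simp add: I_def)
      finally show ?thesis .
    qed
    show "finite_residue_field (I s) (q s)" if "s \<in> S" for s
      unfolding I_def by (rule \<phi>(6)[OF that])
    show "\<exists>i. z - Polynomial.monom 1 i \<in> I s" if "s \<in> S" "z \<notin> I s" for s z
      using \<phi>(7)[OF that(1), of z] that(2) unfolding I_def mem_Collect_eq by blast
  qed
qed

section \<open>Squares in finite residue fields and in their ultraproduct\<close>

context finite_residue_field
begin

text \<open>A root of \<open>z\<close> is its (q / 2)-th power, by Fermat. A nonsquare in the
  ultraproduct therefore forces \<open>q\<close> to be odd along the filter.\<close>

lemma square_if_even: assumes "even q" shows "\<exists>y. z - y ^ 2 \<in> I"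
proof -
  have "z - (z ^ (q div 2)) ^ 2 \<in> I"
    using ideal_cong_sym[OF ideal_I fermat[of z]] assms by (simp add: power_mult[symmetric])
  then show ?thesis by blast
qed

lemma two_notin_if_odd: assumes "odd q" shows "2 \<notin> I"
proof
  assume 2: "2 \<in> I"
  obtain k where k: "q = 2 * k + 1" using assms by (auto elim: oddE)
  have "(1::'a) = of_nat q - of_nat k * 2" by (simp add: k)
  then show False using ideal_diff[OF ideal_I of_nat_q ideal_mult[OF ideal_I 2]] one_notin by metis
qed

text \<open>Nonsquares are odd powers of the generator \<open>g\<close>, so a product of two of them
  has an even exponent.\<close>

lemma square_or_square:
  assumes gen: "\<And>z. z \<notin> I \<Longrightarrow> \<exists>i::nat. z - g ^ i \<in> I"
    and "\<nexists>y. a * b - y ^ 2 \<in> I"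
  shows "(\<exists>y. a - y ^ 2 \<in> I) \<or> (\<exists>y. b - y ^ 2 \<in> I)"
proof (rule ccontr)
  assume *: "\<not> ?thesis"
  have odd: "\<exists>i. odd i \<and> z - g ^ i \<in> I" if z: "\<nexists>y. z - y ^ 2 \<in> I" for z
  proof -
    have "z \<notin> I" using z[simplified, rule_format, of 0] by simp
    then obtain i where i: "z - g ^ i \<in> I" using gen by blast
    have "odd i"
    proof
      assume "even i"
      then have "g ^ i = (g ^ (i div 2)) ^ 2" by (simp add: power_mult[symmetric])
      then show False using z i by metis
    qed
    with i show ?thesis by blast
  qed
  obtain i where i: "odd i" "a - g ^ i \<in> I" using odd[of a] * by blast
  obtain j where j: "odd j" "b - g ^ j \<in> I" using odd[of b] * by blast
  have "a * b - g ^ i * g ^ j \<in> I" by (rule ideal_cong_mult[OF ideal_I i(2) j(2)])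
  moreover have "g ^ i * g ^ j = (g ^ ((i + j) div 2)) ^ 2"
    using i(1) j(1) by (simp add: power_add[symmetric] power_mult[symmetric])
  ultimately show False using assms(2) by metis
qed

end

text \<open>Three instances of Los's theorem, carried out by choosing representatives in the
  factors. The nonsquare \<epsilon> makes \<open>q s\<close> odd eventually, which gives the first
  fact and puts the square-value theorem within reach for the third.\<close>

lemma ultraproduct_of_finite_fields:
  fixes S :: "'s set" and D :: "'s filter" and q :: "'s \<Rightarrow> nat" and F :: "'s \<Rightarrow> 'f ring"
    and \<epsilon> :: "'g::field"
  assumes D: "nonprincipal_ultrafilter_on S D"
    and q: "\<And>s. s \<in> S \<Longrightarrow> primepow (q s)" "\<And>N. \<forall>\<^sub>F s in D. N < q s"
    and F: "\<And>s. s \<in> S \<Longrightarrow> field (F s)" "\<And>s. s \<in> S \<Longrightarrow> card (carrier (F s)) = q s"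
    and iso: "ultraproduct S F D \<simeq> (ring_of_type_algebra :: 'g ring)"
    and \<epsilon>: "\<nexists>x. \<epsilon> = x ^ 2"
  shows "(2::'g) \<noteq> 0"
    and "\<And>x y::'g. \<nexists>z. x = z ^ 2 \<Longrightarrow> \<nexists>z. y = z ^ 2 \<Longrightarrow> \<exists>z. x * y = z ^ 2"
    and "\<And>(Q::'g poly) m. degree Q \<le> 2 * m \<Longrightarrow> (\<And>x. poly Q x \<noteq> 0 \<and> (\<exists>y. poly Q x = y ^ 2)) \<Longrightarrow>
      \<exists>T. Q = T ^ 2"
proof -
  have DS: "D \<le> principal S" and ultra: "\<And>P. (\<forall>\<^sub>F s in D. P s) \<or> (\<forall>\<^sub>F s in D. \<not> P s)"
    and bot: "D \<noteq> bot"
    using D unfolding nonprincipal_ultrafilter_on_def by (auto dest: spec[of _ "Collect _"])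
  have evS: "\<forall>\<^sub>F s in D. s \<in> S" using DS by (simp add: le_principal)
  obtain \<Phi> :: "('s \<Rightarrow> int poly) \<Rightarrow> 'g" and I :: "'s \<Rightarrow> int poly set" where
    \<Phi>: "\<And>z w. \<Phi> (\<lambda>s. z s + w s) = \<Phi> z + \<Phi> w" "\<And>z w. \<Phi> (\<lambda>s. z s * w s) = \<Phi> z * \<Phi> w"
    "\<Phi> (\<lambda>s. 1) = 1" "surj \<Phi>" "\<And>z. \<Phi> z = 0 \<longleftrightarrow> (\<forall>\<^sub>F s in D. z s \<in> I s)"
    and frf: "\<And>s. s \<in> S \<Longrightarrow> finite_residue_field (I s) (q s)"
    and gen: "\<And>s z. s \<in> S \<Longrightarrow> z \<notin> I s \<Longrightarrow> \<exists>i. z - Polynomial.monom 1 i \<in> I s"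
    by (rule ultraproduct_presentation[OF DS q(1) F iso], assumption, assumption, assumption) (rule that)
  have \<Phi>0: "\<Phi> (\<lambda>s. 0) = 0" 
  proof (rule add_left_imp_eq)
    show "\<Phi> (\<lambda>s. 0) + \<Phi> (\<lambda>s. 0) = \<Phi> (\<lambda>s. 0) + 0"
      using \<Phi>(1)[of "\<lambda>s. 0" "\<lambda>s. 0"] by (simp only: add_0_left add_0_right)
  qed
  have \<Phi>pow: "\<Phi> (\<lambda>s. z s ^ n) = \<Phi> z ^ n" for z n
    by (induction n) (simp_all add: \<Phi>)
  have \<Phi>diff: "\<Phi> (\<lambda>s. z s - w s) = \<Phi> z - \<Phi> w" for z w
    using \<Phi>(1)[of "\<lambda>s. z s - w s" w] by simp
  have \<Phi>sum: "\<Phi> (\<lambda>s. \<Sum>i\<in>A. g i s) = (\<Sum>i\<in>A. \<Phi> (g i))" for g and A :: "nat set"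
    by (induction A rule: infinite_finite_induct) (simp_all add: \<Phi> \<Phi>0)
  have eq_iff: "\<Phi> z = \<Phi> w \<longleftrightarrow> (\<forall>\<^sub>F s in D. z s - w s \<in> I s)" for z w
    using \<Phi>(5)[of "\<lambda>s. z s - w s"] by (simp add: \<Phi>diff)
  have lift: "\<exists>z. \<Phi> z = x" for x using \<Phi>(4) by (metis surjD)
  \<comment> \<open>The existential quantifier passes to the ultraproduct by choosing a root in each
    factor.\<close>
  have square_iff: "(\<exists>x. \<Phi> z = x ^ 2) \<longleftrightarrow> (\<forall>\<^sub>F s in D. \<exists>y. z s - y ^ 2 \<in> I s)" for z
  proof
    assume "\<exists>x. \<Phi> z = x ^ 2"
    then obtain y where "\<Phi> z = \<Phi> (\<lambda>s. y s ^ 2)" using lift \<Phi>pow by metis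
    then show "\<forall>\<^sub>F s in D. \<exists>y. z s - y ^ 2 \<in> I s"
      unfolding eq_iff by (rule eventually_mono) blast
  next
    assume *: "\<forall>\<^sub>F s in D. \<exists>y. z s - y ^ 2 \<in> I s"
    define y where "y s = (SOME y. z s - y ^ 2 \<in> I s)" for s
    have "\<forall>\<^sub>F s in D. z s - y s ^ 2 \<in> I s"
      using * by (rule eventually_mono) (auto simp: y_def intro: someI_ex)
    then have "\<Phi> z = \<Phi> (\<lambda>s. y s ^ 2)" unfolding eq_iff .
    then show "\<exists>x. \<Phi> z = x ^ 2" using \<Phi>pow by metis
  qed
  \<comment> \<open>Negation passes through because \<open>D\<close> is an ultrafilter.\<close>
  have nonsquareD: "\<forall>\<^sub>F s in D. \<nexists>y. z s - y ^ 2 \<in> I s" if "\<nexists>x. \<Phi> z = x ^ 2" for z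
    using ultra[of "\<lambda>s. \<exists>y. z s - y ^ 2 \<in> I s"] that square_iff by blast
  obtain e where "\<Phi> e = \<epsilon>" using lift by blast
  then have "\<nexists>x. \<Phi> e = x ^ 2" using \<epsilon> by simp
  from nonsquareD[OF this] evS have odd: "\<forall>\<^sub>F s in D. odd (q s)"
    by eventually_elim (use finite_residue_field.square_if_even[OF frf] in blast)
  have two: "\<forall>\<^sub>F s in D. 2 \<notin> I s"
    using odd evS by eventually_elim (use finite_residue_field.two_notin_if_odd[OF frf] in blast)
  show "(2::'g) \<noteq> 0"
  proof
    assume "(2::'g) = 0"
    moreover have "\<Phi> (\<lambda>s. 2) = 2" using \<Phi>(1)[of "\<lambda>s. 1" "\<lambda>s. 1"] \<Phi>(3) by simp
    ultimately have "\<forall>\<^sub>F s in D. 2 \<in> I s" using \<Phi>(5)[of "\<lambda>s. 2"] by simp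
    with two have "\<forall>\<^sub>F s in D. False" by eventually_elim simp
    then show False using bot by (simp add: trivial_limit_def)
  qed
  show "\<exists>z. x * y = z ^ 2" if xy: "\<nexists>z. x = z ^ 2" "\<nexists>z. y = z ^ 2" for x y :: 'g
  proof -
    obtain a b where ab: "\<Phi> a = x" "\<Phi> b = y" using lift by metis
    show ?thesis
    proof (rule ccontr)
      assume "\<nexists>z. x * y = z ^ 2"
      then have "\<nexists>z. \<Phi> (\<lambda>s. a s * b s) = z ^ 2" by (simp add: \<Phi> ab)
      note ab' = nonsquareD[OF this]
      have "\<nexists>z. \<Phi> a = z ^ 2" "\<nexists>z. \<Phi> b = z ^ 2" using xy ab by auto
      from evS ab' nonsquareD[OF this(1)] nonsquareD[OF this(2)] have "\<forall>\<^sub>F s in D. False"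
      proof eventually_elim
        case (elim s)
        have "\<exists>i. z - [:0, 1:] ^ i \<in> I s" if "z \<notin> I s" for z
          using gen[OF elim(1) that] by (simp add: monom_altdef)
        from finite_residue_field.square_or_square[OF frf[OF elim(1)] this elim(2)] elim(3,4)
        show ?case by blast
      qed
      then show False using bot by (simp add: trivial_limit_def)
    qed
  qed
  show "\<exists>T. Q = T ^ 2" if deg: "degree Q \<le> 2 * m" and sq: "\<And>x. poly Q x \<noteq> 0 \<and> (\<exists>y. poly Q x = y ^ 2)"
    for Q :: "'g poly" and m
  proof -
    \<comment> \<open>\<open>Q\<close> is lifted coefficientwise to a family \<open>f s\<close> of
      polynomials with a common degree bound, so that evaluation commutes with \<Phi>.\<close>
    define c where "c i = inv_into UNIV \<Phi> (coeff Q i)" for i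
    have c: "\<Phi> (c i) = coeff Q i" for i by (simp add: c_def f_inv_into_f \<Phi>(4))
    define f where "f s = (\<Sum>i\<le>2 * m. Polynomial.monom (c i s) i)" for s
    have coeff_f: "coeff (f s) n = (if n \<le> 2 * m then c n s else 0)" for n s
      by (simp add: f_def coeff_sum coeff_monom)
    have deg_f: "degree (f s) \<le> 2 * m" for s by (rule degree_le) (simp add: coeff_f)
    have \<Phi>f: "\<Phi> (\<lambda>s. poly (f s) (x s)) = poly Q (\<Phi> x)" for x
    proof -
      have "poly Q (\<Phi> x) = (\<Sum>i\<le>2 * m. coeff Q i * \<Phi> x ^ i)"
        unfolding poly_altdef using deg
        by (intro sum.mono_neutral_left) (auto simp: coeff_eq_0)
      then show ?thesis by (simp add: f_def poly_sum poly_monom \<Phi>sum \<Phi> \<Phi>pow c)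
    qed
    have \<Phi>c: "\<Phi> (\<lambda>s. coeff (f s) n) = coeff Q n" for n
      using deg by (cases "n \<le> 2 * m") (auto simp: coeff_f c \<Phi>0 coeff_eq_0)
    let ?good = "\<lambda>s x. poly (f s) x \<notin> I s \<and> (\<exists>y. poly (f s) x - y ^ 2 \<in> I s)"
    \<comment> \<open>Otherwise a bad argument chosen in each factor would define a bad argument for
      \<open>Q\<close>.\<close>
    have good: "\<forall>\<^sub>F s in D. \<forall>x. ?good s x"
    proof (rule ccontr)
      assume "\<not> ?thesis"
      then have ev: "\<forall>\<^sub>F s in D. \<exists>x. \<not> ?good s x" using ultra[of "\<lambda>s. \<forall>x. ?good s x"] by auto
      define x where "x s = (SOME x. \<not> ?good s x)" for s
      have bad: "\<forall>\<^sub>F s in D. \<not> ?good s (x s)"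
        using ev by (rule eventually_mono) (unfold x_def, rule someI_ex)
      have "\<Phi> (\<lambda>s. poly (f s) (x s)) \<noteq> 0" using sq[of "\<Phi> x"] by (simp add: \<Phi>f)
      then have "\<forall>\<^sub>F s in D. poly (f s) (x s) \<notin> I s"
        using \<Phi>(5)[of "\<lambda>s. poly (f s) (x s)"] ultra[of "\<lambda>s. poly (f s) (x s) \<in> I s"] by blast
      moreover have "\<forall>\<^sub>F s in D. \<exists>y. poly (f s) (x s) - y ^ 2 \<in> I s"
        using sq[of "\<Phi> x"] square_iff[of "\<lambda>s. poly (f s) (x s)"] by (simp add: \<Phi>f)
      ultimately have "\<forall>\<^sub>F s in D. False" using bad by eventually_elim blast
      then show False using bot by (simp add: trivial_limit_def)
    qed
    \<comment> \<open>\<open>B\<close> depends on \<open>m\<close> only, so \<open>q s\<close>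
      exceeds it eventually.\<close>
    obtain B where B: "\<And>(I::int poly set) q f. finite_residue_field I q \<Longrightarrow> 2 \<notin> I \<Longrightarrow> odd q \<Longrightarrow> q > B \<Longrightarrow>
       degree f \<le> 2 * m \<Longrightarrow> (\<And>x. poly f x \<notin> I \<and> (\<exists>y. poly f x - y ^ 2 \<in> I)) \<Longrightarrow>
       \<exists>s. degree s \<le> m \<and> f - s ^ 2 \<in> coeffs_in I"
      using square_of_square_values[where 'a = "int poly" and m = m] by metis
    define sq where "sq s T \<longleftrightarrow> degree T \<le> m \<and> f s - T ^ 2 \<in> coeffs_in (I s)" for s T
    \<comment> \<open>The default 0 makes the degree bound hold for every \<open>s\<close>, so the
      coefficients beyond \<open>m\<close> vanish in all factors and not merely along
      \<open>D\<close>.\<close>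
    define T where "T s = (if \<exists>T. sq s T then SOME T. sq s T else 0)" for s
    have T: "\<exists>T. sq s T \<Longrightarrow> sq s (T s)" for s unfolding T_def by (simp add: someI_ex)
    have degT: "degree (T s) \<le> m" for s
      using T[of s] by (cases "\<exists>T. sq s T") (auto simp: sq_def T_def)
    have ev: "\<forall>\<^sub>F s in D. f s - T s ^ 2 \<in> coeffs_in (I s)"
      using good evS odd two q(2)[of B]
    proof eventually_elim
      case (elim s)
      have "\<exists>T. sq s T" unfolding sq_def
        by (rule B[OF frf]) (use elim deg_f in auto)
      then show ?case using T by (auto simp: sq_def)
    qed
    define T' where "T' = (\<Sum>i\<le>m. Polynomial.monom (\<Phi> (\<lambda>s. coeff (T s) i)) i)"
    have cT: "coeff T' i = \<Phi> (\<lambda>s. coeff (T s) i)" for i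
    proof (cases "i \<le> m")
      case False
      then have "coeff (T s) i = 0" for s using degT[of s] by (simp add: coeff_eq_0)
      then show ?thesis using False by (simp add: T'_def coeff_sum coeff_monom \<Phi>0)
    qed (simp add: T'_def coeff_sum coeff_monom)
    have "coeff Q n = coeff (T' ^ 2) n" for n
    proof -
      have "coeff (T' ^ 2) n = \<Phi> (\<lambda>s. coeff (T s ^ 2) n)"
        by (simp add: power2_eq_square coeff_mult cT \<Phi>sum \<Phi>)
      moreover have "\<forall>\<^sub>F s in D. coeff (f s) n - coeff (T s ^ 2) n \<in> I s"
        using ev by (rule eventually_mono) (simp add: coeffs_in_def)
      ultimately show ?thesis using \<Phi>c[of n] eq_iff by metis
    qed
    then show ?thesis by (intro exI[of _ T']) (rule poly_eqI)
  qed
qed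

subsection \<open>Anisotropic norm forms over valued fields\<close>

text \<open>The value at 0 is left unspecified, hence the guards; \<open>val_ge\<close> treats 0 as
  having infinite valuation.\<close>

definition field_valuation :: "('k::field \<Rightarrow> int) \<Rightarrow> bool" where
  "field_valuation v \<longleftrightarrow> (\<forall>x y. x \<noteq> 0 \<longrightarrow> y \<noteq> 0 \<longrightarrow> v (x * y) = v x + v y) \<and>
     (\<forall>x y. x \<noteq> 0 \<longrightarrow> y \<noteq> 0 \<longrightarrow> x + y \<noteq> 0 \<longrightarrow> min (v x) (v y) \<le> v (x + y))"

definition val_ge :: "('k::field \<Rightarrow> int) \<Rightarrow> int \<Rightarrow> 'k \<Rightarrow> bool" where
  "val_ge v n x \<longleftrightarrow> x = 0 \<or> n \<le> v x"

text \<open>For \<open>v e\<close> even and residue characteristic not 2, this says that \<open>e\<close> is not a square in the completion.\<close>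

definition residue_nonsquare :: "('k::field \<Rightarrow> int) \<Rightarrow> 'k \<Rightarrow> bool" where
  "residue_nonsquare v e \<longleftrightarrow> e \<noteq> 0 \<and> (\<forall>u. \<not> val_ge v (v e + 1) (u ^ 2 - e))"

definition quaternion_norm :: "'k::field \<Rightarrow> 'k \<Rightarrow> 'k \<Rightarrow> 'k \<Rightarrow> 'k \<Rightarrow> 'k \<Rightarrow> 'k" where
  "quaternion_norm a b w x y z = w ^ 2 - a * x ^ 2 - b * y ^ 2 + a * b * z ^ 2"

text \<open>A quantitative form of anisotropy, which passes to the completion.\<close>

definition norm_anisotropic :: "('k::field \<Rightarrow> int) \<Rightarrow> 'k \<Rightarrow> 'k \<Rightarrow> bool" where
  "norm_anisotropic v a b \<longleftrightarrow> (\<exists>k. \<forall>n w x y z. val_ge v (2 * n + k) (quaternion_norm a b w x y z) \<longrightarrow>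
     val_ge v n w \<and> val_ge v n x \<and> val_ge v n y \<and> val_ge v n z)"

context
  fixes v :: "'k::field \<Rightarrow> int"
  assumes v: "field_valuation v"
begin

lemma val_mult: "x \<noteq> 0 \<Longrightarrow> y \<noteq> 0 \<Longrightarrow> v (x * y) = v x + v y"
  using v by (auto simp: field_valuation_def)

lemma val_one: "v 1 = 0"
  using val_mult[of 1 1] by simp

lemma val_minus: "v (- x) = v x"
proof (cases "x = 0")
  case False
  have "v (-1) + v (-1) = 0" using val_mult[of "-1" "-1"] val_one by simp
  then show ?thesis using False val_mult[of "-1" x] by simp
qed simp

lemma val_power2: "x \<noteq> 0 \<Longrightarrow> v (x ^ 2) = 2 * v x"
  by (simp add: power2_eq_square val_mult)

lemma val_inverse: "x \<noteq> 0 \<Longrightarrow> v (inverse x) = - v x"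
  using val_mult[of x "inverse x"] val_one by simp

lemma val_divide: "x \<noteq> 0 \<Longrightarrow> y \<noteq> 0 \<Longrightarrow> v (x / y) = v x - v y"
  by (simp add: divide_inverse val_mult val_inverse)

lemma val_ge_0 [simp]: "val_ge v n 0"
  by (simp add: val_ge_def)

lemma val_ge_self: "val_ge v (v x) x"
  by (simp add: val_ge_def)

lemma val_ge_mono: "val_ge v n x \<Longrightarrow> m \<le> n \<Longrightarrow> val_ge v m x"
  by (auto simp: val_ge_def)

lemma val_ge_add: "val_ge v n x \<Longrightarrow> val_ge v n y \<Longrightarrow> val_ge v n (x + y)"
  using v unfolding val_ge_def field_valuation_def
  by (cases "x = 0 \<or> y = 0 \<or> x + y = 0") (auto, smt (verit))

lemma val_ge_minus: "val_ge v n (- x) \<longleftrightarrow> val_ge v n x"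
  by (simp add: val_ge_def val_minus)

lemma val_ge_diff: "val_ge v n x \<Longrightarrow> val_ge v n y \<Longrightarrow> val_ge v n (x - y)"
  using val_ge_add[of n x "- y"] by (simp add: val_ge_minus)

lemma val_ge_mult: "val_ge v n x \<Longrightarrow> val_ge v m y \<Longrightarrow> val_ge v (n + m) (x * y)"
  by (cases "x = 0 \<or> y = 0") (auto simp: val_ge_def val_mult)

lemma val_add_eq:
  assumes "x \<noteq> 0" "val_ge v (v x + 1) d" shows "x + d \<noteq> 0" "v (x + d) = v x"
proof -
  have not_ge: "\<not> val_ge v (v x + 1) (x + d)"
    using val_ge_diff[of "v x + 1" "x + d" d] assms by (auto simp: val_ge_def)
  then show "x + d \<noteq> 0" by auto
  have "val_ge v (v x) (x + d)"
    using assms by (intro val_ge_add val_ge_self) (rule val_ge_mono, auto)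
  then show "v (x + d) = v x" using not_ge by (auto simp: val_ge_def)
qed

text \<open>The two terms cannot cancel: for nonzero \<open>y\<close> and u = x / y the form is y^2
  (u^2 - e), and u^2 - e has valuation at most that of \<open>e\<close>.\<close>

lemma norm_form_val_ge:
  assumes e: "residue_nonsquare v e" and n: "val_ge v n (x ^ 2 - e * y ^ 2)"
  shows "val_ge v n (x ^ 2)" "val_ge v n (e * y ^ 2)"
proof -
  show ey: "val_ge v n (e * y ^ 2)"
  proof (cases "y = 0")
    case False
    let ?u = "x / y"
    have "x ^ 2 - e * y ^ 2 = y ^ 2 * (?u ^ 2 - e)"
      using False by (simp add: power_divide right_diff_distrib)
    moreover have "\<not> val_ge v (v e + 1) (?u ^ 2 - e)" using e by (simp add: residue_nonsquare_def)
    then have "?u ^ 2 - e \<noteq> 0" "v (?u ^ 2 - e) \<le> v e" by (auto simp: val_ge_def)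
    ultimately show ?thesis
      using n False e by (auto simp: val_ge_def val_mult residue_nonsquare_def)
  qed simp
  show "val_ge v n (x ^ 2)" using val_ge_add[OF n ey] by simp
qed

text \<open>Both terms have even valuation when nonzero. If the difference had odd valuation, the
  terms, being at least as divisible, would be strictly more divisible, and so would their
  difference.\<close>

lemma norm_form_even:
  assumes e: "residue_nonsquare v e" "even (v e)" and "x ^ 2 - e * y ^ 2 \<noteq> 0"
  shows "even (v (x ^ 2 - e * y ^ 2))"
proof (rule ccontr)
  assume odd: "odd (v (x ^ 2 - e * y ^ 2))"
  let ?n = "v (x ^ 2 - e * y ^ 2)"
  have ge: "val_ge v ?n (x ^ 2)" "val_ge v ?n (e * y ^ 2)"
    using norm_form_val_ge[OF e(1) val_ge_self] by auto
  have "val_ge v (?n + 1) (x ^ 2)"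
    using ge(1) odd by (cases "x = 0") (auto simp: val_ge_def val_power2 zle_add1_eq_le order_le_less)
  moreover have "val_ge v (?n + 1) (e * y ^ 2)"
  proof (cases "y = 0")
    case False
    then have "v (e * y ^ 2) = v e + 2 * v y"
      using e by (simp add: val_mult val_power2 residue_nonsquare_def)
    then have "even (v (e * y ^ 2))" using e(2) by simp
    then have "v (e * y ^ 2) \<noteq> ?n" using odd by metis
    then show ?thesis using ge(2) by (auto simp: val_ge_def)
  qed simp
  ultimately have "val_ge v (?n + 1) (x ^ 2 - e * y ^ 2)" by (rule val_ge_diff)
  then show False using assms(3) by (simp add: val_ge_def)
qed

text \<open>When nonzero, the first form has even valuation and \<open>f\<close> times the second
  has odd valuation. They cannot cancel, so each is at least as divisible as their
  difference.\<close>

lemma double_norm_form_val_ge: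
  assumes e: "residue_nonsquare v e" "even (v e)" and f: "odd (v f)" "f \<noteq> 0"
    and n: "val_ge v n ((x1 ^ 2 - e * x2 ^ 2) - f * (x3 ^ 2 - e * x4 ^ 2))"
  shows "val_ge v n (x1 ^ 2)" "val_ge v n (e * x2 ^ 2)" "val_ge v n (f * x3 ^ 2)" "val_ge v n (f * (e * x4 ^ 2))"
proof -
  define N1 N2 where "N1 = x1 ^ 2 - e * x2 ^ 2" and "N2 = x3 ^ 2 - e * x4 ^ 2"
  have n': "val_ge v n (N1 - f * N2)" using n by (simp add: N1_def N2_def)
  have parity: "v N1 \<noteq> v (f * N2)" if "N1 \<noteq> 0" "N2 \<noteq> 0"
  proof -
    have "even (v N1)" "even (v N2)"
      using norm_form_even[OF e] that unfolding N1_def N2_def by blast+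
    moreover have "v (f * N2) = v f + v N2" using f that by (simp add: val_mult)
    ultimately have "odd (v (f * N2))" using f by simp
    with \<open>even (v N1)\<close> show ?thesis by metis
  qed
  have N1: "val_ge v n N1"
  proof (rule ccontr)
    assume not: "\<not> val_ge v n N1"
    then have nz: "N1 \<noteq> 0" "v N1 < n" by (auto simp: val_ge_def)
    \<comment> \<open>If \<open>N1\<close> had valuation below \<open>n\<close>, then
      \<open>f * N2\<close> would have the same valuation, against parity.\<close>
    have "val_ge v (v N1 + 1) (- (N1 - f * N2))"
      using n' nz by (simp only: val_ge_minus) (rule val_ge_mono, auto)
    from val_add_eq[OF nz(1) this] have "f * N2 \<noteq> 0" "v (f * N2) = v N1" by simp_all
    then show False using parity nz by auto
  qed
  have N2: "val_ge v n (f * N2)" using val_ge_diff[OF N1 n'] by simp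
  have "val_ge v (n - v f) N2" using N2 f by (cases "N2 = 0") (auto simp: val_ge_def val_mult)
  then have "val_ge v (n - v f) (x3 ^ 2)" "val_ge v (n - v f) (e * x4 ^ 2)"
    using norm_form_val_ge[OF e(1)] by (auto simp: N2_def)
  then show "val_ge v n (f * x3 ^ 2)" "val_ge v n (f * (e * x4 ^ 2))"
    using val_ge_mult[OF val_ge_self[of f]] by fastforce+
  show "val_ge v n (x1 ^ 2)" "val_ge v n (e * x2 ^ 2)"
    using norm_form_val_ge[OF e(1)] N1 by (auto simp: N1_def)
qed

lemma val_ge_of_square:
  assumes "val_ge v (2 * n + k) (c * x ^ 2)" "c \<noteq> 0" "v c \<le> k"
  shows "val_ge v n x"
  using assms by (cases "x = 0") (auto simp: val_ge_def val_mult val_power2)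

text \<open>The norm form is grouped as a difference of two copies of x^2 - a y^2, the second scaled
  by \<open>b\<close>, whose valuation is odd.\<close>

lemma norm_anisotropic_odd_right:
  assumes "residue_nonsquare v a" "even (v a)" "b \<noteq> 0" "odd (v b)"
  shows "norm_anisotropic v a b"
  unfolding norm_anisotropic_def
proof (intro exI allI impI)
  fix n w x y z
  \<comment> \<open>This bounds the valuations of all four diagonal coefficients 1, a, b and a b, so
    the bounds on the scaled squares give \<open>n\<close> for each coordinate.\<close>
  define k where "k = \<bar>v a\<bar> + \<bar>v b\<bar>"
  have a: "a \<noteq> 0" using assms(1) by (simp add: residue_nonsquare_def)
  assume "val_ge v (2 * n + (\<bar>v a\<bar> + \<bar>v b\<bar>)) (quaternion_norm a b w x y z)"
  moreover have "quaternion_norm a b w x y z = (w ^ 2 - a * x ^ 2) - b * (y ^ 2 - a * z ^ 2)"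
    by (simp add: quaternion_norm_def algebra_simps)
  ultimately have "val_ge v (2 * n + k) ((w ^ 2 - a * x ^ 2) - b * (y ^ 2 - a * z ^ 2))"
    by (simp add: k_def)
  note * = double_norm_form_val_ge[OF assms(1,2,4,3) this]
  show "val_ge v n w \<and> val_ge v n x \<and> val_ge v n y \<and> val_ge v n z"
    using val_ge_of_square[of n k 1 w] val_ge_of_square[of n k a x] val_ge_of_square[of n k b y]
      val_ge_of_square[of n k "b * a" z] * a assms(3)
    by (simp add: k_def val_one val_mult mult.assoc)
qed

lemma norm_anisotropic_commute: "norm_anisotropic v a b \<Longrightarrow> norm_anisotropic v b a"
proof -
  assume "norm_anisotropic v a b"
  then obtain k where k: "\<And>n w x y z. val_ge v (2 * n + k) (quaternion_norm a b w x y z) \<Longrightarrow>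
     val_ge v n w \<and> val_ge v n x \<and> val_ge v n y \<and> val_ge v n z" by (auto simp: norm_anisotropic_def)
  have "quaternion_norm b a w x y z = quaternion_norm a b w y x z" for w x y z
    by (simp add: quaternion_norm_def algebra_simps)
  then show ?thesis using k unfolding norm_anisotropic_def by metis
qed

text \<open>The norm form of \<open>(a, b)\<close> is that of \<open>(-ab, a)\<close> after the substitution \<open>y \<mapsto> y / a\<close>.\<close>

lemma norm_anisotropic_odd_both:
  assumes "residue_nonsquare v (- (a * b))" "odd (v a)" "odd (v b)"
  shows "norm_anisotropic v a b"
  unfolding norm_anisotropic_def
proof (intro exI allI impI)
  fix n w x y z
  define k where "k = \<bar>v a\<bar> + \<bar>v b\<bar>"
  let ?e = "- (a * b)"
  have nz: "a \<noteq> 0" "b \<noteq> 0" using assms(1) by (auto simp: residue_nonsquare_def)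
  then have e: "even (v ?e)" "v ?e = v a + v b" using assms by (auto simp: val_minus val_mult)
  assume "val_ge v (2 * n + (\<bar>v a\<bar> + \<bar>v b\<bar>)) (quaternion_norm a b w x y z)"
  moreover have "quaternion_norm a b w x y z = (w ^ 2 - ?e * z ^ 2) - a * (x ^ 2 - ?e * (y / a) ^ 2)"
    using nz by (simp add: quaternion_norm_def field_simps power2_eq_square)
  ultimately have "val_ge v (2 * n + k) ((w ^ 2 - ?e * z ^ 2) - a * (x ^ 2 - ?e * (y / a) ^ 2))"
    by (simp add: k_def)
  note * = double_norm_form_val_ge[OF assms(1) e(1) assms(2) nz(1) this]
  have "a * (?e * (y / a) ^ 2) = (- b) * y ^ 2" using nz by (simp add: field_simps power2_eq_square)
  with *(4) have "val_ge v (2 * n + k) ((- b) * y ^ 2)" by (simp only:)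
  then have "val_ge v n y" by (rule val_ge_of_square) (use nz in \<open>simp_all add: k_def val_minus\<close>)
  moreover have "val_ge v n w"
    using *(1) val_ge_of_square[of n k 1 w] by (simp add: k_def val_one)
  moreover have "val_ge v n x"
    using *(3) by (rule val_ge_of_square) (use nz in \<open>simp_all add: k_def\<close>)
  moreover have "val_ge v n z"
    using *(2) by (rule val_ge_of_square) (use nz e in \<open>simp_all add: k_def\<close>)
  ultimately show "val_ge v n w \<and> val_ge v n x \<and> val_ge v n y \<and> val_ge v n z" by blast
qed

lemma norm_anisotropic_nonzero:
  assumes "norm_anisotropic v a b" "quaternion_norm a b w x y z = 0"
  shows "w = 0 \<and> x = 0 \<and> y = 0 \<and> z = 0"
proof -
  have "val_ge v n w \<and> val_ge v n x \<and> val_ge v n y \<and> val_ge v n z" for n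
    using assms unfolding norm_anisotropic_def by (metis val_ge_0)
  moreover have "u = 0" if "\<And>n. val_ge v n u" for u
    using that[of "v u + 1"] by (simp add: val_ge_def)
  ultimately show ?thesis by blast
qed

end

lemma field_valuation_fls_subdegree: "field_valuation (fls_subdegree :: 'a::field fls \<Rightarrow> int)"
  unfolding field_valuation_def by (auto simp: fls_plus_subdegree)

subsection \<open>Valuations of rational functions\<close>

lemma poly_multiplicity_ge_iff:
  assumes P: "P \<in> finite_primes" and A: "A \<noteq> 0"
  shows "n \<le> poly_multiplicity P A \<longleftrightarrow> P ^ n dvd A"
proof
  obtain A' where A': "A = P ^ poly_multiplicity P A * A'" "\<not> P dvd A'"
    using poly_multiplicity_decompose[OF P A] by blast
  show "P ^ n dvd A" if "n \<le> poly_multiplicity P A"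
    using le_imp_power_dvd[OF that, of P] A'(1) by (metis dvd_mult2)
  show "n \<le> poly_multiplicity P A" if "P ^ n dvd A"
  proof (rule ccontr)
    assume "\<not> n \<le> poly_multiplicity P A"
    then have "P ^ Suc (poly_multiplicity P A) dvd A"
      using that le_imp_power_dvd[of "Suc (poly_multiplicity P A)" n P] dvd_trans by auto
    then have "P ^ poly_multiplicity P A * P dvd P ^ poly_multiplicity P A * A'"
      using A'(1) by (metis power_Suc2)
    then show False using A'(2) finite_primesD(4)[OF P] by simp
  qed
qed

lemma field_valuation_Fin:
  assumes P: "P \<in> finite_primes"
  shows "field_valuation (valuation (Fin P))"
  unfolding field_valuation_def
proof (intro conjI allI impI)
  fix x y :: "'a poly fract"
  assume nz: "x \<noteq> 0" "y \<noteq> 0"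
  obtain A B where x: "x = Fract A B" "B \<noteq> 0" by (cases x) auto
  obtain C D where y: "y = Fract C D" "D \<noteq> 0" by (cases y) auto
  have AC: "A \<noteq> 0" "C \<noteq> 0" using nz x y by (auto simp: Zero_fract_def eq_fract)
  note m = poly_multiplicity_mult[OF P] and vF = valuation_Fin_Fract[OF P]
  show "valuation (Fin P) (x * y) = valuation (Fin P) x + valuation (Fin P) y"
    using x y AC by (simp add: vF m del: valuation.simps)
  assume "x + y \<noteq> 0"
  moreover have xy: "x + y = Fract (A * D + C * B) (B * D)" using x y by simp
  ultimately have s: "A * D + C * B \<noteq> 0" by (auto simp: Zero_fract_def eq_fract)
  define n where "n = min (poly_multiplicity P (A * D)) (poly_multiplicity P (C * B))"
  have "P ^ n dvd A * D" "P ^ n dvd C * B"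
    using AC x y by (auto simp: n_def poly_multiplicity_ge_iff[OF P, symmetric])
  then have "n \<le> poly_multiplicity P (A * D + C * B)"
    by (simp add: poly_multiplicity_ge_iff[OF P s])
  moreover have "valuation (Fin P) (x + y) = int (poly_multiplicity P (A * D + C * B)) - int (poly_multiplicity P (B * D))"
    unfolding xy using s x y by (intro vF) auto
  moreover have "valuation (Fin P) x = int (poly_multiplicity P A) - int (poly_multiplicity P B)"
    "valuation (Fin P) y = int (poly_multiplicity P C) - int (poly_multiplicity P D)"
    using x y AC by (simp_all add: vF del: valuation.simps)
  ultimately show "min (valuation (Fin P) x) (valuation (Fin P) y) \<le> valuation (Fin P) (x + y)"
    using AC x y by (auto simp: n_def m)
qed

lemma val_ge_valuation: "val_ge (valuation p) n x = valuation_ge p n x"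
  by (simp add: val_ge_def valuation_ge_def)

lemma to_fract_eq_0_iff: "to_fract A = 0 \<longleftrightarrow> A = 0"
  by (simp add: to_fract_def Zero_fract_def eq_fract)

lemma valuation_Fin_to_fract:
  assumes "P \<in> finite_primes" "A \<noteq> 0"
  shows "valuation (Fin P) (to_fract A) = int (poly_multiplicity P A)"
proof -
  have "poly_multiplicity P 1 = 0"
    using poly_multiplicity_eqI[OF assms(1), of 1 0] finite_primesD(5)[OF assms(1)] by auto
  then show ?thesis using assms by (simp add: to_fract_def valuation_Fin_Fract del: valuation.simps)
qed

lemma valuation_ge_to_fract_iff:
  assumes "P \<in> finite_primes"
  shows "valuation_ge (Fin P) (int n) (to_fract A) \<longleftrightarrow> P ^ n dvd A"
  using assms
  by (cases "A = 0") (auto simp: valuation_ge_def to_fract_eq_0_iff valuation_Fin_to_fract poly_multiplicity_ge_iff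
      simp del: valuation.simps)

subsection \<open>Tensor products with quaternion algebras\<close>

lemma frag_extend_diff_fun:
  fixes f g :: "'a \<Rightarrow> 'b \<Rightarrow>\<^sub>0 int"
  shows "frag_extend (\<lambda>x. f x - g x) u = frag_extend f u - frag_extend g u"
proof -
  have "frag_cmul c (x - y) = frag_cmul c x - frag_cmul c y" for c and x y :: "'b \<Rightarrow>\<^sub>0 int"
    by (rule poly_mapping_eqI) (simp add: right_diff_distrib lookup_minus)
  then show ?thesis by (simp add: frag_extend_def sum_subtractf)
qed

lemma pair_mult_diff_left:
  "(u - u') \<otimes>\<^bsub>pair_ring A B\<^esub> v = u \<otimes>\<^bsub>pair_ring A B\<^esub> v - u' \<otimes>\<^bsub>pair_ring A B\<^esub> v"
  by (simp add: pair_ring_def frag_extend_diff)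

lemma pair_mult_diff_right:
  "u \<otimes>\<^bsub>pair_ring A B\<^esub> (v - v') = u \<otimes>\<^bsub>pair_ring A B\<^esub> v - u \<otimes>\<^bsub>pair_ring A B\<^esub> v'"
  by (simp add: pair_ring_def frag_extend_diff case_prod_unfold frag_extend_diff_fun)

lemma pair_mult_zero [simp]: "0 \<otimes>\<^bsub>pair_ring A B\<^esub> v = 0" "u \<otimes>\<^bsub>pair_ring A B\<^esub> 0 = 0"
  using pair_mult_diff_left[where u = 0 and u' = 0] pair_mult_diff_right[where v = 0 and v' = 0] by simp_all

lemma pair_mult_minus_left: "(- u) \<otimes>\<^bsub>pair_ring A B\<^esub> v = - (u \<otimes>\<^bsub>pair_ring A B\<^esub> v)"
  using pair_mult_diff_left[where u = 0] by simp

lemma pair_mult_minus_right: "u \<otimes>\<^bsub>pair_ring A B\<^esub> (- v) = - (u \<otimes>\<^bsub>pair_ring A B\<^esub> v)"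
  using pair_mult_diff_right[where v = 0] by simp

lemma pair_mult_add_left:
  "(u + u') \<otimes>\<^bsub>pair_ring A B\<^esub> v = u \<otimes>\<^bsub>pair_ring A B\<^esub> v + u' \<otimes>\<^bsub>pair_ring A B\<^esub> v"
  using pair_mult_diff_left[where u' = "- u'"] by (simp add: pair_mult_minus_left)

lemma pair_mult_add_right:
  "u \<otimes>\<^bsub>pair_ring A B\<^esub> (v + v') = u \<otimes>\<^bsub>pair_ring A B\<^esub> v + u \<otimes>\<^bsub>pair_ring A B\<^esub> v'"
  using pair_mult_diff_right[where v' = "- v'"] by (simp add: pair_mult_minus_right)

lemmas pair_mult_linear = pair_mult_diff_left pair_mult_diff_right pair_mult_minus_left
  pair_mult_minus_right pair_mult_add_left pair_mult_add_right

lemma pair_mult_of: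
  "frag_of (x, y) \<otimes>\<^bsub>pair_ring A B\<^esub> frag_of (x', y') = frag_of (x \<otimes>\<^bsub>A\<^esub> x', y \<otimes>\<^bsub>B\<^esub> y')"
  by (simp add: pair_ring_def)

lemma pair_ring_carrier: "u \<in> carrier (pair_ring A B) \<longleftrightarrow> Poly_Mapping.keys u \<subseteq> carrier A \<times> carrier B"
  by (simp add: pair_ring_def)

lemma pair_ring_ops [simp]: "\<zero>\<^bsub>pair_ring A B\<^esub> = 0" "u \<oplus>\<^bsub>pair_ring A B\<^esub> v = u + v"
  "\<one>\<^bsub>pair_ring A B\<^esub> = frag_of (\<one>\<^bsub>A\<^esub>, \<one>\<^bsub>B\<^esub>)"
  by (simp_all add: pair_ring_def)

lemma pair_ring_closed:
  "0 \<in> carrier (pair_ring A B)"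
  "u \<in> carrier (pair_ring A B) \<Longrightarrow> v \<in> carrier (pair_ring A B) \<Longrightarrow> u + v \<in> carrier (pair_ring A B)"
  "u \<in> carrier (pair_ring A B) \<Longrightarrow> v \<in> carrier (pair_ring A B) \<Longrightarrow> u - v \<in> carrier (pair_ring A B)"
  "u \<in> carrier (pair_ring A B) \<Longrightarrow> - u \<in> carrier (pair_ring A B)"
  "x \<in> carrier A \<Longrightarrow> y \<in> carrier B \<Longrightarrow> frag_of (x, y) \<in> carrier (pair_ring A B)"
  unfolding pair_ring_carrier
  using keys_add[of u v] keys_diff[of u v] by (auto simp: keys_frag_of)

lemma pair_ring_induct [consumes 1, case_names zero of diff]:
  assumes "u \<in> carrier (pair_ring A B)" "P 0"
    "\<And>x y. x \<in> carrier A \<Longrightarrow> y \<in> carrier B \<Longrightarrow> P (frag_of (x, y))" "\<And>u v. P u \<Longrightarrow> P v \<Longrightarrow> P (u - v)"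
  shows "P u"
  using assms(1)[unfolded pair_ring_carrier] by (rule frag_induction) (use assms(2-) in auto)

text \<open>Multiplication is biadditive, so the ring laws reduce to generators, where they are
  those of \<open>A\<close> and \<open>B\<close>.\<close>

lemma ring_pair_ring:
  assumes "ring A" "ring B" shows "ring (pair_ring A B)"
proof -
  interpret A: ring A by fact
  interpret B: ring B by fact
  let ?P = "pair_ring A B"
  have closed: "u \<otimes>\<^bsub>?P\<^esub> v \<in> carrier ?P" if "u \<in> carrier ?P" "v \<in> carrier ?P" for u v
    using that(1)
  proof (induction rule: pair_ring_induct)
    case (of x y)
    show ?case using that(2)
    proof (induction rule: pair_ring_induct)
      case (of x' y')
      then show ?case using \<open>x \<in> _\<close> \<open>y \<in> _\<close> by (simp add: pair_mult_of pair_ring_closed)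
    qed (auto simp: pair_mult_linear pair_ring_closed)
  qed (auto simp: pair_mult_linear pair_ring_closed)
  have assoc: "u \<otimes>\<^bsub>?P\<^esub> v \<otimes>\<^bsub>?P\<^esub> w = u \<otimes>\<^bsub>?P\<^esub> (v \<otimes>\<^bsub>?P\<^esub> w)"
    if "u \<in> carrier ?P" "v \<in> carrier ?P" "w \<in> carrier ?P" for u v w
    using that(1)
  proof (induction rule: pair_ring_induct)
    case u: (of x y)
    show ?case using that(2)
    proof (induction rule: pair_ring_induct)
      case v: (of x' y')
      show ?case using that(3)
      proof (induction rule: pair_ring_induct)
        case (of x'' y'')
        then show ?case using u v by (simp add: pair_mult_of A.m_assoc B.m_assoc)
      qed (auto simp: pair_mult_linear)
    qed (auto simp: pair_mult_linear)
  qed (auto simp: pair_mult_linear)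
  have unit: "\<one>\<^bsub>?P\<^esub> \<otimes>\<^bsub>?P\<^esub> u = u" "u \<otimes>\<^bsub>?P\<^esub> \<one>\<^bsub>?P\<^esub> = u" if "u \<in> carrier ?P" for u
    using that
  proof (induction rule: pair_ring_induct)
    case (of x y)
    { case 1 then show ?case using of by (simp add: pair_mult_of) }
    { case 2 then show ?case using of by (simp add: pair_mult_of) }
  qed (auto simp: pair_mult_linear)
  show ?thesis
  proof (rule ringI)
    show "abelian_group ?P"
      by (rule abelian_groupI) (auto simp: pair_ring_closed intro!: bexI[of _ "- u" for u])
    show "Group.monoid ?P"
      by (rule monoidI) (use closed assoc unit in \<open>auto simp: pair_ring_closed\<close>)
  qed (auto simp: pair_mult_linear)
qed

text \<open>A common setting for the two kinds of completion, Cauchy sequences modulo null sequences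
  and Laurent series; \<open>g\<close> is the embedding of the base field.\<close>

locale quaternion_tensor = cring R for R :: "'r ring" (structure) +
  fixes a b :: "'k::field" and g :: "'k \<Rightarrow> 'r"
  assumes g_closed [simp]: "g x \<in> carrier R"
    and g_add: "g (x + y) = g x \<oplus> g y" and g_mult: "g (x * y) = g x \<otimes> g y" and g_one: "g 1 = \<one>"
    and nontrivial: "\<one> \<noteq> \<zero>"
begin

abbreviation H where "H \<equiv> quaternion_algebra a b"
abbreviation PR where "PR \<equiv> pair_ring H R"

definition J where "J = Idl\<^bsub>PR\<^esub> (tensor_relations quaternion_scalar H g R)"

lemma ring_PR: "ring PR"
  by (rule ring_pair_ring[OF ring_quaternion_algebra ring_axioms])

lemma carrier_H [simp]: "x \<in> carrier H"
  by (simp add: quaternion_algebra_def)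

lemma mult_H: "(w, x, y, z) \<otimes>\<^bsub>H\<^esub> (w', x', y', z') =
   (w * w' + a * x * x' + b * y * y' - a * b * z * z', w * x' + x * w' - b * y * z' + b * z * y',
    w * y' + y * w' + a * x * z' - a * z * x', w * z' + z * w' + x * y' - y * x')"
  and one_H: "\<one>\<^bsub>H\<^esub> = (1, 0, 0, 0)"
  and add_H: "(w, x, y, z) \<oplus>\<^bsub>H\<^esub> (w', x', y', z') = (w + w', x + x', y + y', z + z')"
  by (simp_all add: quaternion_algebra_def)

lemma relations_carrier: "tensor_relations quaternion_scalar H g R \<subseteq> carrier PR"
  unfolding tensor_relations_def by (auto intro!: pair_ring_closed)

sublocale J: ideal J PR
  unfolding J_def by (rule ring.genideal_ideal[OF ring_PR relations_carrier])

lemma relations_J: "tensor_relations quaternion_scalar H g R \<subseteq> J"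
  unfolding J_def by (rule ring.genideal_self[OF ring_PR relations_carrier])

lemma J_carrier: "u \<in> J \<Longrightarrow> u \<in> carrier PR"
  using J.a_subset by blast

lemma J_zero: "0 \<in> J"
  using additive_subgroup.zero_closed[OF J.is_additive_subgroup] by simp

lemma J_add: "u \<in> J \<Longrightarrow> v \<in> J \<Longrightarrow> u + v \<in> J"
  using additive_subgroup.a_closed[OF J.is_additive_subgroup] by fastforce

lemma J_minus: "u \<in> J \<Longrightarrow> - u \<in> J"
proof -
  assume u: "u \<in> J"
  have "frag_of (\<one>\<^bsub>H\<^esub>, \<one>) \<in> carrier PR" by (intro pair_ring_closed) auto
  then have "- frag_of (\<one>\<^bsub>H\<^esub>, \<one>) \<in> carrier PR" by (rule pair_ring_closed)
  from J.I_l_closed[OF u this] have "- (\<one>\<^bsub>PR\<^esub> \<otimes>\<^bsub>PR\<^esub> u) \<in> J" by (simp add: pair_mult_minus_left)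
  then show ?thesis using u J_carrier monoid.l_one[OF ring.is_monoid[OF ring_PR], of u] by simp
qed

lemma J_diff: "u \<in> J \<Longrightarrow> v \<in> J \<Longrightarrow> u - v \<in> J"
  using J_add[of u "- v"] J_minus[of v] by simp

lemma J_mult_left: "u \<in> J \<Longrightarrow> v \<in> carrier PR \<Longrightarrow> v \<otimes>\<^bsub>PR\<^esub> u \<in> J"
  by (rule J.I_l_closed)

lemma J_mult_right: "u \<in> J \<Longrightarrow> v \<in> carrier PR \<Longrightarrow> u \<otimes>\<^bsub>PR\<^esub> v \<in> J"
  by (rule J.I_r_closed)

lemma of_add_left:
  assumes "r \<in> carrier R"
  shows "frag_of ((w + w', x + x', y + y', z + z'), r) - frag_of ((w, x, y, z), r) - frag_of ((w', x', y', z'), r) \<in> J"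
proof -
  have "frag_of ((w, x, y, z) \<oplus>\<^bsub>H\<^esub> (w', x', y', z'), r) - frag_of ((w, x, y, z), r) - frag_of ((w', x', y', z'), r)
      \<in> tensor_relations quaternion_scalar H g R"
    unfolding tensor_relations_def using assms by (intro UnI1 CollectI) force
  then show ?thesis using relations_J by (auto simp: add_H)
qed

lemma of_add_right:
  assumes "r \<in> carrier R" "s \<in> carrier R"
  shows "frag_of (x, r \<oplus> s) - frag_of (x, r) - frag_of (x, s) \<in> J"
proof -
  have "frag_of (x, r \<oplus> s) - frag_of (x, r) - frag_of (x, s) \<in> tensor_relations quaternion_scalar H g R"
    unfolding tensor_relations_def
    by (rule UnI1, rule UnI2, rule CollectI, intro exI conjI, rule refl) (use assms in simp_all)
  then show ?thesis using relations_J by auto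
qed

lemma of_scalar:
  assumes "r \<in> carrier R"
  shows "frag_of ((c * w, c * x, c * y, c * z), r) - frag_of ((w, x, y, z), g c \<otimes> r) \<in> J"
proof -
  have "frag_of (quaternion_scalar c \<otimes>\<^bsub>H\<^esub> (w, x, y, z), r) - frag_of ((w, x, y, z), g c \<otimes> r)
      \<in> tensor_relations quaternion_scalar H g R"
    unfolding tensor_relations_def using assms by (intro UnI2 CollectI) force
  then show ?thesis using relations_J by (auto simp: quaternion_scalar_def mult_H)
qed

lemma of_zero_left:
  assumes "r \<in> carrier R" shows "frag_of ((0, 0, 0, 0), r) \<in> J"
  using J_minus[OF of_add_left[OF assms, of 0 0 0 0 0 0 0 0]] by simp

lemma of_minus_left:
  assumes "r \<in> carrier R"
  shows "frag_of ((- w, - x, - y, - z), r) + frag_of ((w, x, y, z), r) \<in> J"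
  using J_diff[OF of_zero_left[OF assms] of_add_left[OF assms, of "- w" w "- x" x "- y" y "- z" z]]
  by (simp add: add.commute)

lemma of_zero_right: "frag_of (x, \<zero>) \<in> J"
  using J_minus[OF of_add_right[of \<zero> \<zero> x]] by simp

lemma of_minus_right:
  assumes "r \<in> carrier R" shows "frag_of (x, \<ominus> r) + frag_of (x, r) \<in> J"
  using J_diff[OF of_zero_right[of x] of_add_right[of "\<ominus> r" r x]] assms by (simp add: l_neg add.commute)

text \<open>The relations are closed under multiplication by pure tensors on both sides, so any additive
  functional killing them and not \<open>1\<close> separates \<open>1\<close> from the ideal; take the scalar part.\<close>

lemma one_notin_J: "\<one>\<^bsub>PR\<^esub> \<notin> J"
proof
  assume one: "\<one>\<^bsub>PR\<^esub> \<in> J"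
  define S where "S = carrier H \<times> carrier R"
  \<comment> \<open>The scalar coordinate of the quaternion, moved into \<open>R\<close>. The
    universal property of the free abelian group extends it to the additive map
    \<open>h\<close>.\<close>
  define f where "f = (\<lambda>(x::'k \<times> 'k \<times> 'k \<times> 'k, r). g (fst x) \<otimes> r)"
  have "f ` S \<subseteq> carrier (add_monoid R)" by (auto simp: S_def f_def)
  then obtain h where h: "h \<in> hom (free_Abelian_group S) (add_monoid R)"
    and hf: "\<And>p. p \<in> S \<Longrightarrow> h (frag_of p) = f p"
    using comm_group.free_Abelian_group_universal[OF a_comm_group] by metis
  have carr: "u \<in> carrier (free_Abelian_group S) \<longleftrightarrow> u \<in> carrier PR" for u
    by (simp add: S_def pair_ring_carrier)
  have hadd: "h (u + v) = h u \<oplus> h v" if "u \<in> carrier PR" "v \<in> carrier PR" for u v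
    using hom_mult[OF h that[folded carr]] by simp
  have hcl: "h u \<in> carrier R" if "u \<in> carrier PR" for u
    using hom_in_carrier[OF h that[folded carr]] by simp
  have h0: "h 0 = \<zero>"
  proof -
    have 0: "0 \<in> carrier PR" by (rule pair_ring_closed)
    have "h 0 \<oplus> h 0 = h 0 \<oplus> \<zero>" using hadd[OF 0 0] hcl[OF 0] by simp
    then show ?thesis using hcl[OF 0] add.l_cancel by blast
  qed
  have hdiff: "h (u - v) = h u \<ominus> h v" if "u \<in> carrier PR" "v \<in> carrier PR" for u v
  proof -
    have "h (u - v) \<oplus> h v = h u" using hadd[of "u - v" v] that by (simp add: pair_ring_closed)
    moreover have "h (u - v) = (h (u - v) \<oplus> h v) \<ominus> h v"
      using hcl that by (simp add: pair_ring_closed a_minus_def a_assoc r_neg)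
    ultimately show ?thesis by simp
  qed
  \<comment> \<open>The elements that \<open>h\<close> kills after multiplication by any pure
    tensors on both sides. They form a two-sided ideal, so \<open>J\<close> lies in it once the
    generating relations do.\<close>
  define Z where "Z = {u \<in> carrier PR. \<forall>p\<in>S. \<forall>p'\<in>S. h (frag_of p \<otimes>\<^bsub>PR\<^esub> u \<otimes>\<^bsub>PR\<^esub> frag_of p') = \<zero>}"
  have of_carr: "frag_of p \<in> carrier PR" if "p \<in> S" for p
    using that by (cases p) (auto simp: S_def intro!: pair_ring_closed)
  have Zdiff: "u - v \<in> Z" if "u \<in> Z" "v \<in> Z" for u v
    using that of_carr by (auto simp: Z_def pair_mult_linear pair_ring_closed hdiff a_minus_def)
  have Z0: "0 \<in> Z" by (simp add: Z_def pair_ring_closed h0)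
  have of_mult: "\<exists>p''\<in>S. frag_of p \<otimes>\<^bsub>PR\<^esub> frag_of p' = frag_of p''" if "p \<in> S" "p' \<in> S" for p p'
    by (rule bexI[of _ "(fst p \<otimes>\<^bsub>H\<^esub> fst p', snd p \<otimes> snd p')"])
      (use that in \<open>cases p; cases p'; auto simp: S_def pair_mult_of\<close>)+
  have Zl: "v \<otimes>\<^bsub>PR\<^esub> u \<in> Z" if "v \<in> carrier PR" "u \<in> Z" for u v
    using that(1)
  proof (induction rule: pair_ring_induct)
    case (of x r)
    then have xr: "(x, r) \<in> S" by (simp add: S_def)
    have u: "u \<in> carrier PR" using \<open>u \<in> Z\<close> by (simp add: Z_def)
    show ?case unfolding Z_def
    proof (intro CollectI conjI ballI)
      fix p p' assume pp: "p \<in> S" "p' \<in> S"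
      obtain p'' where p'': "p'' \<in> S" "frag_of p \<otimes>\<^bsub>PR\<^esub> frag_of (x, r) = frag_of p''"
        using of_mult[OF pp(1) xr] by blast
      have "frag_of p \<otimes>\<^bsub>PR\<^esub> (frag_of (x, r) \<otimes>\<^bsub>PR\<^esub> u) = frag_of p'' \<otimes>\<^bsub>PR\<^esub> u"
        using J.m_assoc[OF of_carr[OF pp(1)] of_carr[OF xr] u] p''(2) by simp
      then show "h (frag_of p \<otimes>\<^bsub>PR\<^esub> (frag_of (x, r) \<otimes>\<^bsub>PR\<^esub> u) \<otimes>\<^bsub>PR\<^esub> frag_of p') = \<zero>"
        using p''(1) pp(2) \<open>u \<in> Z\<close> by (simp add: Z_def)
    qed (rule J.m_closed[OF of_carr[OF xr] u])
  qed (auto simp: pair_mult_linear Z0 Zdiff)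
  have Zr: "u \<otimes>\<^bsub>PR\<^esub> v \<in> Z" if "v \<in> carrier PR" "u \<in> Z" for u v
    using that(1)
  proof (induction rule: pair_ring_induct)
    case (of x r)
    then have xr: "(x, r) \<in> S" by (simp add: S_def)
    have u: "u \<in> carrier PR" using \<open>u \<in> Z\<close> by (simp add: Z_def)
    show ?case unfolding Z_def
    proof (intro CollectI conjI ballI)
      fix p p' assume pp: "p \<in> S" "p' \<in> S"
      obtain p'' where p'': "p'' \<in> S" "frag_of (x, r) \<otimes>\<^bsub>PR\<^esub> frag_of p' = frag_of p''"
        using of_mult[OF xr pp(2)] by blast
      have "frag_of p \<otimes>\<^bsub>PR\<^esub> (u \<otimes>\<^bsub>PR\<^esub> frag_of (x, r)) \<otimes>\<^bsub>PR\<^esub> frag_of p' = frag_of p \<otimes>\<^bsub>PR\<^esub> u \<otimes>\<^bsub>PR\<^esub> frag_of p''"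
        unfolding p''(2)[symmetric] using of_carr pp xr u by (simp add: J.m_assoc)
      then show "h (frag_of p \<otimes>\<^bsub>PR\<^esub> (u \<otimes>\<^bsub>PR\<^esub> frag_of (x, r)) \<otimes>\<^bsub>PR\<^esub> frag_of p') = \<zero>"
        using p''(1) pp(1) \<open>u \<in> Z\<close> by (simp add: Z_def)
    qed (rule J.m_closed[OF u of_carr[OF xr]])
  qed (auto simp: pair_mult_linear Z0 Zdiff)
  have "ideal Z PR"
  proof (rule idealI)
    show "subgroup Z (add_monoid PR)"
    proof (rule J.add.subgroupI)
      show "Z \<subseteq> carrier PR" "Z \<noteq> {}" using Z0 by (auto simp: Z_def)
      fix u v assume u: "u \<in> Z" and v: "v \<in> Z"
      show "u \<oplus>\<^bsub>PR\<^esub> v \<in> Z" using Zdiff[OF u Zdiff[OF Z0 v]] by simp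
    next
      fix u assume u: "u \<in> Z"
      have "\<ominus>\<^bsub>PR\<^esub> u = - u"
        by (rule J.minus_equality) (use u in \<open>auto simp: Z_def pair_ring_closed\<close>)
      then show "\<ominus>\<^bsub>PR\<^esub> u \<in> Z" using Zdiff[OF Z0 u] by simp
    qed
  qed (use ring_PR Zl Zr in auto)
  moreover have "tensor_relations quaternion_scalar H g R \<subseteq> Z"
  proof
    fix u assume u: "u \<in> tensor_relations quaternion_scalar H g R"
    have fm: "h (frag_of p \<otimes>\<^bsub>PR\<^esub> frag_of (x, r) \<otimes>\<^bsub>PR\<^esub> frag_of p') =
        g (fst (fst p \<otimes>\<^bsub>H\<^esub> x \<otimes>\<^bsub>H\<^esub> fst p')) \<otimes> (snd p \<otimes> r \<otimes> snd p')"
      if "p \<in> S" "p' \<in> S" "r \<in> carrier R" for p p' x r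
      using that by (cases p; cases p') (auto simp: pair_mult_of S_def hf f_def)
    have fc: "frag_of p \<otimes>\<^bsub>PR\<^esub> frag_of (x, r) \<otimes>\<^bsub>PR\<^esub> frag_of p' \<in> carrier PR"
      if "p \<in> S" "p' \<in> S" "r \<in> carrier R" for p p' x r
      using that of_carr by (intro J.m_closed pair_ring_closed) auto
    show "u \<in> Z" unfolding Z_def
    proof (intro CollectI conjI ballI)
      show "u \<in> carrier PR" using u relations_carrier by blast
      fix p p' assume pp: "p \<in> S" "p' \<in> S"
      obtain p1 p2 p3 p4 rp where p: "p = ((p1, p2, p3, p4), rp)" by (metis prod_cases4 surj_pair)
      obtain q1 q2 q3 q4 rq where q: "p' = ((q1, q2, q3, q4), rq)" by (metis prod_cases4 surj_pair)
      have rpq: "rp \<in> carrier R" "rq \<in> carrier R" using pp p q by (auto simp: S_def)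
      from u consider (1) x x' y where "u = frag_of (x \<oplus>\<^bsub>H\<^esub> x', y) - frag_of (x, y) - frag_of (x', y)" "y \<in> carrier R"
        | (2) x y y' where "u = frag_of (x, y \<oplus> y') - frag_of (x, y) - frag_of (x, y')" "y \<in> carrier R" "y' \<in> carrier R"
        | (3) c x y where "u = frag_of (quaternion_scalar c \<otimes>\<^bsub>H\<^esub> x, y) - frag_of (x, g c \<otimes> y)" "y \<in> carrier R"
        unfolding tensor_relations_def by blast
      then show "h (frag_of p \<otimes>\<^bsub>PR\<^esub> u \<otimes>\<^bsub>PR\<^esub> frag_of p') = \<zero>"
      proof cases
        case 1
        obtain x1 x2 x3 x4 where x: "x = (x1, x2, x3, x4)" by (cases x)
        obtain y1 y2 y3 y4 where x': "x' = (y1, y2, y3, y4)" by (cases x')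
        have "fst (fst p \<otimes>\<^bsub>H\<^esub> (x \<oplus>\<^bsub>H\<^esub> x') \<otimes>\<^bsub>H\<^esub> fst p') =
            fst (fst p \<otimes>\<^bsub>H\<^esub> x \<otimes>\<^bsub>H\<^esub> fst p') + fst (fst p \<otimes>\<^bsub>H\<^esub> x' \<otimes>\<^bsub>H\<^esub> fst p')"
          unfolding x x' p q by (simp add: mult_H add_H algebra_simps)
        then show ?thesis using pp 1 fc[OF pp] rpq
          by (simp add: pair_mult_linear hdiff pair_ring_closed fm g_add p q)
            (simp add: l_distr a_minus_def a_ac minus_add r_neg r_neg1 r_neg2 l_neg)
      next
        case 2
        then show ?thesis using pp fc[OF pp] rpq
          by (simp add: pair_mult_linear hdiff pair_ring_closed fm p q)
            (simp add: r_distr l_distr a_minus_def a_ac minus_add r_neg r_neg1 r_neg2 l_neg)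
      next
        case 3
        obtain x1 x2 x3 x4 where x: "x = (x1, x2, x3, x4)" by (cases x)
        have "fst (fst p \<otimes>\<^bsub>H\<^esub> (quaternion_scalar c \<otimes>\<^bsub>H\<^esub> x) \<otimes>\<^bsub>H\<^esub> fst p') = c * fst (fst p \<otimes>\<^bsub>H\<^esub> x \<otimes>\<^bsub>H\<^esub> fst p')"
          unfolding x p q by (simp add: quaternion_scalar_def mult_H algebra_simps)
        then show ?thesis using pp 3 fc[OF pp] rpq
          by (simp add: pair_mult_linear hdiff pair_ring_closed fm g_mult p q)
            (simp add: m_ac a_minus_def r_neg)
      qed
    qed
  qed
  ultimately have "J \<subseteq> Z" unfolding J_def by (rule J.genideal_minimal)
  then have "\<one>\<^bsub>PR\<^esub> \<in> Z" using one by blast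
  then have "h (\<one>\<^bsub>PR\<^esub> \<otimes>\<^bsub>PR\<^esub> \<one>\<^bsub>PR\<^esub> \<otimes>\<^bsub>PR\<^esub> \<one>\<^bsub>PR\<^esub>) = \<zero>"
    unfolding Z_def by (auto simp: S_def)
  then have "h \<one>\<^bsub>PR\<^esub> = \<zero>" by (simp only: J.l_one J.one_closed)
  moreover have "h \<one>\<^bsub>PR\<^esub> = \<one>" by (simp add: hf S_def f_def one_H g_one)
  ultimately show False using nontrivial by simp
qed

end

section \<open>Coordinates in the tensor product and the two criteria for division\<close>

context quaternion_tensor
begin

abbreviation T where "T \<equiv> tensor_algebra quaternion_scalar H g R"

definition cl where "cl u = J +>\<^bsub>PR\<^esub> u"

lemma T_eq: "T = PR Quot J"
  by (simp add: tensor_algebra_def J_def)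

lemma ring_T: "ring T"
  unfolding T_eq by (rule J.quotient_is_ring)

lemma carrier_T: "carrier T = cl ` carrier PR"
  unfolding T_eq by (auto simp: FactRing_def A_RCOSETS_def' cl_def)

lemma mult_T: "u \<in> carrier PR \<Longrightarrow> v \<in> carrier PR \<Longrightarrow> cl u \<otimes>\<^bsub>T\<^esub> cl v = cl (u \<otimes>\<^bsub>PR\<^esub> v)"
  unfolding T_eq by (simp add: FactRing_def cl_def J.rcoset_mult_add)

lemma one_T: "\<one>\<^bsub>T\<^esub> = cl \<one>\<^bsub>PR\<^esub>"
  unfolding T_eq by (simp add: FactRing_def cl_def)

lemma cl_eq_iff:
  assumes "u \<in> carrier PR" "v \<in> carrier PR"
  shows "cl u = cl v \<longleftrightarrow> u - v \<in> J"
proof -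
  have "\<ominus>\<^bsub>PR\<^esub> v = - v"
    by (rule J.minus_equality) (use assms in \<open>auto simp: pair_ring_closed\<close>)
  then have "u \<ominus>\<^bsub>PR\<^esub> v = u - v" by (simp add: a_minus_def)
  then show ?thesis
    using J.quotient_eq_iff_same_a_r_cos[OF J.is_ideal assms] by (simp add: cl_def)
qed

lemma cl_0: "cl 0 = \<zero>\<^bsub>T\<^esub>"
proof -
  have "cl 0 = J" unfolding cl_def using J.a_rcos_const[OF J_zero] .
  then show ?thesis unfolding T_eq by (simp add: FactRing_def)
qed

lemma cl_eq_0_iff: "u \<in> carrier PR \<Longrightarrow> cl u = \<zero>\<^bsub>T\<^esub> \<longleftrightarrow> u \<in> J"
  using cl_eq_iff[of u 0] by (simp add: cl_0 pair_ring_closed)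

lemma one_T_neq_zero: "\<one>\<^bsub>T\<^esub> \<noteq> \<zero>\<^bsub>T\<^esub>"
  unfolding one_T using cl_eq_0_iff[OF J.one_closed] one_notin_J by blast

definition elt where
  "elt c0 c1 c2 c3 = frag_of ((1, 0, 0, 0), c0) + frag_of ((0, 1, 0, 0), c1)
     + frag_of ((0, 0, 1, 0), c2) + frag_of ((0, 0, 0, 1), c3)"

definition conj where
  "conj c0 c1 c2 c3 = frag_of ((1, 0, 0, 0), c0) - frag_of ((0, 1, 0, 0), c1)
     - frag_of ((0, 0, 1, 0), c2) - frag_of ((0, 0, 0, 1), c3)"

definition norm where
  "norm c0 c1 c2 c3 = c0 \<otimes> c0 \<oplus> g (- a) \<otimes> (c1 \<otimes> c1) \<oplus> g (- b) \<otimes> (c2 \<otimes> c2) \<oplus> g (a * b) \<otimes> (c3 \<otimes> c3)"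

lemma of_closed [simp]: "r \<in> carrier R \<Longrightarrow> frag_of (x, r) \<in> carrier PR"
  by (rule pair_ring_closed) auto

lemma elt_closed:
  assumes "c0 \<in> carrier R" "c1 \<in> carrier R" "c2 \<in> carrier R" "c3 \<in> carrier R"
  shows "elt c0 c1 c2 c3 \<in> carrier PR" "conj c0 c1 c2 c3 \<in> carrier PR"
  using assms unfolding elt_def conj_def by (auto intro!: pair_ring_closed)

lemma elt_of:
  assumes "r \<in> carrier R"
  shows "frag_of ((w, x, y, z), r) - elt (g w \<otimes> r) (g x \<otimes> r) (g y \<otimes> r) (g z \<otimes> r) \<in> J"
proof -
  have 1: "frag_of ((w, x, y, z), r) - frag_of ((w, x, y, 0), r) - frag_of ((0, 0, 0, z), r) \<in> J"
    "frag_of ((w, x, y, 0), r) - frag_of ((w, x, 0, 0), r) - frag_of ((0, 0, y, 0), r) \<in> J"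
    "frag_of ((w, x, 0, 0), r) - frag_of ((w, 0, 0, 0), r) - frag_of ((0, x, 0, 0), r) \<in> J"
    using of_add_left[OF assms, of w 0 x 0 y 0 0 z] of_add_left[OF assms, of w 0 x 0 0 y 0 0]
      of_add_left[OF assms, of w 0 0 x 0 0 0 0] by simp_all
  have 2: "frag_of ((w, 0, 0, 0), r) - frag_of ((1, 0, 0, 0), g w \<otimes> r) \<in> J"
    "frag_of ((0, x, 0, 0), r) - frag_of ((0, 1, 0, 0), g x \<otimes> r) \<in> J"
    "frag_of ((0, 0, y, 0), r) - frag_of ((0, 0, 1, 0), g y \<otimes> r) \<in> J"
    "frag_of ((0, 0, 0, z), r) - frag_of ((0, 0, 0, 1), g z \<otimes> r) \<in> J"
    using of_scalar[OF assms, of w 1 0 0 0] of_scalar[OF assms, of x 0 1 0 0]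
      of_scalar[OF assms, of y 0 0 1 0] of_scalar[OF assms, of z 0 0 0 1] by simp_all
  from J_add[OF J_add[OF J_add[OF J_add[OF J_add[OF J_add[OF 1(1) 1(2)] 1(3)] 2(1)] 2(2)] 2(3)] 2(4)]
  show ?thesis by (simp add: elt_def algebra_simps)
qed

lemma elt_diff:
  assumes "c0 \<in> carrier R" "c1 \<in> carrier R" "c2 \<in> carrier R" "c3 \<in> carrier R"
    "d0 \<in> carrier R" "d1 \<in> carrier R" "d2 \<in> carrier R" "d3 \<in> carrier R"
  shows "elt c0 c1 c2 c3 - elt d0 d1 d2 d3 - elt (c0 \<oplus> \<ominus> d0) (c1 \<oplus> \<ominus> d1) (c2 \<oplus> \<ominus> d2) (c3 \<oplus> \<ominus> d3) \<in> J"
proof -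
  have 1: "frag_of (x, c) - frag_of (x, d) - frag_of (x, c \<oplus> \<ominus> d) \<in> J"
    if "c \<in> carrier R" "d \<in> carrier R" for x c d
    using J_minus[OF J_add[OF of_add_right[OF that(1) a_inv_closed[OF that(2)], of x] of_minus_right[OF that(2), of x]]]
    by (simp add: algebra_simps)
  from J_add[OF J_add[OF J_add[OF 1[OF assms(1,5)] 1[OF assms(2,6)]] 1[OF assms(3,7)]] 1[OF assms(4,8)]]
  show ?thesis by (simp add: elt_def algebra_simps)
qed

text \<open>A pure tensor is split along the quaternion basis and its scalars are moved into
  \<open>R\<close>; sums are handled coordinatewise.\<close>

lemma elt_exhaust:
  assumes "u \<in> carrier PR"
  shows "\<exists>c0\<in>carrier R. \<exists>c1\<in>carrier R. \<exists>c2\<in>carrier R. \<exists>c3\<in>carrier R. u - elt c0 c1 c2 c3 \<in> J"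
  using assms
proof (induction rule: pair_ring_induct)
  case zero
  have "elt \<zero> \<zero> \<zero> \<zero> \<in> J" unfolding elt_def by (intro J_add of_zero_right)
  then have "0 - elt \<zero> \<zero> \<zero> \<zero> \<in> J" using J_minus by simp
  then show ?case by blast
next
  case (of x r)
  obtain w1 w2 w3 w4 where x: "x = (w1, w2, w3, w4)" by (cases x)
  have "g w \<otimes> r \<in> carrier R" for w using of by simp
  then show ?case using elt_of[OF of(2), of w1 w2 w3 w4] unfolding x by blast
next
  case (diff u v)
  obtain c0 c1 c2 c3 where
    c: "c0 \<in> carrier R" "c1 \<in> carrier R" "c2 \<in> carrier R" "c3 \<in> carrier R"
    and u: "u - elt c0 c1 c2 c3 \<in> J" using diff(1) by (elim bexE)
  obtain d0 d1 d2 d3 where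
    d: "d0 \<in> carrier R" "d1 \<in> carrier R" "d2 \<in> carrier R" "d3 \<in> carrier R"
    and v: "v - elt d0 d1 d2 d3 \<in> J" using diff(2) by (elim bexE)
  from J_add[OF J_diff[OF u v] elt_diff[OF c d]]
  have "u - v - elt (c0 \<oplus> \<ominus> d0) (c1 \<oplus> \<ominus> d1) (c2 \<oplus> \<ominus> d2) (c3 \<oplus> \<ominus> d3) \<in> J"
    by (simp add: algebra_simps)
  moreover have "c0 \<oplus> \<ominus> d0 \<in> carrier R" "c1 \<oplus> \<ominus> d1 \<in> carrier R" "c2 \<oplus> \<ominus> d2 \<in> carrier R"
    "c3 \<oplus> \<ominus> d3 \<in> carrier R" using c d by auto
  ultimately show ?case by blast
qed

lemma elt_mult_conj:
  assumes c: "c0 \<in> carrier R" "c1 \<in> carrier R" "c2 \<in> carrier R" "c3 \<in> carrier R"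
  shows "elt c0 c1 c2 c3 \<otimes>\<^bsub>PR\<^esub> conj c0 c1 c2 c3 - frag_of ((1, 0, 0, 0), norm c0 c1 c2 c3) \<in> J"
    and "conj c0 c1 c2 c3 \<otimes>\<^bsub>PR\<^esub> elt c0 c1 c2 c3 - frag_of ((1, 0, 0, 0), norm c0 c1 c2 c3) \<in> J"
proof -
  have comm: "c1 \<otimes> c0 = c0 \<otimes> c1" "c2 \<otimes> c0 = c0 \<otimes> c2" "c3 \<otimes> c0 = c0 \<otimes> c3"
    "c2 \<otimes> c1 = c1 \<otimes> c2" "c3 \<otimes> c1 = c1 \<otimes> c3" "c3 \<otimes> c2 = c2 \<otimes> c3"
    using c by (simp_all add: m_comm)
  let ?e = "\<lambda>r. frag_of ((1, 0, 0, 0) :: 'k \<times> 'k \<times> 'k \<times> 'k, r)"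
  let ?s = "\<lambda>w r. frag_of ((w, 0, 0, 0) :: 'k \<times> 'k \<times> 'k \<times> 'k, r)"
  \<comment> \<open>The relations used: \<open>m\<close> cancels opposite quaternion entries,
    \<open>s\<close> moves scalars into \<open>R\<close>, and \<open>t\<close> splits the norm into
    its four summands.\<close>
  have m: "frag_of ((0, 0, 0, - 1), c1 \<otimes> c2) + frag_of ((0, 0, 0, 1), c1 \<otimes> c2) \<in> J"
    "frag_of ((0, 0, - a, 0), c1 \<otimes> c3) + frag_of ((0, 0, a, 0), c1 \<otimes> c3) \<in> J"
    "frag_of ((0, - b, 0, 0), c2 \<otimes> c3) + frag_of ((0, b, 0, 0), c2 \<otimes> c3) \<in> J"
    "?s (- a) (c1 \<otimes> c1) + ?s a (c1 \<otimes> c1) \<in> J" "?s (- b) (c2 \<otimes> c2) + ?s b (c2 \<otimes> c2) \<in> J"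
    "?s (- (a * b)) (c3 \<otimes> c3) + ?s (a * b) (c3 \<otimes> c3) \<in> J"
    using of_minus_left[of "c1 \<otimes> c2" 0 0 0 1] of_minus_left[of "c1 \<otimes> c3" 0 0 a 0]
      of_minus_left[of "c2 \<otimes> c3" 0 b 0 0] of_minus_left[of "c1 \<otimes> c1" a 0 0 0]
      of_minus_left[of "c2 \<otimes> c2" b 0 0 0] of_minus_left[of "c3 \<otimes> c3" "a * b" 0 0 0] c by simp_all
  have s: "?s (- a) (c1 \<otimes> c1) - ?e (g (- a) \<otimes> (c1 \<otimes> c1)) \<in> J"
    "?s (- b) (c2 \<otimes> c2) - ?e (g (- b) \<otimes> (c2 \<otimes> c2)) \<in> J"
    "?s (a * b) (c3 \<otimes> c3) - ?e (g (a * b) \<otimes> (c3 \<otimes> c3)) \<in> J"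
    using of_scalar[of "c1 \<otimes> c1" "- a" 1 0 0 0] of_scalar[of "c2 \<otimes> c2" "- b" 1 0 0 0]
      of_scalar[of "c3 \<otimes> c3" "a * b" 1 0 0 0] c by simp_all
  have t: "?e (c0 \<otimes> c0 \<oplus> g (- a) \<otimes> (c1 \<otimes> c1)) - ?e (c0 \<otimes> c0) - ?e (g (- a) \<otimes> (c1 \<otimes> c1)) \<in> J"
    "?e (c0 \<otimes> c0 \<oplus> g (- a) \<otimes> (c1 \<otimes> c1) \<oplus> g (- b) \<otimes> (c2 \<otimes> c2))
      - ?e (c0 \<otimes> c0 \<oplus> g (- a) \<otimes> (c1 \<otimes> c1)) - ?e (g (- b) \<otimes> (c2 \<otimes> c2)) \<in> J"
    "?e (norm c0 c1 c2 c3) - ?e (c0 \<otimes> c0 \<oplus> g (- a) \<otimes> (c1 \<otimes> c1) \<oplus> g (- b) \<otimes> (c2 \<otimes> c2))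
      - ?e (g (a * b) \<otimes> (c3 \<otimes> c3)) \<in> J"
    unfolding norm_def using c by (auto intro!: of_add_right)
  \<comment> \<open>The two products agree already in \<open>PR\<close>, before passing to the
    quotient, so one membership gives both.\<close>
  have "elt c0 c1 c2 c3 \<otimes>\<^bsub>PR\<^esub> conj c0 c1 c2 c3 - frag_of ((1, 0, 0, 0), norm c0 c1 c2 c3) =
     conj c0 c1 c2 c3 \<otimes>\<^bsub>PR\<^esub> elt c0 c1 c2 c3 - frag_of ((1, 0, 0, 0), norm c0 c1 c2 c3)"
    unfolding elt_def conj_def by (simp add: pair_mult_linear pair_mult_of mult_H comm)
  moreover show "elt c0 c1 c2 c3 \<otimes>\<^bsub>PR\<^esub> conj c0 c1 c2 c3 - frag_of ((1, 0, 0, 0), norm c0 c1 c2 c3) \<in> J"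
    using J_diff[OF J_diff[OF J_add[OF J_add[OF s(1,2)] s(3)] J_add[OF J_add[OF t(1,2)] t(3)]]
        J_add[OF J_add[OF J_add[OF m(1,2)] m(3)] J_add[OF J_add[OF m(4,5)] m(6)]]]
    unfolding elt_def conj_def by (simp add: pair_mult_linear pair_mult_of mult_H comm algebra_simps)
  ultimately show "conj c0 c1 c2 c3 \<otimes>\<^bsub>PR\<^esub> elt c0 c1 c2 c3 - frag_of ((1, 0, 0, 0), norm c0 c1 c2 c3) \<in> J"
    by (simp only:)
qed

lemma conj_mult_scalar:
  assumes "c0 \<in> carrier R" "c1 \<in> carrier R" "c2 \<in> carrier R" "c3 \<in> carrier R" "r \<in> carrier R"
  shows "frag_of ((1, 0, 0, 0), r) \<otimes>\<^bsub>PR\<^esub> conj c0 c1 c2 c3 = conj c0 c1 c2 c3 \<otimes>\<^bsub>PR\<^esub> frag_of ((1, 0, 0, 0), r)"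
  using assms by (simp add: conj_def pair_mult_linear pair_mult_of mult_H m_comm)

text \<open>The inverse of a nonzero element is its conjugate divided by its norm. It is two-sided
  because scalars from \<open>R\<close> commute with the conjugate.\<close>

lemma division_algebra_tensorI:
  assumes "\<And>c0 c1 c2 c3. c0 \<in> carrier R \<Longrightarrow> c1 \<in> carrier R \<Longrightarrow> c2 \<in> carrier R \<Longrightarrow> c3 \<in> carrier R \<Longrightarrow>
    \<not> (c0 = \<zero> \<and> c1 = \<zero> \<and> c2 = \<zero> \<and> c3 = \<zero>) \<Longrightarrow> norm c0 c1 c2 c3 \<in> Units R"
  shows "division_algebra T"
  unfolding division_algebra_def
proof (intro conjI equalityI subsetI)
  interpret T: ring T by (rule ring_T)
  show "ring T" by (rule ring_T)
  show "\<one>\<^bsub>T\<^esub> \<noteq> \<zero>\<^bsub>T\<^esub>" by (rule one_T_neq_zero)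
  show "t \<in> carrier T - {\<zero>\<^bsub>T\<^esub>}" if t: "t \<in> Units T" for t
  proof -
    have "t \<noteq> \<zero>\<^bsub>T\<^esub>"
    proof
      assume "t = \<zero>\<^bsub>T\<^esub>"
      moreover obtain s where "s \<in> carrier T" "s \<otimes>\<^bsub>T\<^esub> t = \<one>\<^bsub>T\<^esub>" using t by (auto simp: Units_def)
      ultimately show False using one_T_neq_zero by simp
    qed
    then show ?thesis using t by auto
  qed
  show "t \<in> Units T" if t: "t \<in> carrier T - {\<zero>\<^bsub>T\<^esub>}" for t
  proof -
    obtain u where u: "u \<in> carrier PR" "t = cl u" using t by (auto simp: carrier_T)
    obtain c0 c1 c2 c3 where c: "c0 \<in> carrier R" "c1 \<in> carrier R" "c2 \<in> carrier R" "c3 \<in> carrier R"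
      and uc: "u - elt c0 c1 c2 c3 \<in> J" using elt_exhaust[OF u(1)] by blast
    let ?e = "elt c0 c1 c2 c3" and ?c = "conj c0 c1 c2 c3" and ?n = "norm c0 c1 c2 c3"
    note ec = elt_closed[OF c]
    have te: "t = cl ?e" using u uc cl_eq_iff[OF u(1) ec(1)] by simp
    have "\<not> (c0 = \<zero> \<and> c1 = \<zero> \<and> c2 = \<zero> \<and> c3 = \<zero>)"
    proof
      assume "c0 = \<zero> \<and> c1 = \<zero> \<and> c2 = \<zero> \<and> c3 = \<zero>"
      then have "?e \<in> J" unfolding elt_def by (auto intro!: J_add of_zero_right)
      then show False using t te cl_eq_0_iff[OF ec(1)] by simp
    qed
    then have "?n \<in> Units R" using assms c by blast
    then obtain r where r: "r \<in> carrier R" "?n \<otimes> r = \<one>" "r \<otimes> ?n = \<one>" "?n \<in> carrier R"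
      by (auto simp: Units_def)
    let ?r = "frag_of ((1, 0, 0, 0), r)"
    have cr: "?r \<in> carrier PR" "frag_of ((1, 0, 0, 0), ?n) \<in> carrier PR" using r by auto
    have one: "\<one>\<^bsub>PR\<^esub> = frag_of ((1, 0, 0, 0), \<one>)" by (simp add: one_H)
    have right: "?e \<otimes>\<^bsub>PR\<^esub> (?c \<otimes>\<^bsub>PR\<^esub> ?r) - \<one>\<^bsub>PR\<^esub> \<in> J"
    proof -
      have "(?e \<otimes>\<^bsub>PR\<^esub> ?c - frag_of ((1, 0, 0, 0), ?n)) \<otimes>\<^bsub>PR\<^esub> ?r \<in> J"
        by (rule J_mult_right[OF elt_mult_conj(1)[OF c] cr(1)])
      moreover have "(?e \<otimes>\<^bsub>PR\<^esub> ?c - frag_of ((1, 0, 0, 0), ?n)) \<otimes>\<^bsub>PR\<^esub> ?r = ?e \<otimes>\<^bsub>PR\<^esub> (?c \<otimes>\<^bsub>PR\<^esub> ?r) - \<one>\<^bsub>PR\<^esub>"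
        using ec cr r by (simp add: pair_mult_diff_left pair_mult_of mult_H J.m_assoc one_H)
      ultimately show ?thesis by simp
    qed
    have left: "(?c \<otimes>\<^bsub>PR\<^esub> ?r) \<otimes>\<^bsub>PR\<^esub> ?e - \<one>\<^bsub>PR\<^esub> \<in> J"
    proof -
      have "?r \<otimes>\<^bsub>PR\<^esub> (?c \<otimes>\<^bsub>PR\<^esub> ?e - frag_of ((1, 0, 0, 0), ?n)) \<in> J"
        by (rule J_mult_left[OF elt_mult_conj(2)[OF c] cr(1)])
      moreover have "?r \<otimes>\<^bsub>PR\<^esub> (?c \<otimes>\<^bsub>PR\<^esub> ?e - frag_of ((1, 0, 0, 0), ?n)) = (?c \<otimes>\<^bsub>PR\<^esub> ?r) \<otimes>\<^bsub>PR\<^esub> ?e - \<one>\<^bsub>PR\<^esub>"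
        unfolding conj_mult_scalar[OF c r(1), symmetric]
        using ec cr r by (simp add: pair_mult_diff_right pair_mult_of mult_H J.m_assoc one_H)
      ultimately show ?thesis by simp
    qed
    have k: "?c \<otimes>\<^bsub>PR\<^esub> ?r \<in> carrier PR" using ec cr by (intro J.m_closed)
    have "cl ?e \<otimes>\<^bsub>T\<^esub> cl (?c \<otimes>\<^bsub>PR\<^esub> ?r) = \<one>\<^bsub>T\<^esub>" "cl (?c \<otimes>\<^bsub>PR\<^esub> ?r) \<otimes>\<^bsub>T\<^esub> cl ?e = \<one>\<^bsub>T\<^esub>"
      unfolding one_T mult_T[OF ec(1) k] mult_T[OF k ec(1)]
      using left right ec k cl_eq_iff J.m_closed J.one_closed by blast+
    then show ?thesis using te t k by (auto simp: Units_def carrier_T)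
  qed
qed

text \<open>If \<open>a = r\<^sup>2\<close>, then \<open>\<alpha> \<otimes> 1 \<mp> 1 \<otimes> r\<close> are zero divisors, unless one of them vanishes;
  but then \<open>\<alpha> \<otimes> 1\<close> is central, although it anticommutes with \<open>\<beta> \<otimes> 1\<close>.\<close>

lemma not_division_algebra_tensor:
  assumes r: "r \<in> carrier R" "r \<otimes> r = g a" and nz: "a \<noteq> 0" "b \<noteq> 0" "(2::'k) \<noteq> 0"
  shows "\<not> division_algebra T"
proof
  assume div: "division_algebra T"
  interpret T: ring T by (rule ring_T)
  let ?i = "frag_of ((0, 1, 0, 0) :: 'k \<times> 'k \<times> 'k \<times> 'k, \<one>)" and ?r = "frag_of ((1, 0, 0, 0) :: 'k \<times> 'k \<times> 'k \<times> 'k, r)"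
  let ?j = "frag_of ((0, 0, 1, 0) :: 'k \<times> 'k \<times> 'k \<times> 'k, \<one>)"
  have car: "?i - ?r \<in> carrier PR" "?i + ?r \<in> carrier PR" "?j \<in> carrier PR"
    using r by (auto intro!: pair_ring_closed)
  have "(?i - ?r) \<otimes>\<^bsub>PR\<^esub> (?i + ?r) = frag_of ((a, 0, 0, 0), \<one>) - frag_of ((1, 0, 0, 0), g a \<otimes> \<one>)"
    using r by (simp add: pair_mult_linear pair_mult_of mult_H)
  then have "(?i - ?r) \<otimes>\<^bsub>PR\<^esub> (?i + ?r) \<in> J" using of_scalar[of \<one> a 1 0 0 0] by simp
  then have prod: "cl (?i - ?r) \<otimes>\<^bsub>T\<^esub> cl (?i + ?r) = \<zero>\<^bsub>T\<^esub>"
    unfolding mult_T[OF car(1,2)] using cl_eq_0_iff J.m_closed[OF car(1,2)] by blast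
  have clT: "cl (?i - ?r) \<in> carrier T" "cl (?i + ?r) \<in> carrier T" using car by (auto simp: carrier_T)
  have "cl (?i - ?r) = \<zero>\<^bsub>T\<^esub> \<or> cl (?i + ?r) = \<zero>\<^bsub>T\<^esub>"
  proof (rule ccontr)
    assume nz: "\<not> ?thesis"
    then have "cl (?i - ?r) \<in> Units T" using clT div by (auto simp: division_algebra_def)
    then obtain s where s: "s \<in> carrier T" "s \<otimes>\<^bsub>T\<^esub> cl (?i - ?r) = \<one>\<^bsub>T\<^esub>" by (auto simp: Units_def)
    have "cl (?i + ?r) = s \<otimes>\<^bsub>T\<^esub> cl (?i - ?r) \<otimes>\<^bsub>T\<^esub> cl (?i + ?r)" using s clT by simp
    also have "\<dots> = s \<otimes>\<^bsub>T\<^esub> (cl (?i - ?r) \<otimes>\<^bsub>T\<^esub> cl (?i + ?r))" by (rule T.m_assoc) (use s clT in auto)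
    also have "\<dots> = \<zero>\<^bsub>T\<^esub>" using prod s by simp
    finally show False using nz by blast
  qed
  then have "?i - ?r \<in> J \<or> ?i + ?r \<in> J" 
    unfolding cl_eq_0_iff[OF car(1)] cl_eq_0_iff[OF car(2)] .
  \<comment> \<open>The commutator with \<open>?j\<close> removes \<open>?r\<close>, which is
    central, and leaves \<alpha>\<beta> - \<beta>\<alpha>.\<close>
  then have "frag_of ((0, 0, 0, 1), \<one>) - frag_of ((0, 0, 0, - 1), \<one>) \<in> J"
  proof
    assume *: "?i - ?r \<in> J"
    have "(?i - ?r) \<otimes>\<^bsub>PR\<^esub> ?j - ?j \<otimes>\<^bsub>PR\<^esub> (?i - ?r) \<in> J"
      by (intro J_diff J_mult_left J_mult_right * car)
    then show ?thesis using r by (simp add: pair_mult_linear pair_mult_of mult_H)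
  next
    assume *: "?i + ?r \<in> J"
    have "(?i + ?r) \<otimes>\<^bsub>PR\<^esub> ?j - ?j \<otimes>\<^bsub>PR\<^esub> (?i + ?r) \<in> J"
      by (intro J_diff J_mult_left J_mult_right * car)
    then show ?thesis using r by (simp add: pair_mult_linear pair_mult_of mult_H)
  qed
  from J_add[OF this of_minus_left[of \<one> 0 0 0 1]]
  have "frag_of ((0, 0, 0, 1), \<one>) + frag_of ((0, 0, 0, 1), \<one>) \<in> J" by simp
  from J_add[OF this of_add_left[of \<one> 0 0 0 0 0 0 1 1]]
  have k: "frag_of ((0, 0, 0, 2), \<one>) \<in> J" by simp
  \<comment> \<open>The square of \<alpha>\<beta> is - a b, so 2 \<alpha>\<beta> has the inverse -
    \<alpha>\<beta> / (2 a b), which brings 1 into \<open>J\<close>.\<close>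
  have "frag_of ((0, 0, 0, 2), \<one>) \<otimes>\<^bsub>PR\<^esub> frag_of ((0, 0, 0, - 1 / (2 * a * b)), \<one>) \<in> J"
    by (rule J_mult_right[OF k]) simp
  moreover have "frag_of ((0, 0, 0, 2), \<one>) \<otimes>\<^bsub>PR\<^esub> frag_of ((0, 0, 0, - 1 / (2 * a * b)), \<one>) = \<one>\<^bsub>PR\<^esub>"
    using nz by (simp add: pair_mult_of mult_H one_H)
  ultimately show False using one_notin_J by simp
qed

end

subsection \<open>The completion at a finite prime\<close>

context
  fixes P :: "'a::field poly"
  assumes P: "P \<in> finite_primes"
begin

abbreviation vge where "vge \<equiv> valuation_ge (Fin P)"

lemmas vge_rules = val_ge_add[OF field_valuation_Fin[OF P], unfolded val_ge_valuation]
  val_ge_diff[OF field_valuation_Fin[OF P], unfolded val_ge_valuation]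
  val_ge_mult[OF field_valuation_Fin[OF P], unfolded val_ge_valuation]
  val_ge_minus[OF field_valuation_Fin[OF P], unfolded val_ge_valuation]
  val_ge_mono[OF field_valuation_Fin[OF P], unfolded val_ge_valuation]
  val_ge_0[OF field_valuation_Fin[OF P], unfolded val_ge_valuation]

abbreviation CR where "CR \<equiv> cauchy_ring P"
abbreviation NS where "NS \<equiv> null_seqs P"

lemma CR_ops [simp]: "x \<otimes>\<^bsub>CR\<^esub> y = (\<lambda>n. x n * y n)" "x \<oplus>\<^bsub>CR\<^esub> y = (\<lambda>n. x n + y n)"
  "\<one>\<^bsub>CR\<^esub> = (\<lambda>n. 1)" "\<zero>\<^bsub>CR\<^esub> = (\<lambda>n. 0)"
  by (simp_all add: cauchy_ring_def)

lemma CR_iff: "x \<in> carrier CR \<longleftrightarrow> (\<forall>N. \<exists>M. \<forall>m\<ge>M. \<forall>n\<ge>M. vge N (x m - x n))"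
  by (simp add: cauchy_ring_def)

lemma NS_iff: "x \<in> NS \<longleftrightarrow> (\<forall>N. \<exists>M. \<forall>n\<ge>M. vge N (x n))"
  by (simp add: null_seqs_def)

lemma NS_CR: "x \<in> NS \<Longrightarrow> x \<in> carrier CR"
  unfolding NS_iff CR_iff using vge_rules(2) by meson

lemma const_CR: "(\<lambda>n. c) \<in> carrier CR"
  by (simp add: CR_iff vge_rules)

lemma CR_bounded:
  assumes "x \<in> carrier CR" shows "\<exists>B. \<forall>n. vge B (x n)"
proof -
  have fin: "\<exists>B. \<forall>n<k. vge B (x n)" for k
  proof (induction k)
    case (Suc k)
    then obtain B where B: "\<forall>n<k. vge B (x n)" by blast
    have "vge (min B (valuation (Fin P) (x k))) (x n)" if "n < Suc k" for n
      using that B vge_rules(5)[of B "x n"] by (cases "n = k") (auto simp: valuation_ge_def simp del: valuation.simps)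
    then show ?case by blast
  qed simp
  obtain M where M: "\<And>m n. m \<ge> M \<Longrightarrow> n \<ge> M \<Longrightarrow> vge 0 (x m - x n)" using assms unfolding CR_iff by meson
  obtain B where B: "\<forall>n<Suc M. vge B (x n)" using fin by blast
  have "vge (min B 0) (x n)" for n
  proof (cases "n \<le> M")
    case True
    then show ?thesis using B vge_rules(5)[of B "x n" "min B 0"] by simp
  next
    case False
    then have "vge 0 (x n - x M)" using M by simp
    then have "vge (min B 0) (x n - x M)" using vge_rules(5) by simp
    moreover have "vge (min B 0) (x M)" using B vge_rules(5)[of B "x M" "min B 0"] by simp
    ultimately show ?thesis using vge_rules(1)[of "min B 0" "x n - x M" "x M"] by simp
  qed
  then show ?thesis by blast
qed

lemma CR_add: assumes "x \<in> carrier CR" "y \<in> carrier CR" shows "(\<lambda>n. x n + y n) \<in> carrier CR"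
  unfolding CR_iff
proof
  fix N
  obtain M1 where 1: "\<And>m n. m \<ge> M1 \<Longrightarrow> n \<ge> M1 \<Longrightarrow> vge N (x m - x n)" using assms(1) unfolding CR_iff by meson
  obtain M2 where 2: "\<And>m n. m \<ge> M2 \<Longrightarrow> n \<ge> M2 \<Longrightarrow> vge N (y m - y n)" using assms(2) unfolding CR_iff by meson
  have "vge N (x m + y m - (x n + y n))" if "m \<ge> max M1 M2" "n \<ge> max M1 M2" for m n
    using vge_rules(1)[OF 1 2, of m n m n] that by (simp add: algebra_simps)
  then show "\<exists>M. \<forall>m\<ge>M. \<forall>n\<ge>M. vge N (x m + y m - (x n + y n))" by blast
qed

lemma CR_uminus: assumes "x \<in> carrier CR" shows "(\<lambda>n. - x n) \<in> carrier CR"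
proof -
  have "vge N (- x m - - x n) \<longleftrightarrow> vge N (x m - x n)" for N m n
    using vge_rules(4)[of N "x m - x n"] by simp
  then show ?thesis using assms unfolding CR_iff by simp
qed

lemma CR_mult: assumes "x \<in> carrier CR" "y \<in> carrier CR" shows "(\<lambda>n. x n * y n) \<in> carrier CR"
  unfolding CR_iff
proof
  fix N
  obtain B1 B2 where B: "\<And>n. vge B1 (x n)" "\<And>n. vge B2 (y n)" using CR_bounded assms by meson
  obtain M1 where 1: "\<And>m n. m \<ge> M1 \<Longrightarrow> n \<ge> M1 \<Longrightarrow> vge (N - B2) (x m - x n)" using assms(1) unfolding CR_iff by meson
  obtain M2 where 2: "\<And>m n. m \<ge> M2 \<Longrightarrow> n \<ge> M2 \<Longrightarrow> vge (N - B1) (y m - y n)" using assms(2) unfolding CR_iff by meson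
  have "vge N (x m * y m - x n * y n)" if "m \<ge> max M1 M2" "n \<ge> max M1 M2" for m n
  proof -
    have "vge (B1 + (N - B1)) (x m * (y m - y n))"
      by (rule vge_rules(3)[OF B(1) 2]) (use that in auto)
    moreover have "vge ((N - B2) + B2) ((x m - x n) * y n)"
      by (rule vge_rules(3)[OF 1 B(2)]) (use that in auto)
    ultimately have "vge N (x m * (y m - y n))" "vge N ((x m - x n) * y n)" by simp_all
    then show ?thesis using vge_rules(1)[of N "x m * (y m - y n)" "(x m - x n) * y n"]
      by (simp add: algebra_simps)
  qed
  then show "\<exists>M. \<forall>m\<ge>M. \<forall>n\<ge>M. vge N (x m * y m - x n * y n)" by blast
qed

lemma cring_CR: "cring CR"
proof (rule cringI)
  show "abelian_group CR"
  proof (rule abelian_groupI)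
    fix x assume "x \<in> carrier CR"
    then show "\<exists>y\<in>carrier CR. y \<oplus>\<^bsub>CR\<^esub> x = \<zero>\<^bsub>CR\<^esub>"
      by (intro bexI[of _ "\<lambda>n. - x n"] CR_uminus) auto
  qed (auto simp: CR_add const_CR algebra_simps)
  show "Group.comm_monoid CR"
    by (rule comm_monoidI) (auto simp: CR_mult const_CR algebra_simps)
qed (auto simp: algebra_simps)

lemma NS_add: assumes "x \<in> NS" "y \<in> NS" shows "(\<lambda>n. x n + y n) \<in> NS"
  unfolding NS_iff
proof
  fix N
  obtain M1 M2 where "\<And>n. n \<ge> M1 \<Longrightarrow> vge N (x n)" "\<And>n. n \<ge> M2 \<Longrightarrow> vge N (y n)"
    using assms unfolding NS_iff by meson
  then have "vge N (x n + y n)" if "n \<ge> max M1 M2" for n using vge_rules(1) that by simp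
  then show "\<exists>M. \<forall>n\<ge>M. vge N (x n + y n)" by blast
qed

lemma NS_mult: assumes "x \<in> NS" "y \<in> carrier CR" shows "(\<lambda>n. y n * x n) \<in> NS"
  unfolding NS_iff
proof
  fix N
  obtain B where B: "\<And>n. vge B (y n)" using CR_bounded[OF assms(2)] by meson
  obtain M where M: "\<And>n. n \<ge> M \<Longrightarrow> vge (N - B) (x n)" using assms unfolding NS_iff by meson
  have "vge N (y n * x n)" if "n \<ge> M" for n using vge_rules(3)[OF B M[OF that], of n] by simp
  then show "\<exists>M. \<forall>n\<ge>M. vge N (y n * x n)" by blast
qed

lemma NS_0: "(\<lambda>n. 0) \<in> NS"
  by (simp add: NS_iff vge_rules)

lemma NS_uminus: "x \<in> NS \<Longrightarrow> (\<lambda>n. - x n) \<in> NS"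
  using NS_mult[OF _ const_CR[of "-1"]] by simp

lemma ideal_NS: "ideal NS CR"
proof (rule idealI)
  interpret cring CR by (rule cring_CR)
  show "ring CR" by (rule ring_axioms)
  show "subgroup NS (add_monoid CR)"
  proof (rule add.subgroupI)
    show "NS \<subseteq> carrier CR" "NS \<noteq> {}" using NS_CR NS_0 by auto
    fix x assume x: "x \<in> NS"
    have "\<ominus>\<^bsub>CR\<^esub> x = (\<lambda>n. - x n)"
      by (rule minus_equality) (use x NS_CR CR_uminus in auto)
    then show "\<ominus>\<^bsub>CR\<^esub> x \<in> NS" using NS_uminus[OF x] by simp
  qed (auto simp: NS_add)
  show "x \<otimes>\<^bsub>CR\<^esub> u \<in> NS" if "u \<in> NS" "x \<in> carrier CR" for u x using NS_mult[OF that] by simp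
  show "u \<otimes>\<^bsub>CR\<^esub> x \<in> NS" if "u \<in> NS" "x \<in> carrier CR" for u x
    using NS_mult[OF that] by (simp add: mult.commute)
qed

definition cc where "cc x = NS +>\<^bsub>CR\<^esub> x"

lemma cring_completion: "cring (completion P)"
  unfolding completion_def by (rule ideal.quotient_is_cring[OF ideal_NS cring_CR])

lemma completion_simps:
  "carrier (completion P) = cc ` carrier CR"
  "\<one>\<^bsub>completion P\<^esub> = cc (\<lambda>n. 1)" "\<zero>\<^bsub>completion P\<^esub> = cc (\<lambda>n. 0)"
  "x \<in> carrier CR \<Longrightarrow> y \<in> carrier CR \<Longrightarrow> cc x \<otimes>\<^bsub>completion P\<^esub> cc y = cc (\<lambda>n. x n * y n)"
  "x \<in> carrier CR \<Longrightarrow> y \<in> carrier CR \<Longrightarrow> cc x \<oplus>\<^bsub>completion P\<^esub> cc y = cc (\<lambda>n. x n + y n)"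
  "to_completion P c = cc (\<lambda>n. c)"
proof -
  interpret ideal NS CR by (rule ideal_NS)
  show "carrier (completion P) = cc ` carrier CR"
    by (auto simp: completion_def FactRing_def A_RCOSETS_def' cc_def)
  show "\<one>\<^bsub>completion P\<^esub> = cc (\<lambda>n. 1)"
    by (simp add: completion_def FactRing_def cc_def)
  show "\<zero>\<^bsub>completion P\<^esub> = cc (\<lambda>n. 0)"
    using a_rcos_const[OF NS_0] by (simp add: completion_def FactRing_def cc_def)
  show "cc x \<otimes>\<^bsub>completion P\<^esub> cc y = cc (\<lambda>n. x n * y n)" if "x \<in> carrier CR" "y \<in> carrier CR"
    using rcoset_mult_add[OF that] by (simp add: completion_def FactRing_def cc_def)
  show "cc x \<oplus>\<^bsub>completion P\<^esub> cc y = cc (\<lambda>n. x n + y n)" if "x \<in> carrier CR" "y \<in> carrier CR"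
    using a_rcos_sum[OF that] by (simp add: completion_def FactRing_def cc_def)
  show "to_completion P c = cc (\<lambda>n. c)"
    by (simp add: to_completion_def cc_def)
qed

lemma cc_eq_iff:
  assumes "x \<in> carrier CR" "y \<in> carrier CR"
  shows "cc x = cc y \<longleftrightarrow> (\<lambda>n. x n - y n) \<in> NS"
proof -
  interpret C: cring CR by (rule cring_CR)
  have "\<ominus>\<^bsub>CR\<^esub> y = (\<lambda>n. - y n)"
    by (rule C.minus_equality) (use assms CR_uminus in auto)
  then have "x \<ominus>\<^bsub>CR\<^esub> y = (\<lambda>n. x n - y n)" by (simp add: a_minus_def)
  then show ?thesis
    using C.quotient_eq_iff_same_a_r_cos[OF ideal_NS assms] by (simp add: cc_def)
qed

lemma cc_eq_0_iff: "x \<in> carrier CR \<Longrightarrow> cc x = \<zero>\<^bsub>completion P\<^esub> \<longleftrightarrow> x \<in> NS"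
  using cc_eq_iff[of x "\<lambda>n. 0"] by (simp add: completion_simps const_CR)

lemma one_notin_NS: "(\<lambda>n. 1) \<notin> NS"
proof
  assume "(\<lambda>n. 1) \<in> NS"
  then have "vge 1 1" unfolding NS_iff by blast
  then show False using val_one[OF field_valuation_Fin[OF P]] by (simp add: valuation_ge_def del: valuation.simps)
qed

lemma quaternion_tensor_completion: "quaternion_tensor (completion P) (to_completion P)"
proof (intro quaternion_tensor.intro quaternion_tensor_axioms.intro)
  show "\<one>\<^bsub>completion P\<^esub> \<noteq> \<zero>\<^bsub>completion P\<^esub>"
    using one_notin_NS cc_eq_0_iff[OF const_CR] by (simp add: completion_simps)
qed (auto simp: cring_completion completion_simps const_CR)

text \<open>A Cauchy sequence that is not null has valuations eventually bounded above, so its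
  termwise inverses are again Cauchy.\<close>

lemma cc_Units:
  assumes x: "x \<in> carrier CR" "x \<notin> NS"
  shows "cc x \<in> Units (completion P)"
proof -
  interpret cring "completion P" by (rule cring_completion)
  obtain N where N: "\<And>M. \<exists>n\<ge>M. \<not> vge N (x n)" using x(2) unfolding NS_iff by meson
  obtain M0 where M0: "\<And>m n. m \<ge> M0 \<Longrightarrow> n \<ge> M0 \<Longrightarrow> vge N (x m - x n)" using x(1) unfolding CR_iff by meson
  obtain n0 where n0: "n0 \<ge> M0" "\<not> vge N (x n0)" using N by blast
  have low: "x m \<noteq> 0 \<and> valuation (Fin P) (x m) < N" if "m \<ge> M0" for m
  proof -
    have "\<not> vge N (x m)"
    proof
      assume "vge N (x m)"
      from vge_rules(1)[OF M0[OF n0(1) that] this] n0(2) show False by simp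
    qed
    then show ?thesis by (auto simp: valuation_ge_def simp del: valuation.simps)
  qed
  \<comment> \<open>Terms before \<open>M0\<close> may be 0 and then have inverse 0; only the tail
    matters.\<close>
  define y where "y n = inverse (x n)" for n
  have y: "y \<in> carrier CR" unfolding CR_iff
  proof
    fix K
    \<comment> \<open>The difference of inverses is (x n - x m) / (x m x n), and the two
      denominators together cost at most \<open>2 * N\<close>.\<close>
    obtain M where M: "\<And>m n. m \<ge> M \<Longrightarrow> n \<ge> M \<Longrightarrow> vge (K + 2 * N) (x m - x n)"
      using x(1) unfolding CR_iff by meson
    have "vge K (y m - y n)" if mn: "m \<ge> max M M0" "n \<ge> max M M0" for m n
    proof -
      note l = low[of m] low[of n]
      have nz: "x m \<noteq> 0" "x n \<noteq> 0" using l mn by auto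
      have "vge (- N) (y m)" "vge (- N) (y n)"
        using l mn val_inverse[OF field_valuation_Fin[OF P]]
        by (auto simp: valuation_ge_def y_def simp del: valuation.simps)
      from vge_rules(3)[OF vge_rules(3)[OF this] M[of n m]] mn
      have "vge K (y m * y n * (x n - x m))" by simp
      moreover have "y m - y n = y m * y n * (x n - x m)"
        using nz by (simp add: y_def field_simps)
      ultimately show ?thesis by simp
    qed
    then show "\<exists>M. \<forall>m\<ge>M. \<forall>n\<ge>M. vge K (y m - y n)" by blast
  qed
  have "(\<lambda>n. x n * y n - 1) \<in> NS"
    unfolding NS_iff using low by (auto simp: y_def vge_rules intro!: exI[of _ M0])
  then have "cc x \<otimes>\<^bsub>completion P\<^esub> cc y = \<one>\<^bsub>completion P\<^esub>"
    using cc_eq_iff[OF CR_mult[OF x(1) y] const_CR[of 1]] x(1) y by (simp add: completion_simps)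
  then show ?thesis using x(1) y m_comm[of "cc y" "cc x"]
    by (auto simp: Units_def completion_simps)
qed

text \<open>The norm of an element is represented by the sequence of norms of representatives. If
  this is a null sequence, quantitative anisotropy makes the four coordinate sequences null.\<close>

lemma ramified_Fin:
  assumes "norm_anisotropic (valuation (Fin P)) a b"
  shows "quaternion_localization_is_division a b (Fin P)"
proof -
  interpret quaternion_tensor "completion P" a b "to_completion P" by (rule quaternion_tensor_completion)
  show ?thesis
    unfolding quaternion_localization_is_division.simps
  proof (rule division_algebra_tensorI)
    fix c0 c1 c2 c3
    assume "c0 \<in> carrier (completion P)" "c1 \<in> carrier (completion P)" "c2 \<in> carrier (completion P)"
      "c3 \<in> carrier (completion P)"
    then obtain x0 x1 x2 x3 where x: "x0 \<in> carrier CR" "x1 \<in> carrier CR" "x2 \<in> carrier CR" "x3 \<in> carrier CR"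
      and c: "c0 = cc x0" "c1 = cc x1" "c2 = cc x2" "c3 = cc x3" by (auto simp: completion_simps)
    assume nz: "\<not> (c0 = \<zero>\<^bsub>completion P\<^esub> \<and> c1 = \<zero>\<^bsub>completion P\<^esub> \<and> c2 = \<zero>\<^bsub>completion P\<^esub> \<and> c3 = \<zero>\<^bsub>completion P\<^esub>)"
    define \<nu> where "\<nu> n = x0 n * x0 n + - a * (x1 n * x1 n) + - b * (x2 n * x2 n) + a * b * (x3 n * x3 n)" for n
    have \<nu>: "\<nu> \<in> carrier CR" unfolding \<nu>_def by (intro CR_add CR_mult const_CR x)
    have "norm c0 c1 c2 c3 = cc \<nu>"
      unfolding norm_def c completion_simps(6) \<nu>_def
      by (simp only: completion_simps CR_add CR_mult const_CR x)
    moreover have "\<nu> \<notin> NS"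
    proof
      assume \<nu>0: "\<nu> \<in> NS"
      obtain k where k: "\<And>n w x y z. vge (2 * n + k) (quaternion_norm a b w x y z) \<Longrightarrow>
          vge n w \<and> vge n x \<and> vge n y \<and> vge n z"
        using assms unfolding norm_anisotropic_def val_ge_valuation by blast
      have q: "\<nu> n = quaternion_norm a b (x0 n) (x1 n) (x2 n) (x3 n)" for n
        by (simp add: \<nu>_def quaternion_norm_def power2_eq_square)
      have "\<exists>M. \<forall>n\<ge>M. vge N (x0 n) \<and> vge N (x1 n) \<and> vge N (x2 n) \<and> vge N (x3 n)" for N
      proof -
        obtain M where "\<And>n. n \<ge> M \<Longrightarrow> vge (2 * N + k) (\<nu> n)" using \<nu>0 unfolding NS_iff by meson
        then show ?thesis using k unfolding q by blast
      qed
      then have "x0 \<in> NS" "x1 \<in> NS" "x2 \<in> NS" "x3 \<in> NS" unfolding NS_iff by meson+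
      then show False using nz x by (simp add: c cc_eq_0_iff)
    qed
    ultimately show "norm c0 c1 c2 c3 \<in> Units (completion P)" using cc_Units[OF \<nu>] by simp
  qed
qed

end

text \<open>Newton iteration with the constant derivative \<open>2y\<close> gains one power of \<open>t - l\<close> per step.\<close>

lemma square_root_in_completion:
  fixes A :: "'a::field poly"
  assumes A: "poly A l = y ^ 2" "y \<noteq> 0" and two: "(2::'a) \<noteq> 0"
  defines "P \<equiv> [:- l, 1:]"
  shows "\<exists>r. \<forall>n. P ^ Suc n dvd r n ^ 2 - A \<and> P ^ n dvd r (Suc n) - r n"
proof -
  define r where "r = rec_nat [:y:] (\<lambda>_ s. s - smult (1 / (2 * y)) (s ^ 2 - A))"
  have r0: "r 0 = [:y:]" and rS: "r (Suc n) = r n - smult (1 / (2 * y)) (r n ^ 2 - A)" for n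
    by (simp_all add: r_def)
  have P: "P dvd B \<longleftrightarrow> poly B l = 0" for B by (simp add: P_def poly_eq_0_iff_dvd)
  have inv: "P ^ Suc n dvd r n ^ 2 - A \<and> P dvd r n - [:y:]" for n
  proof (induction n)
    case 0
    then show ?case using A by (simp add: r0 P)
  next
    case (Suc n)
    let ?d = "r n ^ 2 - A"
    have d: "P ^ Suc n dvd ?d" and P1: "P dvd r n - [:y:]" using Suc by auto
    have Pd: "P dvd ?d" using d by (metis dvd_mult_left power_Suc)
    have "r (Suc n) - [:y:] = (r n - [:y:]) - smult (1 / (2 * y)) ?d" by (simp add: rS)
    then have "P dvd r (Suc n) - [:y:]" using P1 Pd by (simp only: dvd_diff dvd_smult)
    \<comment> \<open>With d = r^2 - A, the new error is d (d / (4 y^2) - (r - y) / y). The second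
      factor is divisible by \<open>P\<close>, since d and r - y are.\<close>
    moreover have eq: "r (Suc n) ^ 2 - A = ?d * (smult (1 / (2 * y)) (smult (1 / (2 * y)) ?d) - smult (1 / y) (r n - [:y:]))"
    proof -
      have "smult (1 / (2 * y)) B + smult (1 / (2 * y)) B = smult (1 / y) B" for B :: "'a poly"
        using A(2) two by (simp add: smult_add_left[symmetric] field_simps)
      then have half: "2 * smult (1 / (2 * y)) B = smult (1 / y) B" for B by (simp only: mult_2)
      have "smult (1 / y) [:y:] = 1" using A(2) by (simp add: one_pCons)
      then have "?d * (smult (1 / (2 * y)) (smult (1 / (2 * y)) ?d) - smult (1 / y) (r n - [:y:]))
        = ?d - smult (1 / y) (r n) * ?d + (smult (1 / (2 * y)) ?d) ^ 2"
        by (simp add: smult_diff_right power2_eq_square algebra_simps)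
      also have "\<dots> = r (Suc n) ^ 2 - A"
        unfolding rS half[symmetric] by (simp add: power2_eq_square algebra_simps)
      finally show ?thesis ..
    qed
    moreover have "P dvd smult (1 / (2 * y)) (smult (1 / (2 * y)) ?d) - smult (1 / y) (r n - [:y:])"
      by (intro dvd_diff dvd_smult Pd P1)
    from mult_dvd_mono[OF d this] have "P ^ Suc (Suc n) dvd r (Suc n) ^ 2 - A"
      unfolding eq by (simp only: power_Suc2[of P "Suc n"])
    ultimately show ?case by blast
  qed
  have "P ^ n dvd r (Suc n) - r n" for n
  proof -
    have "P ^ n dvd r n ^ 2 - A" using inv[of n] by (metis dvd_mult_right power_Suc)
    then show ?thesis by (simp add: rS dvd_smult)
  qed
  with inv show ?thesis by blast
qed

lemma linear_finite_prime: "[:- l, 1:] \<in> finite_primes"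
  by (auto simp: finite_primes_def intro: irreducible_linear_field_poly)

text \<open>The approximate roots form a Cauchy sequence whose class squares to the image of
  \<open>A\<close>, which provides zero divisors in the tensor product.\<close>

lemma not_ramified_at_root:
  fixes A :: "'a::field poly"
  assumes A: "poly A l = y ^ 2" "y \<noteq> 0" and two: "(2::'a) \<noteq> 0" and b: "b \<noteq> 0"
  shows "\<not> quaternion_localization_is_division (to_fract A) b (Fin [:- l, 1:])"
proof -
  let ?P = "[:- l, 1:]"
  have P: "?P \<in> finite_primes" by (rule linear_finite_prime)
  obtain r where r: "\<And>n. ?P ^ Suc n dvd r n ^ 2 - A" "\<And>n. ?P ^ n dvd r (Suc n) - r n"
    using square_root_in_completion[OF A two] by blast
  have diff: "?P ^ n dvd r (n + k) - r n" for n k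
  proof (induction k)
    case (Suc k)
    have "?P ^ n dvd r (Suc (n + k)) - r (n + k)"
      using r(2)[of "n + k"] by (metis dvd_trans le_add1 le_imp_power_dvd)
    from dvd_add[OF this Suc] show ?case by simp
  qed simp
  define x where "x n = to_fract (r n)" for n
  have ge: "valuation_ge (Fin ?P) N (to_fract B)" if "?P ^ n dvd B" "nat N \<le> n" for N n B
  proof -
    have "?P ^ nat N dvd B" using dvd_trans[OF le_imp_power_dvd[OF that(2)] that(1)] .
    then have "valuation_ge (Fin ?P) (int (nat N)) (to_fract B)"
      unfolding valuation_ge_to_fract_iff[OF P] .
    then show ?thesis by (rule vge_rules(5)[OF P]) simp
  qed
  have xC: "x \<in> carrier (cauchy_ring ?P)"
    unfolding CR_iff[OF P]
  proof
    fix N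
    have "valuation_ge (Fin ?P) N (x m - x n)" if "m \<ge> nat N" "n \<ge> nat N" for m n
    proof -
      have "?P ^ nat N dvd (r m - r (nat N)) - (r n - r (nat N))"
        by (rule dvd_diff) (use diff[of "nat N" "m - nat N"] diff[of "nat N" "n - nat N"] that in auto)
      then show ?thesis using ge[of "nat N" "r m - r n" N] by (simp add: x_def)
    qed
    then show "\<exists>M. \<forall>m\<ge>M. \<forall>n\<ge>M. valuation_ge (Fin ?P) N (x m - x n)" by blast
  qed
  have "(\<lambda>n. x n * x n - to_fract A) \<in> null_seqs ?P"
    unfolding NS_iff[OF P]
  proof
    fix N
    have "valuation_ge (Fin ?P) N (x n * x n - to_fract A)" if "n \<ge> nat N" for n
      using ge[OF r(1)[of n], of N] that by (simp add: x_def power2_eq_square)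
    then show "\<exists>M. \<forall>n\<ge>M. valuation_ge (Fin ?P) N (x n * x n - to_fract A)" by blast
  qed
  then have sq: "cc ?P x \<otimes>\<^bsub>completion ?P\<^esub> cc ?P x = to_completion ?P (to_fract A)"
    using cc_eq_iff[OF P CR_mult[OF P xC xC] const_CR[OF P]] by (simp add: completion_simps[OF P] xC)
  interpret quaternion_tensor "completion ?P" "to_fract A" b "to_completion ?P"
    by (rule quaternion_tensor_completion[OF P])
  have "to_fract A \<noteq> 0" using A by (auto simp: to_fract_eq_0_iff)
  moreover have "(2 :: 'a poly fract) \<noteq> 0"
  proof -
    have "(2 :: 'a poly fract) = to_fract [:2:]"
      by (metis numeral_poly one_add_one to_fract_1 to_fract_add)
    moreover have "to_fract [:2::'a:] \<noteq> 0" unfolding to_fract_eq_0_iff using two by simp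
    ultimately show ?thesis by metis
  qed
  ultimately show ?thesis
    unfolding quaternion_localization_is_division.simps
    using sq xC b by (intro not_division_algebra_tensor[of "cc ?P x"]) (auto simp: completion_simps[OF P])
qed

subsection \<open>Resultants of monic polynomials\<close>

abbreviation lift :: "'a::field poly \<Rightarrow> 'a alg_closure poly" where
  "lift \<equiv> map_poly to_ac"

lemma lift_add: "lift (A + B) = lift A + lift B"
  by (rule poly_eqI) (simp add: coeff_map_poly)

lemma lift_mult: "lift (A * B) = lift A * lift B"
  by (rule poly_eqI) (simp add: coeff_map_poly coeff_mult to_ac_sum)

lemma lift_diff: "lift (A - B) = lift A - lift B"
  by (rule poly_eqI) (simp add: coeff_map_poly)

lemma lift_const [simp]: "lift [:c:] = [:to_ac c:]"
  by (rule poly_eqI) (simp add: coeff_map_poly coeff_pCons split: nat.split)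

lemma degree_lift [simp]: "degree (lift A) = degree A"
  by (cases "A = 0") (auto intro: map_poly_degree_eq)

lemma lift_eq_0_iff [simp]: "lift A = 0 \<longleftrightarrow> A = 0"
  by (simp add: map_poly_eq_0_iff)

lemma lead_coeff_lift: "lead_coeff (lift A) = to_ac (lead_coeff A)"
  by (simp add: coeff_map_poly)

text \<open>For monic \<open>P\<close> this is the resultant of \<open>P\<close> and
  \<open>A\<close>. For irreducible monic \<open>P\<close> it is the norm of \<open>A\<close> from
  the residue field of \<open>P\<close> to the constants, which is why a square residue has a square
  value here.\<close>

definition res :: "'a::field poly \<Rightarrow> 'a poly \<Rightarrow> 'a alg_closure" where
  "res P A = (\<Prod>x\<in>#proots (lift P). poly (lift A) x)"

lemma monic_lift_factorization:
  assumes "lead_coeff P = 1"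
  shows "lift P = (\<Prod>x\<in>#proots (lift P). [:- x, 1:])" "size (proots (lift P)) = degree P"
proof -
  have nz: "lift P \<noteq> 0" using assms by auto
  obtain M where M: "size M = degree (lift P)" "lift P = smult (lead_coeff (lift P)) (\<Prod>x\<in>#M. [:- x, 1:])"
    using alg_closed_imp_factorization[OF nz] by blast
  have "lead_coeff (lift P) = 1" using lead_coeff_lift[of P] assms by (simp only: to_ac_1)
  then have eq: "lift P = (\<Prod>x\<in>#M. [:- x, 1:])" using M(2) by (metis smult_1_left)
  have "proots (\<Prod>x\<in>#N. [:- x, 1:]) = N" for N :: "'a alg_closure multiset"
  proof (induction N)
    case (add y N)
    have "[:- y, 1:] \<noteq> 0" "(\<Prod>x\<in>#N. [:- x, 1:]) \<noteq> 0" by (auto simp: prod_mset_zero_iff)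
    then show ?case using add by (simp add: proots_mult del: mult_pCons_left)
  qed simp
  then have "proots (lift P) = M" using eq by metis
  then show "lift P = (\<Prod>x\<in>#proots (lift P). [:- x, 1:])" "size (proots (lift P)) = degree P"
    using eq M(1)[unfolded degree_lift] by (simp_all only:)
qed

lemma res_mult_right: "res P (A * B) = res P A * res P B"
  by (simp add: res_def lift_mult prod_mset.distrib)

lemma res_power_right: "res P (A ^ n) = res P A ^ n"
proof (induction n)
  case 0
  show ?case by (simp add: res_def)
qed (simp add: res_mult_right)

lemma res_const: "lead_coeff P = 1 \<Longrightarrow> res P [:c:] = to_ac c ^ degree P"
  using monic_lift_factorization(2)[of P] by (simp add: res_def)

lemma res_mult_left: "P \<noteq> 0 \<Longrightarrow> Q \<noteq> 0 \<Longrightarrow> res (P * Q) A = res P A * res Q A"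
  by (simp add: res_def lift_mult proots_mult)

lemma res_prod_left:
  assumes "finite Z" "\<And>P. P \<in> Z \<Longrightarrow> P \<noteq> 0"
  shows "res (\<Prod>P\<in>Z. P) A = (\<Prod>P\<in>Z. res P A)"
  using assms
proof (induction Z)
  case empty
  show ?case by (simp add: res_def)
next
  case (insert P Z)
  then show ?case by (simp add: res_mult_left)
qed

lemma res_cong:
  assumes "P dvd A - B" shows "res P A = res P B"
proof -
  obtain C where "A = B + P * C" using assms by (metis add.commute diff_add_cancel dvdE)
  then have "lift A = lift B + lift P * lift C" by (simp add: lift_add lift_mult)
  then have "poly (lift A) x = poly (lift B) x" if "x \<in># proots (lift P)" for x
    using that by (cases "lift P = 0") auto
  then show ?thesis unfolding res_def by (intro arg_cong[of _ _ prod_mset] image_mset_cong) auto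
qed

lemma res_swap:
  assumes "lead_coeff P = 1" "lead_coeff Q = 1"
  shows "res P Q = (-1) ^ (degree P * degree Q) * res Q P"
proof -
  let ?M = "proots (lift P)" and ?N = "proots (lift Q)"
  have minus: "(\<Prod>x\<in>#M. - g x) = (-1) ^ size M * (\<Prod>x\<in>#M. g x)"
    for M and g :: "'a alg_closure \<Rightarrow> 'a alg_closure"
    by (induction M) auto
  have ev: "poly (\<Prod>y\<in>#N. [:- y, 1:]) x = (\<Prod>y\<in>#N. x - y)" for N and x :: "'a alg_closure"
    by (induction N) (auto simp: left_diff_distrib)
  have evP: "poly (lift P) x = (\<Prod>y\<in>#?M. x - y)" and evQ: "poly (lift Q) x = (\<Prod>y\<in>#?N. x - y)" for x
    using arg_cong[OF monic_lift_factorization(1)[OF assms(1)], of "\<lambda>p. poly p x"]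
      arg_cong[OF monic_lift_factorization(1)[OF assms(2)], of "\<lambda>p. poly p x"] by (simp_all only: ev)
  have "res P Q = (\<Prod>x\<in>#?M. \<Prod>y\<in>#?N. x - y)"
    unfolding res_def evQ ..
  also have "\<dots> = (\<Prod>y\<in>#?N. \<Prod>x\<in>#?M. - (y - x))"
    by (subst prod_mset.swap) simp
  also have "\<dots> = (\<Prod>y\<in>#?N. (-1) ^ degree P * (\<Prod>x\<in>#?M. y - x))"
    unfolding minus monic_lift_factorization(2)[OF assms(1)] ..
  also have "\<dots> = ((-1) ^ degree P) ^ degree Q * (\<Prod>y\<in>#?N. \<Prod>x\<in>#?M. y - x)"
    using monic_lift_factorization(2)[OF assms(2)] by (simp add: prod_mset.distrib)
  also have "(\<Prod>y\<in>#?N. \<Prod>x\<in>#?M. y - x) = res Q P"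
    unfolding res_def evP ..
  finally show ?thesis by (simp add: power_mult)
qed

text \<open>The Euclidean algorithm: reduce \<open>A\<close> modulo \<open>P\<close>, make the
  remainder monic, and exchange the two arguments, which lowers the degree of the first.\<close>

lemma res_in_range: "lead_coeff P = 1 \<Longrightarrow> res P A \<in> range to_ac"
proof (induction "degree P" arbitrary: P A rule: less_induct)
  case less
  define B where "B = A mod P"
  have PB: "res P A = res P B" by (rule res_cong) (simp add: B_def)
  have P0: "P \<noteq> 0" using less.prems by auto
  show ?case
  proof (cases "B = 0")
    case True
    then show ?thesis unfolding PB using res_const[OF less.prems, of 0]
      by (metis pCons_0_0 rangeI to_ac_power)
  next
    case False
    then have deg: "degree B < degree P"
      using degree_mod_less[OF P0, of A] by (simp add: B_def)
    define B' where "B' = smult (inverse (lead_coeff B)) B"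
    have B': "lead_coeff B' = 1" "degree B' = degree B" "B = [:lead_coeff B:] * B'"
      using False by (simp_all add: B'_def)
    have "res B' P \<in> range to_ac" using less.hyps[of B' P] B' deg by simp
    then obtain c where c: "res B' P = to_ac c" by blast
    have "res P B = res P [:lead_coeff B:] * res P B'" by (metis B'(3) res_mult_right)
    also have "\<dots> = to_ac (lead_coeff B) ^ degree P * ((-1) ^ (degree P * degree B') * to_ac c)"
      by (simp only: res_const[OF less.prems] res_swap[OF less.prems B'(1)] c)
    also have "\<dots> = to_ac (lead_coeff B ^ degree P * ((-1) ^ (degree P * degree B') * c))"
      by simp
    finally show ?thesis unfolding PB by blast
  qed
qed

text \<open>\<open>M\<close> is a minimal polynomial of the common root; it divides both
  polynomials, and the irreducible \<open>P\<close> is associated to it.\<close>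

lemma irreducible_dvd_of_common_root:
  assumes P: "irreducible P" and x: "poly (lift P) x = 0" "poly (lift W) x = 0"
  shows "P dvd W"
proof -
  define R where "R d \<longleftrightarrow> (\<exists>M. M \<noteq> 0 \<and> degree M = d \<and> poly (lift M) x = 0)" for d
  have "R (degree P)" using P x by (auto simp: R_def irreducible_def)
  then obtain d where d: "R d" "\<And>d'. d' < d \<Longrightarrow> \<not> R d'" by (metis exists_least_iff)
  then obtain M where M: "M \<noteq> 0" "degree M = d" "poly (lift M) x = 0" by (auto simp: R_def)
  have dvd: "M dvd V" if "poly (lift V) x = 0" for V
  proof (rule ccontr)
    assume "\<not> M dvd V"
    then have nz: "V mod M \<noteq> 0" by (simp add: dvd_eq_mod_eq_0)
    have "poly (lift (V mod M)) x = poly (lift (V - M * (V div M))) x" by (simp add: minus_mult_div_eq_mod)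
    also have "\<dots> = 0" using that M by (simp add: lift_diff lift_mult)
    finally have "R (degree (V mod M))" using nz by (auto simp: R_def)
    then show False using d(2) degree_mod_less[OF M(1), of V] nz M(2) by blast
  qed
  have "\<not> is_unit M"
  proof
    assume "is_unit M"
    then obtain c where "M = [:c:]" "c \<noteq> 0" using M(1) by (auto simp: is_unit_poly_iff)
    then show False using M(3) by simp
  qed
  moreover obtain C where C: "P = M * C" using dvd[OF x(1)] by (elim dvdE)
  ultimately have "is_unit C" using irreducibleD[OF P C] by blast
  then have "P dvd M" unfolding C by (simp add: mult_unit_dvd_iff)
  then show ?thesis using dvd[OF x(2)] dvd_trans by blast
qed

lemma res_nonzero:
  assumes "P \<in> finite_primes" "\<not> P dvd W" shows "res P W \<noteq> 0"
proof
  assume "res P W = 0"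
  then obtain x where "x \<in># proots (lift P)" "poly (lift W) x = 0"
    by (auto simp: res_def prod_mset_zero_iff)
  then show False
    using irreducible_dvd_of_common_root[OF finite_primesD(2)[OF assms(1)], of x W] assms
      finite_primesD(4)[OF assms(1)] by auto
qed

text \<open>Nonzero squares of elements of the base field, regarded inside the closure, where every
  element is a square.\<close>

definition squares :: "'a::field alg_closure set" where
  "squares = {to_ac c ^ 2 | c. c \<noteq> 0}"

lemma squares_mult: "x \<in> squares \<Longrightarrow> y \<in> squares \<Longrightarrow> x * y \<in> squares"
  unfolding squares_def by (smt (verit) mem_Collect_eq mult_eq_0_iff power_mult_distrib to_ac_mult)

lemma squares_inverse: "x \<in> squares \<Longrightarrow> inverse x \<in> squares"
  unfolding squares_def by (smt (verit) mem_Collect_eq inverse_zero_imp_zero power_inverse to_ac_inverse)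

lemma squares_cancel: "x \<in> squares \<Longrightarrow> x * y \<in> squares \<Longrightarrow> y \<in> squares"
proof -
  assume x: "x \<in> squares" and xy: "x * y \<in> squares"
  have "x \<noteq> 0" using x by (auto simp: squares_def)
  then have "inverse x * (x * y) = y" by simp
  then show ?thesis using squares_mult[OF squares_inverse[OF x] xy] by (simp only:)
qed

lemma squares_prod: "(\<And>i. i \<in> A \<Longrightarrow> h i \<in> squares) \<Longrightarrow> (\<Prod>i\<in>A. h i) \<in> squares"
proof (induction A rule: infinite_finite_induct)
  case (insert x F)
  then show ?case by (simp add: squares_mult)
qed (auto simp: squares_def intro!: exI[of _ 1])

lemma squaresI: "x \<in> range to_ac \<Longrightarrow> x \<noteq> 0 \<Longrightarrow> x ^ 2 \<in> squares"
  by (auto simp: squares_def)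

lemma to_ac_square_iff: "to_ac c \<in> squares \<longleftrightarrow> c \<noteq> 0 \<and> (\<exists>d. c = d ^ 2)"
proof -
  have "to_ac c = to_ac d ^ 2 \<longleftrightarrow> c = d ^ 2" for d by (metis to_ac_eq_iff to_ac_power)
  then show ?thesis by (auto simp: squares_def)
qed

text \<open>The half of the power residue criterion that holds over every field.\<close>

lemma res_square:
  assumes P: "P \<in> finite_primes" and E: "\<not> P dvd E" and W: "\<not> P dvd W" and U: "P dvd U ^ 2 - E * W ^ 2"
  shows "res P E \<in> squares"
proof -
  have "res P U ^ 2 = res P E * res P W ^ 2"
    using res_cong[OF U] by (simp add: res_mult_right res_power_right)
  moreover have "res P E \<noteq> 0" "res P W \<noteq> 0" using res_nonzero P E W by blast+
  ultimately have "res P U \<noteq> 0" by auto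
  have m: "lead_coeff P = 1" by (rule finite_primesD(1)[OF P])
  have "res P W ^ 2 * res P E \<in> squares"
    using \<open>res P U ^ 2 = _\<close> squaresI[OF res_in_range[OF m] \<open>res P U \<noteq> 0\<close>] by (simp add: mult.commute)
  with squaresI[OF res_in_range[OF m] \<open>res P W \<noteq> 0\<close>] show ?thesis by (rule squares_cancel)
qed

text \<open>The combination of the three residue conditions by quadratic reciprocity: all resultants
  between the monic factors occur twice, and only the class of \<open>\<alpha>\<close> survives.\<close>

lemma reciprocity_square:
  fixes A B G :: "'a::field poly"
  assumes m: "lead_coeff A = 1" "lead_coeff B = 1" "lead_coeff G = 1"
    and nz: "\<alpha> \<noteq> 0" "\<beta> \<noteq> 0"
    and deg: "even (degree A + degree G)" "odd (degree B + degree G)"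
    and sq: "res A ([:\<beta>:] * (B * G)) \<in> squares" "res B ([:\<alpha>:] * (A * G)) \<in> squares"
      "res G ([:- (\<alpha> * \<beta>):] * (A * B)) \<in> squares"
  shows "\<exists>d. \<alpha> = d ^ 2"
proof -
  let ?a = "degree A" and ?b = "degree B" and ?g = "degree G"
  define s where "s = res B A * res G A * res G B"
  have q1: "res A ([:\<beta>:] * (B * G)) = to_ac \<beta> ^ ?a * ((-1) ^ (?a * ?b) * res B A * ((-1) ^ (?a * ?g) * res G A))"
    by (simp only: res_mult_right res_const[OF m(1)] res_swap[OF m(1,2)] res_swap[OF m(1,3)])
  have q2: "res B ([:\<alpha>:] * (A * G)) = to_ac \<alpha> ^ ?b * (res B A * ((-1) ^ (?b * ?g) * res G B))"
    by (simp only: res_mult_right res_const[OF m(2)] res_swap[OF m(2,3)])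
  have q3: "res G ([:- (\<alpha> * \<beta>):] * (A * B)) = to_ac (- (\<alpha> * \<beta>)) ^ ?g * (res G A * res G B)"
    by (simp only: res_mult_right res_const[OF m(3)])
  have "s \<noteq> 0"
    using sq unfolding q1 q2 q3 by (auto simp: s_def squares_def)
  moreover have "s \<in> range to_ac"
  proof -
    obtain c1 c2 c3 where "res B A = to_ac c1" "res G A = to_ac c2" "res G B = to_ac c3"
      using res_in_range[OF m(2), of A] res_in_range[OF m(3), of A] res_in_range[OF m(3), of B] by blast
    then have "s = to_ac (c1 * c2 * c3)" by (simp add: s_def)
    then show ?thesis by (metis rangeI)
  qed
  ultimately have ss: "s ^ 2 \<in> squares" by (rule squaresI[rotated])
  \<comment> \<open>The last sign comes from the constant - (\<alpha> \<beta>) of the third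
    condition. With \<open>?a\<close> congruent to \<open>?g\<close> and \<open>?b\<close> to
    \<open>?g + 1\<close> modulo 2, the first and third exponents are even and the other two have
    equal parity.\<close>
  have sign: "(-1) ^ (?a * ?b) * (-1) ^ (?a * ?g) * (-1) ^ (?b * ?g) * (-1) ^ ?g = (1 :: 'a alg_closure)"
  proof -
    have "even (?a * ?b + ?a * ?g + ?b * ?g + ?g)" using deg by (auto simp: even_add)
    then show ?thesis by (simp flip: power_add)
  qed
  have "res A ([:\<beta>:] * (B * G)) * res B ([:\<alpha>:] * (A * G)) * res G ([:- (\<alpha> * \<beta>):] * (A * B))
      = ((-1) ^ (?a * ?b) * (-1) ^ (?a * ?g) * (-1) ^ (?b * ?g) * (-1) ^ ?g) *
        (s ^ 2 * (to_ac \<alpha> ^ (?b + ?g) * to_ac \<beta> ^ (?a + ?g)))"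
    unfolding q1 q2 q3 s_def
    by (simp add: power_mult_distrib power_add power2_eq_square power_minus[of "to_ac \<alpha> * to_ac \<beta>"])
  also have "\<dots> = s ^ 2 * (to_ac \<alpha> ^ (?b + ?g) * to_ac \<beta> ^ (?a + ?g))" unfolding sign by simp
  finally have "s ^ 2 * (to_ac \<alpha> ^ (?b + ?g) * to_ac \<beta> ^ (?a + ?g)) \<in> squares"
    using squares_mult[OF squares_mult[OF sq(1,2)] sq(3)] by simp
  then have "to_ac \<alpha> ^ (?b + ?g) * to_ac \<beta> ^ (?a + ?g) \<in> squares" by (rule squares_cancel[OF ss])
  moreover obtain i j where "?b + ?g = 2 * i + 1" "?a + ?g = 2 * j" using deg by (meson evenE oddE)
  ultimately have "(to_ac \<alpha> ^ i * to_ac \<beta> ^ j) ^ 2 * to_ac \<alpha> \<in> squares"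
    by (simp add: power_mult_distrib power_add power_mult[symmetric] mult_ac)
  moreover have "(to_ac \<alpha> ^ i * to_ac \<beta> ^ j) ^ 2 \<in> squares"
  proof (rule squaresI)
    have "to_ac \<alpha> ^ i * to_ac \<beta> ^ j = to_ac (\<alpha> ^ i * \<beta> ^ j)" by simp
    then show "to_ac \<alpha> ^ i * to_ac \<beta> ^ j \<in> range to_ac" by (metis rangeI)
  qed (use nz in simp)
  ultimately have "to_ac \<alpha> \<in> squares" using squares_cancel by blast
  then show ?thesis by (simp add: to_ac_square_iff)
qed

subsection \<open>Square classes of rational functions\<close>

lemma exists_prime_factor:
  fixes A :: "'a::field poly"
  assumes "degree A > 0" shows "\<exists>P\<in>finite_primes. P dvd A"
  using assms
proof (induction "degree A" arbitrary: A rule: less_induct)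
  case less
  show ?case
  proof (cases "irreducible A")
    case True
    define P where "P = smult (inverse (lead_coeff A)) A"
    have c: "lead_coeff A \<noteq> 0" using less.prems by auto
    then have "P dvd A" "A dvd P" by (simp_all add: P_def smult_dvd_iff dvd_smult)
    moreover have "irreducible P"
    proof (rule irreducibleI)
      show "P \<noteq> 0" using c by (auto simp: P_def)
      show "\<not> is_unit P" using True \<open>A dvd P\<close> by (meson dvd_trans irreducible_not_unit)
      fix B C assume "P = B * C"
      then have "A = B * smult (lead_coeff A) C" using c by (simp add: P_def) (metis mult_smult_right smult_smult c right_inverse smult_1_left)
      then have "is_unit B \<or> is_unit (smult (lead_coeff A) C)" by (rule irreducibleD[OF True])
      then show "is_unit B \<or> is_unit C" using c by (auto simp: smult_dvd_iff)
    qed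
    ultimately have "P \<in> finite_primes" using c less.prems by (auto simp: finite_primes_def P_def)
    with \<open>P dvd A\<close> show ?thesis by blast
  next
    case False
    have "A \<noteq> 0" "\<not> is_unit A" using less.prems by (auto simp: is_unit_poly_iff)
    then obtain B C where BC: "A = B * C" "\<not> is_unit B" "\<not> is_unit C" using False by (auto simp: irreducible_def)
    then have nz: "B \<noteq> 0" "C \<noteq> 0" using \<open>A \<noteq> 0\<close> by auto
    have "degree B > 0" "degree C > 0" using BC nz by (auto simp: is_unit_iff_degree)
    moreover have "degree A = degree B + degree C" unfolding BC(1) using nz by (rule degree_mult_eq)
    ultimately obtain P where "P \<in> finite_primes" "P dvd B" using less.hyps[of B] by auto
    then show ?thesis unfolding BC(1) by (intro bexI[of _ P] dvd_mult2)
  qed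
qed

lemma finite_primes_dvd_imp_eq:
  assumes "P \<in> finite_primes" "Q \<in> finite_primes" "P dvd Q" shows "P = Q"
proof -
  obtain C where C: "Q = P * C" using assms(3) by (elim dvdE)
  have "\<not> is_unit P" using finite_primesD(2)[OF assms(1)] by (rule irreducible_not_unit)
  then have "is_unit C" using irreducibleD[OF finite_primesD(2)[OF assms(2)] C] by blast
  then obtain c where c: "C = [:c:]" by (auto simp: is_unit_poly_iff)
  have "lead_coeff Q = lead_coeff P * lead_coeff C" unfolding C by (rule lead_coeff_mult)
  then have "c = 1" using finite_primesD(1)[OF assms(1)] finite_primesD(1)[OF assms(2)] c by simp
  then show ?thesis using C c by simp
qed

lemma prime_dvd_prod_iff_mem:
  assumes "P \<in> finite_primes" "finite Z" "Z \<subseteq> finite_primes"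
  shows "P dvd (\<Prod>Q\<in>Z. Q) \<longleftrightarrow> P \<in> Z"
  using assms(2,3)
proof (induction Z)
  case empty
  then show ?case using finite_primesD(2)[OF assms(1)] irreducible_not_unit by auto
next
  case (insert Q Z)
  have "P dvd Q \<longleftrightarrow> P = Q" using finite_primes_dvd_imp_eq[OF assms(1)] insert.prems by auto
  then show ?case using insert by (simp add: prime_elem_dvd_mult_iff[OF finite_primesD(5)[OF assms(1)]])
qed

lemma lead_coeff_prod_finite_primes:
  "Z \<subseteq> finite_primes \<Longrightarrow> lead_coeff (\<Prod>P\<in>Z. P) = 1"
  by (auto simp: lead_coeff_prod finite_primesD(1) intro!: prod.neutral)

text \<open>Recording the squarefree part as a set of primes turns the parity of a valuation into
  membership in that set.\<close>

lemma squarefree_decomposition: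
  fixes A :: "'a::field poly"
  assumes "A \<noteq> 0"
  shows "\<exists>\<alpha> S Z. \<alpha> \<noteq> 0 \<and> S \<noteq> 0 \<and> finite Z \<and> Z \<subseteq> finite_primes \<and> A = [:\<alpha>:] * S ^ 2 * (\<Prod>P\<in>Z. P)"
  using assms
proof (induction "degree A" arbitrary: A rule: less_induct)
  case less
  show ?case
  proof (cases "degree A = 0")
    case True
    then obtain \<alpha> where "A = [:\<alpha>:]" by (metis degree_eq_zeroE)
    then show ?thesis using less.prems by (intro exI[of _ \<alpha>] exI[of _ 1] exI[of _ "{}"]) auto
  next
    case False
    then obtain P where P: "P \<in> finite_primes" "P dvd A" using exists_prime_factor by blast
    then obtain B where B: "A = P * B" by (elim dvdE)
    have "B \<noteq> 0" "P \<noteq> 0" using less.prems B by auto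
    then have "degree B < degree A" unfolding B using finite_primesD(3)[OF P(1)] by (simp add: degree_mult_eq)
    from less.hyps[OF this \<open>B \<noteq> 0\<close>] obtain \<alpha> S Z where
      Z: "\<alpha> \<noteq> 0" "S \<noteq> 0" "finite Z" "Z \<subseteq> finite_primes" "B = [:\<alpha>:] * S ^ 2 * (\<Prod>P\<in>Z. P)" by blast
    show ?thesis
    proof (cases "P \<in> Z")
      case True
      have "A = [:\<alpha>:] * (S * P) ^ 2 * (\<Prod>P\<in>Z - {P}. P)"
        unfolding B Z(5) prod.remove[OF Z(3) True] by (simp add: power2_eq_square mult_ac)
      then show ?thesis using Z \<open>P \<noteq> 0\<close>
        by (intro exI[of _ \<alpha>] exI[of _ "S * P"] exI[of _ "Z - {P}"]) auto
    next
      case False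
      have "A = [:\<alpha>:] * S ^ 2 * (\<Prod>P\<in>insert P Z. P)"
        unfolding B Z(5) prod.insert[OF Z(3) False] by (simp add: mult_ac)
      then show ?thesis using Z P by (intro exI[of _ \<alpha>] exI[of _ S] exI[of _ "insert P Z"]) auto
    qed
  qed
qed

lemma fract_eq_divide: "Fract A B = to_fract A / to_fract B"
  by (cases "B = 0") (auto simp: to_fract_def fract_collapse)

lemma const_fract_simps:
  "const_fract (c * d) = const_fract c * const_fract d" "const_fract (- c) = - const_fract c"
  "const_fract c = 0 \<longleftrightarrow> c = 0" "const_fract 1 = 1"
  unfolding const_fract_def to_fract_eq_0_iff
  by (simp_all flip: to_fract_mult to_fract_uminus add: one_pCons[symmetric])

text \<open>A / B and A B differ by the square of B, which reduces the claim to polynomials.\<close>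

lemma fract_decomposition:
  assumes "x \<noteq> 0"
  shows "\<exists>\<alpha> s Z. \<alpha> \<noteq> 0 \<and> s \<noteq> 0 \<and> finite Z \<and> Z \<subseteq> finite_primes \<and>
    x = const_fract \<alpha> * s ^ 2 * to_fract (\<Prod>P\<in>Z. P)"
proof -
  obtain A B where x: "x = Fract A B" "B \<noteq> 0" by (cases x) auto
  then have "A \<noteq> 0" using assms by (auto simp: Zero_fract_def eq_fract)
  then have "A * B \<noteq> 0" using x by simp
  from squarefree_decomposition[OF this] obtain \<alpha> S Z where
    Z: "\<alpha> \<noteq> 0" "S \<noteq> 0" "finite Z" "Z \<subseteq> finite_primes" "A * B = [:\<alpha>:] * S ^ 2 * (\<Prod>P\<in>Z. P)" by blast
  have B: "to_fract B \<noteq> 0" using x by (simp add: to_fract_eq_0_iff)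
  have "x = to_fract (A * B) / to_fract B ^ 2"
    using B by (simp add: x fract_eq_divide power2_eq_square)
  also have "\<dots> = const_fract \<alpha> * (to_fract S / to_fract B) ^ 2 * to_fract (\<Prod>P\<in>Z. P)"
    unfolding Z(5) by (simp add: const_fract_def power2_eq_square del: mult_pCons_left)
  finally show ?thesis
    using Z B by (intro exI[of _ \<alpha>] exI[of _ "to_fract S / to_fract B"] exI[of _ Z]) (simp add: to_fract_eq_0_iff)
qed

lemma poly_multiplicity_eq_0: "P \<in> finite_primes \<Longrightarrow> \<not> P dvd A \<Longrightarrow> poly_multiplicity P A = 0"
  using poly_multiplicity_eqI[of P A 0] by simp

lemma valuation_Fin_not_dvd:
  assumes "P \<in> finite_primes" "\<not> P dvd A" shows "valuation (Fin P) (to_fract A) = 0"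
proof -
  have "A \<noteq> 0" using assms(2) by auto
  then show ?thesis using poly_multiplicity_eq_0[OF assms] valuation_Fin_to_fract[OF assms(1)] by simp
qed

lemma not_dvd_const: "P \<in> finite_primes \<Longrightarrow> c \<noteq> 0 \<Longrightarrow> \<not> P dvd [:c:]"
  using finite_primesD(3)[of P] by (auto dest!: dvd_imp_degree_le)

lemma valuation_Fin_const_fract: "P \<in> finite_primes \<Longrightarrow> c \<noteq> 0 \<Longrightarrow> valuation (Fin P) (const_fract c) = 0"
  unfolding const_fract_def by (rule valuation_Fin_not_dvd[OF _ not_dvd_const])

lemma valuation_Fin_prod:
  assumes P: "P \<in> finite_primes" and Z: "finite Z" "Z \<subseteq> finite_primes"
  shows "valuation (Fin P) (to_fract (\<Prod>Q\<in>Z. Q)) = (if P \<in> Z then 1 else 0)"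
proof (cases "P \<in> Z")
  case True
  have "\<not> P dvd (\<Prod>Q\<in>Z - {P}. Q)" using prime_dvd_prod_iff_mem[OF P, of "Z - {P}"] Z by auto
  from poly_multiplicity_eqI[OF P this, of 1]
  have "poly_multiplicity P (\<Prod>Q\<in>Z. Q) = 1" using prod.remove[OF Z(1) True, of "\<lambda>Q. Q"] by simp
  moreover have "(\<Prod>Q\<in>Z. Q) \<noteq> 0" using lead_coeff_prod_finite_primes[OF Z(2)] by auto
  ultimately show ?thesis using True valuation_Fin_to_fract[OF P] by simp
next
  case False
  then show ?thesis using prime_dvd_prod_iff_mem[OF P Z] valuation_Fin_not_dvd[OF P] by simp
qed

lemma odd_valuation_decomposition:
  assumes P: "P \<in> finite_primes" and "\<alpha> \<noteq> 0" "s \<noteq> 0" "finite Z" "Z \<subseteq> finite_primes"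
  shows "odd (valuation (Fin P) (const_fract \<alpha> * s ^ 2 * to_fract (\<Prod>Q\<in>Z. Q))) \<longleftrightarrow> P \<in> Z"
proof -
  note V = field_valuation_Fin[OF P]
  have "to_fract (\<Prod>Q\<in>Z. Q) \<noteq> 0"
    unfolding to_fract_eq_0_iff using lead_coeff_prod_finite_primes[OF assms(5)] by auto
  then have "valuation (Fin P) (const_fract \<alpha> * s ^ 2 * to_fract (\<Prod>Q\<in>Z. Q)) =
      0 + 2 * valuation (Fin P) s + (if P \<in> Z then 1 else 0)"
    using assms by (simp add: val_mult[OF V] val_power2[OF V] const_fract_simps valuation_Fin_const_fract
        valuation_Fin_prod del: valuation.simps)
  then show ?thesis by simp
qed

text \<open>Turns a failure of \<open>residue_nonsquare\<close> into a congruence of polynomials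
  modulo \<open>P\<close>, by scaling \<open>s\<close> away and clearing denominators prime to
  \<open>P\<close>.\<close>

lemma local_square:
  assumes P: "P \<in> finite_primes" and E: "\<not> P dvd E" and s: "s \<noteq> 0"
    and not: "\<not> residue_nonsquare (valuation (Fin P)) (s ^ 2 * to_fract E)"
  shows "res P E \<in> squares"
proof -
  note V = field_valuation_Fin[OF P]
  let ?v = "valuation (Fin P)" and ?e = "s ^ 2 * to_fract E"
  have E0: "to_fract E \<noteq> 0" using E by (auto simp: to_fract_eq_0_iff)
  have vE: "?v (to_fract E) = 0" by (rule valuation_Fin_not_dvd[OF P E])
  have ve: "?v ?e = 2 * ?v s" using s E0 vE by (simp add: val_mult[OF V] val_power2[OF V] del: valuation.simps)
  obtain u where u: "val_ge ?v (2 * ?v s + 1) (u ^ 2 - ?e)"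
    using not s E0 ve unfolding residue_nonsquare_def by auto
  \<comment> \<open>After division by \<open>s\<close>, \<open>u'\<close> is a square root of
    \<open>E\<close> up to an error of positive valuation, and in particular it is
    \<open>P\<close>-integral.\<close>
  define u' where "u' = u / s"
  have "u ^ 2 - ?e = s ^ 2 * (u' ^ 2 - to_fract E)"
    using s by (simp add: u'_def power_divide right_diff_distrib)
  then have u'1: "val_ge ?v 1 (u' ^ 2 - to_fract E)"
    using u s by (cases "u' ^ 2 - to_fract E = 0")
      (auto simp: val_ge_def val_mult[OF V] val_power2[OF V] simp del: valuation.simps)
  have "val_ge ?v 0 (u' ^ 2 - to_fract E)" by (rule val_ge_mono[OF V u'1]) simp
  moreover have "val_ge ?v 0 (to_fract E)" using vE by (simp add: val_ge_def)
  ultimately have "val_ge ?v 0 (u' ^ 2)" using val_ge_add[OF V] by fastforce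
  then have u'0: "val_ge ?v 0 u'"
    by (cases "u' = 0") (auto simp: val_ge_def val_power2[OF V] simp del: valuation.simps)
  \<comment> \<open>For a \<open>P\<close>-integral fraction the power of \<open>P\<close> in the
    denominator cancels against the numerator.\<close>
  have "\<exists>U W. \<not> P dvd W \<and> u' = to_fract U / to_fract W"
  proof (cases "u' = 0")
    case True
    then show ?thesis using not_dvd_const[OF P, of 1] by (intro exI[of _ 0] exI[of _ "[:1:]"]) auto
  next
    case False
    obtain A B where AB: "u' = Fract A B" "B \<noteq> 0" by (cases u') auto
    then have "A \<noteq> 0" using False by (auto simp: Zero_fract_def eq_fract)
    define i j where "i = poly_multiplicity P A" and "j = poly_multiplicity P B"
    obtain A' where A': "A = P ^ i * A'" using poly_multiplicity_decompose[OF P \<open>A \<noteq> 0\<close>] unfolding i_def by blast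
    obtain B' where B': "B = P ^ j * B'" "\<not> P dvd B'" using poly_multiplicity_decompose[OF P AB(2)] unfolding j_def by blast
    have "?v u' = int i - int j"
      unfolding AB(1) i_def j_def by (rule valuation_Fin_Fract[OF P \<open>A \<noteq> 0\<close> AB(2)])
    then have "j \<le> i" using u'0 False by (auto simp: val_ge_def simp del: valuation.simps)
    then have "A = P ^ j * (P ^ (i - j) * A')" unfolding A' by (metis le_add_diff_inverse mult.assoc power_add)
    moreover have "to_fract (P ^ j) \<noteq> 0" unfolding to_fract_eq_0_iff using finite_primesD(4)[OF P] by simp
    ultimately have "u' = to_fract (P ^ (i - j) * A') / to_fract B'"
      unfolding AB(1) fract_eq_divide B'(1) using finite_primesD(4)[OF P] by simp
    then show ?thesis using B'(2) by blast
  qed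
  then obtain U W where W: "\<not> P dvd W" "u' = to_fract U / to_fract W" by blast
  have W0: "to_fract W \<noteq> 0" using W(1) by (auto simp: to_fract_eq_0_iff)
  have "val_ge ?v 0 (to_fract W ^ 2)"
    using W0 valuation_Fin_not_dvd[OF P W(1)] by (simp add: val_ge_def val_power2[OF V] del: valuation.simps)
  from val_ge_mult[OF V u'1 this]
  have "val_ge ?v 1 ((u' ^ 2 - to_fract E) * to_fract W ^ 2)" by simp
  moreover have "(u' ^ 2 - to_fract E) * to_fract W ^ 2 = to_fract (U ^ 2 - E * W ^ 2)"
    using W0 by (simp add: W(2) left_diff_distrib power_divide power2_eq_square)
  ultimately have "valuation_ge (Fin P) (int 1) (to_fract (U ^ 2 - E * W ^ 2))"
    by (simp only: val_ge_valuation of_nat_1)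
  then have "P dvd U ^ 2 - E * W ^ 2" unfolding valuation_ge_to_fract_iff[OF P] by simp
  with P E W(1) show ?thesis by (rule res_square)
qed

lemma res_prod_squares:
  assumes "finite Z" "Z \<subseteq> finite_primes" "\<And>P. P \<in> Z \<Longrightarrow> res P E \<in> squares"
  shows "res (\<Prod>P\<in>Z. P) E \<in> squares"
proof -
  have "res (\<Prod>P\<in>Z. P) E = (\<Prod>P\<in>Z. res P E)"
    using assms(1,2) finite_primesD(4) by (intro res_prod_left) blast+
  then show ?thesis using squares_prod[of Z "\<lambda>P. res P E", OF assms(3)] by simp
qed

text \<open>At a prime that is odd for \<open>a\<close> only, for \<open>b\<close> only, or for
  both, anisotropy follows once \<open>b\<close>, \<open>a\<close> or \<open>- (a * b)\<close>,
  respectively, is a residue nonsquare. If anisotropy fails at all of them, the products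
  \<open>A\<close>, \<open>B\<close> and \<open>G\<close> of the three kinds of primes satisfy the
  hypotheses of \<open>reciprocity_square\<close>, which contradicts the choice of \<alpha>.\<close>

lemma exists_ramified_finite_prime:
  assumes nz: "\<alpha> \<noteq> 0" "s \<noteq> 0" "\<beta> \<noteq> 0" "r \<noteq> 0"
    and Z: "finite Z" "Z \<subseteq> finite_primes" "finite Y" "Y \<subseteq> finite_primes"
    and a: "a = const_fract \<alpha> * s ^ 2 * to_fract (\<Prod>P\<in>Z. P)"
    and b: "b = const_fract \<beta> * r ^ 2 * to_fract (\<Prod>P\<in>Y. P)"
    and \<alpha>: "\<nexists>d. \<alpha> = d ^ 2" and deg: "even (degree (\<Prod>P\<in>Z. P))" "odd (degree (\<Prod>P\<in>Y. P))"
  shows "\<exists>P\<in>finite_primes. (odd (valuation (Fin P) a) \<or> odd (valuation (Fin P) b)) \<and>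
    norm_anisotropic (valuation (Fin P)) a b"
proof (rule ccontr)
  assume not: "\<not> ?thesis"
  define A B G where "A = (\<Prod>P\<in>Z - Y. P)" and "B = (\<Prod>P\<in>Y - Z. P)" and "G = (\<Prod>P\<in>Z \<inter> Y. P)"
  have sub: "Z - Y \<subseteq> finite_primes" "Y - Z \<subseteq> finite_primes" "Z \<inter> Y \<subseteq> finite_primes"
    "finite (Z - Y)" "finite (Y - Z)" "finite (Z \<inter> Y)" using Z by auto
  have AG: "(\<Prod>P\<in>Z. P) = A * G" and BG: "(\<Prod>P\<in>Y. P) = B * G"
    unfolding A_def B_def G_def
    using prod.Int_Diff[OF Z(1), of "\<lambda>P. P" Y] prod.Int_Diff[OF Z(3), of "\<lambda>P. P" Z]
    by (simp_all add: mult.commute Int_commute)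
  have m: "lead_coeff A = 1" "lead_coeff B = 1" "lead_coeff G = 1"
    unfolding A_def B_def G_def using lead_coeff_prod_finite_primes sub by blast+
  then have ABG0: "A \<noteq> 0" "B \<noteq> 0" "G \<noteq> 0" by auto
  have va: "odd (valuation (Fin P) a) \<longleftrightarrow> P \<in> Z" and vb: "odd (valuation (Fin P) b) \<longleftrightarrow> P \<in> Y"
    if "P \<in> finite_primes" for P
    unfolding a b by (rule odd_valuation_decomposition[OF that nz(1,2) Z(1,2)])
      (rule odd_valuation_decomposition[OF that nz(3,4) Z(3,4)])
  have a0: "a \<noteq> 0" and b0: "b \<noteq> 0"
    using nz ABG0 by (auto simp: a b AG BG const_fract_simps to_fract_eq_0_iff)
  have dvd: "P dvd A \<longleftrightarrow> P \<in> Z - Y" "P dvd B \<longleftrightarrow> P \<in> Y - Z" "P dvd G \<longleftrightarrow> P \<in> Z \<inter> Y" if "P \<in> finite_primes" for P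
    unfolding A_def B_def G_def using prime_dvd_prod_iff_mem[OF that] sub by blast+
  note dvd_mult = prime_elem_dvd_mult_iff[OF finite_primesD(5)]
  have "res P ([:\<beta>:] * (B * G)) \<in> squares" if "P \<in> Z - Y" for P
  proof (rule local_square[OF _ _ nz(4)])
    show P: "P \<in> finite_primes" using that sub by blast
    show "\<not> P dvd [:\<beta>:] * (B * G)" using that dvd[OF P] not_dvd_const[OF P nz(3)] by (simp add: dvd_mult[OF P] del: mult_pCons_left)
    have "r ^ 2 * to_fract ([:\<beta>:] * (B * G)) = b"
      unfolding b BG const_fract_def to_fract_mult by (simp only: mult_ac)
    moreover have "\<not> residue_nonsquare (valuation (Fin P)) b"
      using not va[OF P] vb[OF P] that a0 P norm_anisotropic_commute[OF field_valuation_Fin[OF P]]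
        norm_anisotropic_odd_right[OF field_valuation_Fin[OF P], of b a] by blast
    ultimately show "\<not> residue_nonsquare (valuation (Fin P)) (r ^ 2 * to_fract ([:\<beta>:] * (B * G)))" by simp
  qed
  then have 1: "res A ([:\<beta>:] * (B * G)) \<in> squares"
    unfolding A_def by (rule res_prod_squares[OF sub(4,1)])
  have "res P ([:\<alpha>:] * (A * G)) \<in> squares" if "P \<in> Y - Z" for P
  proof (rule local_square[OF _ _ nz(2)])
    show P: "P \<in> finite_primes" using that sub by blast
    show "\<not> P dvd [:\<alpha>:] * (A * G)" using that dvd[OF P] not_dvd_const[OF P nz(1)] by (simp add: dvd_mult[OF P] del: mult_pCons_left)
    have "s ^ 2 * to_fract ([:\<alpha>:] * (A * G)) = a"
      unfolding a AG const_fract_def to_fract_mult by (simp only: mult_ac)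
    moreover have "\<not> residue_nonsquare (valuation (Fin P)) a"
      using not va[OF P] vb[OF P] that b0 P
        norm_anisotropic_odd_right[OF field_valuation_Fin[OF P], of a b] by blast
    ultimately show "\<not> residue_nonsquare (valuation (Fin P)) (s ^ 2 * to_fract ([:\<alpha>:] * (A * G)))" by simp
  qed
  then have 2: "res B ([:\<alpha>:] * (A * G)) \<in> squares"
    unfolding B_def by (rule res_prod_squares[OF sub(5,2)])
  have "res P ([:- (\<alpha> * \<beta>):] * (A * B)) \<in> squares" if "P \<in> Z \<inter> Y" for P
  \<comment> \<open>Both \<open>a\<close> and \<open>b\<close> contain the factor \<open>G\<close>,
    so its square in their product is absorbed into the scaling.\<close>
  proof (rule local_square[where s = "s * r * to_fract G"])
    show P: "P \<in> finite_primes" using that sub by blast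
    show "\<not> P dvd [:- (\<alpha> * \<beta>):] * (A * B)"
      using that dvd[OF P] not_dvd_const[OF P, of "- (\<alpha> * \<beta>)"] nz by (simp add: dvd_mult[OF P] del: mult_pCons_left)
    show "s * r * to_fract G \<noteq> 0" using nz ABG0 by (simp add: to_fract_eq_0_iff)
    have c: "to_fract [:- (\<alpha> * \<beta>):] = - (to_fract [:\<alpha>:] * to_fract [:\<beta>:])"
      using const_fract_simps(1)[of \<alpha> \<beta>] const_fract_simps(2)[of "\<alpha> * \<beta>"] by (simp add: const_fract_def)
    have "(s * r * to_fract G) ^ 2 * to_fract ([:- (\<alpha> * \<beta>):] * (A * B)) = - (a * b)"
      unfolding a b AG BG const_fract_def to_fract_mult c by (simp add: power2_eq_square mult_ac)
    moreover have "\<not> residue_nonsquare (valuation (Fin P)) (- (a * b))"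
      using not va[OF P] vb[OF P] that P
        norm_anisotropic_odd_both[OF field_valuation_Fin[OF P], of a b] by blast
    ultimately show "\<not> residue_nonsquare (valuation (Fin P)) ((s * r * to_fract G) ^ 2 * to_fract ([:- (\<alpha> * \<beta>):] * (A * B)))"
      by simp
  qed
  then have 3: "res G ([:- (\<alpha> * \<beta>):] * (A * B)) \<in> squares"
    unfolding G_def by (rule res_prod_squares[OF sub(6,3)])
  have "even (degree A + degree G)" "odd (degree B + degree G)"
    using deg ABG0 by (simp_all add: AG BG degree_mult_eq)
  from reciprocity_square[OF m nz(1,3) this 1 2 3] \<alpha> show False by blast
qed

subsection \<open>The infinite place\<close>

lemma fract_to_fls_mult: "fract_to_fls (x * y) = fract_to_fls x * fract_to_fls y"
proof -
  obtain A B where x: "x = Fract A B" "B \<noteq> 0" by (cases x) auto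
  obtain C D where y: "y = Fract C D" "D \<noteq> 0" by (cases y) auto
  show ?thesis using x(2) y(2) by (simp add: x(1) y(1) fract_to_fls_Fract poly_to_fls_mult)
qed

lemma fract_to_fls_add: "fract_to_fls (x + y) = fract_to_fls x + fract_to_fls y"
proof -
  obtain A B where x: "x = Fract A B" "B \<noteq> 0" by (cases x) auto
  obtain C D where y: "y = Fract C D" "D \<noteq> 0" by (cases y) auto
  have "poly_to_fls B \<noteq> 0" "poly_to_fls D \<noteq> 0" using x y by (simp_all add: poly_to_fls_eq_0_iff)
  then show ?thesis using x(2) y(2)
    by (simp add: x(1) y(1) fract_to_fls_Fract poly_to_fls_mult poly_to_fls_add add_frac_eq)
qed

lemma poly_to_fls_const: "poly_to_fls [:c:] = fls_const c"
  by (simp add: poly_to_fls_def)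

lemma fract_to_fls_to_fract:
  fixes A :: "'a::field poly"
  shows "fract_to_fls (to_fract A) = poly_to_fls A"
proof -
  have "poly_to_fls (1 :: 'a poly) = 1" using poly_to_fls_const[of 1] by (simp add: one_pCons)
  then show ?thesis using fract_to_fls_Fract[of 1 A] by (simp add: to_fract_def)
qed

lemma fract_to_fls_1: "fract_to_fls 1 = 1"
  by (metis fls_const_1 fract_to_fls_to_fract one_pCons poly_to_fls_const to_fract_1)

lemma fract_to_fls_minus:
  fixes x :: "'a::field poly fract"
  shows "fract_to_fls (- x) = - fract_to_fls x"
proof -
  have "poly_to_fls [:-1:] = (- 1 :: 'a fls)" unfolding poly_to_fls_const by (rule fls_eqI) simp
  then have "fract_to_fls (to_fract [:-1:]) = (-1 :: 'a fls)" unfolding fract_to_fls_to_fract .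
  moreover have "to_fract [:-1:] = (-1 :: 'a poly fract)"
    by (metis one_pCons minus_pCons minus_zero to_fract_1 to_fract_uminus)
  ultimately show ?thesis using fract_to_fls_mult[of "-1" x] by simp
qed

lemma fract_to_fls_eq_0_iff: "fract_to_fls x = 0 \<longleftrightarrow> x = 0"
proof -
  obtain A B where x: "x = Fract A B" "B \<noteq> 0" by (cases x) auto
  then show ?thesis by (auto simp: fract_to_fls_Fract poly_to_fls_eq_0_iff Zero_fract_def eq_fract)
qed

lemma fls_subdegree_poly_to_fls: "fls_subdegree (poly_to_fls A) = - int (degree A)"
proof (cases "A = 0")
  case False
  then show ?thesis by (intro fls_subdegree_eqI) (auto simp: poly_to_fls_nth intro!: coeff_eq_0)
qed (simp add: poly_to_fls_def)

lemma fls_subdegree_fract_to_fls: "x \<noteq> 0 \<Longrightarrow> fls_subdegree (fract_to_fls x) = - fract_degree x"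
proof -
  assume "x \<noteq> 0"
  obtain A B where x: "x = Fract A B" "B \<noteq> 0" by (cases x) auto
  then have A: "A \<noteq> 0" using \<open>x \<noteq> 0\<close> by (auto simp: Zero_fract_def eq_fract)
  have "fls_subdegree (poly_to_fls A / poly_to_fls B) = fls_subdegree (poly_to_fls A) - fls_subdegree (poly_to_fls B)"
    by (rule val_divide[OF field_valuation_fls_subdegree]) (use A x in \<open>auto simp: poly_to_fls_eq_0_iff\<close>)
  then show ?thesis using A x by (simp add: fract_to_fls_Fract fract_degree_Fract fls_subdegree_poly_to_fls)
qed

text \<open>The variable is 1/t, so the lowest coefficient of the series is the leading coefficient
  in t.\<close>

definition fls_lead :: "'a::field fls \<Rightarrow> 'a" where
  "fls_lead f = fls_nth f (fls_subdegree f)"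

lemma fls_lead_mult: "fls_lead (f * g) = fls_lead f * fls_lead g"
proof (cases "f = 0 \<or> g = 0")
  case False
  then show ?thesis by (simp add: fls_lead_def)
qed (auto simp: fls_lead_def)

lemma fls_lead_nonzero: "f \<noteq> 0 \<Longrightarrow> fls_lead f \<noteq> 0"
  by (simp add: fls_lead_def)

lemma fls_lead_poly_to_fls: "fls_lead (poly_to_fls A) = lead_coeff A"
  by (simp add: fls_lead_def fls_subdegree_poly_to_fls poly_to_fls_nth)

lemma fls_lead_const: "fls_lead (fls_const c) = c"
  by (simp add: fls_lead_def)

text \<open>The square of an approximate root would have the same leading coefficient as the series,
  and this would make \<epsilon> a square of constants.\<close>

lemma residue_nonsquare_fls:
  assumes "\<nexists>x. \<epsilon> = x ^ 2" "y \<noteq> 0"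
  shows "residue_nonsquare fls_subdegree (fls_const \<epsilon> * y ^ 2)" "even (fls_subdegree (fls_const \<epsilon> * y ^ 2))"
proof -
  note V = field_valuation_fls_subdegree
  let ?e = "fls_const \<epsilon> * y ^ 2"
  have \<epsilon>: "\<epsilon> \<noteq> 0" using assms(1) by (metis zero_power2)
  then have e0: "?e \<noteq> 0" using assms by simp
  have sub: "fls_subdegree ?e = 2 * fls_subdegree y"
    using \<epsilon> assms(2) by (simp add: power2_eq_square)
  then show "even (fls_subdegree ?e)" by simp
  show "residue_nonsquare fls_subdegree ?e"
    unfolding residue_nonsquare_def
  proof (rule conjI[OF e0], intro allI notI)
    fix u assume u: "val_ge fls_subdegree (fls_subdegree ?e + 1) (u ^ 2 - ?e)"
    from val_add_eq[OF V e0 u] have "u ^ 2 \<noteq> 0" "fls_subdegree (u ^ 2) = fls_subdegree ?e" by simp_all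
    moreover have "fls_nth (u ^ 2 - ?e) (fls_subdegree ?e) = 0"
    proof (cases "u ^ 2 - ?e = 0")
      case False
      then have "fls_subdegree ?e < fls_subdegree (u ^ 2 - ?e)" using u unfolding val_ge_def by linarith
      then show ?thesis by (rule fls_eq0_below_subdegree)
    qed (simp only: fls_zero_nth)
    ultimately have "fls_lead (u ^ 2) = fls_lead ?e" by (simp add: fls_lead_def)
    then have "fls_lead u ^ 2 = \<epsilon> * fls_lead y ^ 2"
      by (simp add: power2_eq_square fls_lead_mult fls_lead_const)
    then have "\<epsilon> = (fls_lead u / fls_lead y) ^ 2"
      using fls_lead_nonzero[OF assms(2)] by (simp add: power_divide)
    then show False using assms(1) by blast
  qed
qed

text \<open>The coordinates lie in the complete field itself, so anisotropy enters as nonvanishing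
  of the norm, which is then a unit.\<close>

lemma ramified_Infty:
  assumes "norm_anisotropic fls_subdegree (fract_to_fls a) (fract_to_fls b)"
  shows "quaternion_localization_is_division a b Infty"
proof -
  let ?R = "ring_of_type_algebra :: 'a fls ring"
  interpret quaternion_tensor ?R a b fract_to_fls
    by (intro quaternion_tensor.intro quaternion_tensor_axioms.intro cring_from_type_algebra)
      (simp_all add: ring_of_type_algebra_def fract_to_fls_mult fract_to_fls_add fract_to_fls_1)
  show ?thesis
    unfolding quaternion_localization_is_division.simps
  proof (rule division_algebra_tensorI)
    fix c0 c1 c2 c3
    assume nz: "\<not> (c0 = \<zero>\<^bsub>?R\<^esub> \<and> c1 = \<zero>\<^bsub>?R\<^esub> \<and> c2 = \<zero>\<^bsub>?R\<^esub> \<and> c3 = \<zero>\<^bsub>?R\<^esub>)"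
    have "norm c0 c1 c2 c3 = quaternion_norm (fract_to_fls a) (fract_to_fls b) c0 c1 c2 c3"
      unfolding norm_def quaternion_norm_def
      by (simp add: ring_of_type_algebra_def fract_to_fls_minus fract_to_fls_mult power2_eq_square)
    moreover have "quaternion_norm (fract_to_fls a) (fract_to_fls b) c0 c1 c2 c3 \<noteq> 0"
    proof
      assume "quaternion_norm (fract_to_fls a) (fract_to_fls b) c0 c1 c2 c3 = 0"
      from norm_anisotropic_nonzero[OF field_valuation_fls_subdegree assms this] nz
      show False by (simp add: ring_of_type_algebra_def)
    qed
    ultimately have "norm c0 c1 c2 c3 \<noteq> 0" by simp
    moreover have "u \<in> Units ?R" if "u \<noteq> 0" for u :: "'a fls"
      using that by (auto simp: Units_def ring_of_type_algebra_def intro!: exI[of _ "inverse u"])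
    ultimately show "norm c0 c1 c2 c3 \<in> Units ?R" by blast
  qed
qed

text \<open>A pair in the first form of the definition of \<open>D_pairs\<close> is ramified at infinity and, by
  reciprocity, at some finite prime as well.\<close>

lemma ramified_pair:
  assumes \<epsilon>: "\<nexists>x. \<epsilon> = x ^ 2" and nz: "a \<noteq> 0" "b \<noteq> 0"
    and a: "fract_to_fls a = fls_const \<epsilon> * y ^ 2" and b: "odd (fract_degree b)"
  shows "norm_anisotropic fls_subdegree (fract_to_fls a) (fract_to_fls b)"
    and "\<exists>P\<in>finite_primes. (odd (valuation (Fin P) a) \<or> odd (valuation (Fin P) b)) \<and>
      norm_anisotropic (valuation (Fin P)) a b"
proof -
  note V = field_valuation_fls_subdegree
  have y: "y \<noteq> 0" using a nz(1) fract_to_fls_eq_0_iff[of a] by auto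
  show "norm_anisotropic fls_subdegree (fract_to_fls a) (fract_to_fls b)"
    using nz b residue_nonsquare_fls[OF \<epsilon> y]
    by (intro norm_anisotropic_odd_right[OF V]) (auto simp: a fract_to_fls_eq_0_iff fls_subdegree_fract_to_fls)
  obtain \<alpha> s Z where Z: "\<alpha> \<noteq> 0" "s \<noteq> 0" "finite Z" "Z \<subseteq> finite_primes"
    "a = const_fract \<alpha> * s ^ 2 * to_fract (\<Prod>P\<in>Z. P)" using fract_decomposition[OF nz(1)] by blast
  obtain \<beta> r Y where Y: "\<beta> \<noteq> 0" "r \<noteq> 0" "finite Y" "Y \<subseteq> finite_primes"
    "b = const_fract \<beta> * r ^ 2 * to_fract (\<Prod>P\<in>Y. P)" using fract_decomposition[OF nz(2)] by blast
  let ?F = "fract_to_fls"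
  have F: "?F (const_fract \<gamma> * t ^ 2 * to_fract A) = fls_const \<gamma> * ?F t ^ 2 * poly_to_fls A" for \<gamma> t A
    by (simp add: fract_to_fls_mult const_fract_def fract_to_fls_to_fract poly_to_fls_const power2_eq_square)
  have sub: "fls_subdegree (?F (const_fract \<gamma> * t ^ 2 * to_fract A)) = 2 * fls_subdegree (?F t) - int (degree A)"
    if "\<gamma> \<noteq> 0" "t \<noteq> 0" "A \<noteq> 0" for \<gamma> t A
    unfolding F using that
    by (simp add: fract_to_fls_eq_0_iff poly_to_fls_eq_0_iff fls_subdegree_poly_to_fls power2_eq_square)
  have ZY: "(\<Prod>P\<in>Z. P) \<noteq> 0" "(\<Prod>P\<in>Y. P) \<noteq> 0"
    using lead_coeff_prod_finite_primes[OF Z(4)] lead_coeff_prod_finite_primes[OF Y(4)] by auto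
  have "even (2 * fls_subdegree (?F s) - int (degree (\<Prod>P\<in>Z. P)))"
    using residue_nonsquare_fls(2)[OF \<epsilon> y] sub[OF Z(1,2) ZY(1)] unfolding Z(5)[symmetric] a by simp
  then have degZ: "even (degree (\<Prod>P\<in>Z. P))" by simp
  have "odd (2 * fls_subdegree (?F r) - int (degree (\<Prod>P\<in>Y. P)))"
    using b fls_subdegree_fract_to_fls[OF nz(2)] sub[OF Y(1,2) ZY(2)] unfolding Y(5)[symmetric] by simp
  then have degY: "odd (degree (\<Prod>P\<in>Y. P))" by simp
  have "fls_lead (?F a) = \<alpha> * fls_lead (?F s) ^ 2"
    unfolding Z(5) F using lead_coeff_prod_finite_primes[OF Z(4)]
    by (simp add: fls_lead_mult fls_lead_const fls_lead_poly_to_fls power2_eq_square)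
  moreover have "fls_lead (?F a) = \<epsilon> * fls_lead y ^ 2"
    unfolding a by (simp add: fls_lead_mult fls_lead_const power2_eq_square)
  ultimately have "\<alpha> * fls_lead (?F s) ^ 2 = \<epsilon> * fls_lead y ^ 2" by simp
  \<comment> \<open>Comparison of leading coefficients: \<alpha> and \<epsilon> lie in the same
    square class, so \<alpha> inherits being a nonsquare.\<close>
  then have e: "\<epsilon> = \<alpha> * (fls_lead (?F s) / fls_lead y) ^ 2"
    using fls_lead_nonzero[OF y] by (simp add: power_divide field_simps)
  have "\<nexists>d. \<alpha> = d ^ 2"
  proof
    assume "\<exists>d. \<alpha> = d ^ 2"
    then obtain d where "\<alpha> = d ^ 2" ..
    then have "\<epsilon> = (d * (fls_lead (?F s) / fls_lead y)) ^ 2" using e by (simp only: power_mult_distrib)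
    then show False using \<epsilon> by blast
  qed
  from exists_ramified_finite_prime[OF Z(1,2) Y(1,2) Z(3,4) Y(3,4) Z(5) Y(5) this degZ degY]
  show "\<exists>P\<in>finite_primes. (odd (valuation (Fin P) a) \<or> odd (valuation (Fin P) b)) \<and>
      norm_anisotropic (valuation (Fin P)) a b" .
qed

section \<open>Square roots of power series and squares at infinity\<close>

fun fps_sqrt_coeff :: "'a::field fps \<Rightarrow> nat \<Rightarrow> 'a" where
  "fps_sqrt_coeff f n = (if n = 0 then 1
     else (fps_nth f n - (\<Sum>i\<in>{1..n - 1}. fps_sqrt_coeff f i * fps_sqrt_coeff f (n - i))) / 2)"

declare fps_sqrt_coeff.simps [simp del]

text \<open>With g(0) = 1, comparing n-th coefficients in g^2 = f gives 2 g(n) plus terms of lower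
  index, so the coefficients are solved for successively.\<close>

lemma fps_square_root:
  fixes f :: "'a::field fps"
  assumes "fps_nth f 0 = 1" "(2::'a) \<noteq> 0" shows "\<exists>g. f = g ^ 2"
proof -
  define g where "g = Abs_fps (fps_sqrt_coeff f)"
  have "fps_nth (g * g) n = fps_nth f n" for n
  proof (cases n)
    case 0
    then show ?thesis using assms(1) by (simp add: g_def fps_sqrt_coeff.simps)
  next
    case (Suc k)
    let ?c = "fps_sqrt_coeff f"
    have "fps_nth (g * g) n = (\<Sum>i=0..n. ?c i * ?c (n - i))" by (simp add: g_def fps_mult_nth)
    also have "{0..n} = insert 0 (insert n {1..n - 1})" using Suc by auto
    also have "(\<Sum>i\<in>\<dots>. ?c i * ?c (n - i)) = 2 * ?c n + (\<Sum>i\<in>{1..n - 1}. ?c i * ?c (n - i))"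
      using Suc by (simp add: fps_sqrt_coeff.simps[of f 0])
    also have "?c n = (fps_nth f n - (\<Sum>i\<in>{1..n - 1}. ?c i * ?c (n - i))) / 2"
      using Suc by (subst fps_sqrt_coeff.simps) (simp only: nat.distinct if_False)
    also have "2 * \<dots> + (\<Sum>i\<in>{1..n - 1}. ?c i * ?c (n - i)) = fps_nth f n"
      using assms(2) by (simp only: times_divide_eq_right nonzero_mult_div_cancel_left diff_add_cancel not_False_eq_True)
    finally show ?thesis .
  qed
  then show ?thesis by (intro exI[of _ g]) (simp add: fps_eq_iff power2_eq_square)
qed

text \<open>\<open>Q\<close> is t^(2 m) times the reversed polynomial in 1/t, whose constant term is
  1; both factors are squares.\<close>

lemma square_at_infinity_monic_even:
  fixes Q :: "'a::field poly"
  assumes "lead_coeff Q = 1" "degree Q = 2 * m" "(2::'a) \<noteq> 0"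
  shows "square_at_infinity (to_fract Q)"
proof -
  define h where "h = Abs_fps (\<lambda>n. if n \<le> 2 * m then coeff Q (2 * m - n) else 0)"
  have "fps_nth h 0 = 1" using assms by (simp add: h_def)
  then obtain g where g: "h = g ^ 2" using fps_square_root assms(3) by blast
  have "poly_to_fls Q = fls_shift (int (2 * m)) (fps_to_fls h)"
  proof (rule fls_eqI)
    fix n
    show "fls_nth (poly_to_fls Q) n = fls_nth (fls_shift (int (2 * m)) (fps_to_fls h)) n"
    proof (cases "n + int (2 * m) < 0")
      case True
      then show ?thesis using assms(2) by (simp add: poly_to_fls_nth coeff_eq_0)
    next
      case False
      then show ?thesis by (auto simp: poly_to_fls_nth h_def intro!: arg_cong[of _ _ "coeff Q"])
    qed
  qed
  also have "\<dots> = fls_shift (int m) (fps_to_fls g) ^ 2"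
    by (simp add: g power2_eq_square fls_times_fps_to_fls fls_shifted_times_simps)
  finally show ?thesis unfolding square_at_infinity_def fract_to_fls_to_fract by blast
qed

subsection \<open>The intersection\<close>

lemma fract_degree_mult: "x \<noteq> 0 \<Longrightarrow> y \<noteq> 0 \<Longrightarrow> fract_degree (x * y) = fract_degree x + fract_degree y"
proof -
  assume "x \<noteq> 0" "y \<noteq> 0"
  moreover have "fls_subdegree (fract_to_fls x * fract_to_fls y) = fls_subdegree (fract_to_fls x) + fls_subdegree (fract_to_fls y)"
    using calculation by (simp add: fract_to_fls_eq_0_iff)
  ultimately show ?thesis
    using fls_subdegree_fract_to_fls[of "x * y"] by (simp add: fls_subdegree_fract_to_fls fract_to_fls_mult)
qed

lemma fract_degree_to_fract: "A \<noteq> 0 \<Longrightarrow> fract_degree (to_fract A) = int (degree A)"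
  by (simp add: to_fract_def fract_degree_Fract)

lemma fract_degree_const_fract: "c \<noteq> 0 \<Longrightarrow> fract_degree (const_fract c) = 0"
  by (simp add: const_fract_def fract_degree_to_fract)

lemma D_pairsI:
  assumes "c \<noteq> 0" "d \<noteq> 0" "even (fract_degree c) \<longleftrightarrow> odd (fract_degree d)" "square_at_infinity c"
  shows "(const_fract \<epsilon> * c, d) \<in> D_pairs \<epsilon>"
proof -
  have "d = const_fract 1 * d" by (simp add: const_fract_simps)
  then show ?thesis
    unfolding D_pairs_def using assms
    by (intro CollectI case_prodI exI[of _ c] exI[of _ d] exI[of _ 1] conjI disjI1) simp_all
qed

lemma D_pairs_ramified:
  assumes \<epsilon>: "\<nexists>x. \<epsilon> = x ^ 2" and ab: "(a, b) \<in> D_pairs \<epsilon>"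
  shows "Infty \<in> ramified_places a b \<inter> (odd_places a \<union> odd_places b)"
    and "\<exists>P\<in>finite_primes. Fin P \<in> ramified_places a b \<inter> (odd_places a \<union> odd_places b)"
proof -
  note V = field_valuation_fls_subdegree
  have \<epsilon>0: "\<epsilon> \<noteq> 0" using \<epsilon> by (metis zero_power2)
  \<comment> \<open>The first form of the definition, for arbitrary entries; the second form follows
    by exchanging the entries, under which anisotropy is symmetric.\<close>
  have key: "Infty \<in> odd_places b" "norm_anisotropic fls_subdegree (fract_to_fls a) (fract_to_fls b)"
    "\<exists>P\<in>finite_primes. Fin P \<in> odd_places a \<union> odd_places b \<and> norm_anisotropic (valuation (Fin P)) a b"
    if c: "c \<noteq> 0" "d \<noteq> 0" "even (fract_degree c) \<longleftrightarrow> odd (fract_degree d)" "\<delta> \<noteq> 0"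
      "square_at_infinity c" "a = const_fract \<epsilon> * c" "b = const_fract \<delta> * d" for a b c d \<delta>
  proof -
    obtain y where y: "fract_to_fls c = y ^ 2" using c(5) by (auto simp: square_at_infinity_def)
    have "y \<noteq> 0" using y c(1) fract_to_fls_eq_0_iff[of c] by auto
    then have "even (fls_subdegree (fract_to_fls c))" by (simp add: y power2_eq_square)
    then have d: "odd (fract_degree d)" using c(3) fls_subdegree_fract_to_fls[OF c(1)] by simp
    have nz: "a \<noteq> 0" "b \<noteq> 0" using c \<epsilon>0 by (auto simp: const_fract_simps)
    have b: "odd (fract_degree b)"
      unfolding c(7) using d c by (simp add: fract_degree_mult const_fract_simps fract_degree_const_fract)
    have a: "fract_to_fls a = fls_const \<epsilon> * y ^ 2"
      unfolding c(6) fract_to_fls_mult const_fract_def fract_to_fls_to_fract poly_to_fls_const y ..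
    show "Infty \<in> odd_places b" using nz b by (simp add: odd_places_def places_def)
    show "norm_anisotropic fls_subdegree (fract_to_fls a) (fract_to_fls b)"
      by (rule ramified_pair(1)[OF \<epsilon> nz a b])
    show "\<exists>P\<in>finite_primes. Fin P \<in> odd_places a \<union> odd_places b \<and> norm_anisotropic (valuation (Fin P)) a b"
      using ramified_pair(2)[OF \<epsilon> nz a b] nz unfolding odd_places_def places_def by blast
  qed
  have "Infty \<in> odd_places a \<union> odd_places b \<and> norm_anisotropic fls_subdegree (fract_to_fls a) (fract_to_fls b) \<and>
    (\<exists>P\<in>finite_primes. Fin P \<in> odd_places a \<union> odd_places b \<and> norm_anisotropic (valuation (Fin P)) a b)"
  proof -
    obtain c d \<delta> where c: "c \<noteq> 0" "d \<noteq> 0" "even (fract_degree c) \<longleftrightarrow> odd (fract_degree d)" "\<delta> \<noteq> 0"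
      and or: "square_at_infinity c \<and> a = const_fract \<epsilon> * c \<and> b = const_fract \<delta> * d \<or>
         square_at_infinity d \<and> b = const_fract \<epsilon> * d \<and> a = const_fract \<delta> * c"
      using ab unfolding D_pairs_def by blast
    from or show ?thesis
    proof
      assume "square_at_infinity c \<and> a = const_fract \<epsilon> * c \<and> b = const_fract \<delta> * d"
      then show ?thesis using key[OF c, of a b] by blast
    next
      assume *: "square_at_infinity d \<and> b = const_fract \<epsilon> * d \<and> a = const_fract \<delta> * c"
      have "even (fract_degree d) \<longleftrightarrow> odd (fract_degree c)" using c(3) by blast
      note k = key[OF c(2,1) this c(4), of b a]
      obtain P where P: "P \<in> finite_primes" "Fin P \<in> odd_places b \<union> odd_places a"
        "norm_anisotropic (valuation (Fin P)) b a" using k(3) * by blast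
      have "norm_anisotropic (valuation (Fin P)) a b"
        by (rule norm_anisotropic_commute[OF field_valuation_Fin[OF P(1)] P(3)])
      moreover have "norm_anisotropic fls_subdegree (fract_to_fls a) (fract_to_fls b)"
        using norm_anisotropic_commute[OF V] k(2) * by blast
      ultimately show ?thesis using k(1) * P by blast
    qed
  qed
  then show "Infty \<in> ramified_places a b \<inter> (odd_places a \<union> odd_places b)"
    "\<exists>P\<in>finite_primes. Fin P \<in> ramified_places a b \<inter> (odd_places a \<union> odd_places b)"
    using ramified_Infty ramified_Fin unfolding ramified_places_def places_def by blast+
qed

lemma polynomial_integral:
  assumes "P \<in> finite_primes" shows "to_fract A \<in> valuation_ring (Fin P)"
  using valuation_ge_to_fract_iff[OF assms, of 0 A] by (simp add: valuation_ring_def del: valuation.simps)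

text \<open>In a representation with denominator of least degree, no prime factor of the denominator
  divides the numerator, so each one is a pole.\<close>

lemma exists_pole:
  fixes x :: "'a::field poly fract"
  assumes "x \<notin> polynomials" shows "\<exists>P\<in>finite_primes. x \<notin> valuation_ring (Fin P)"
proof -
  define R where "R n \<longleftrightarrow> (\<exists>A B. B \<noteq> 0 \<and> degree B = n \<and> x = Fract A B)" for n
  obtain A0 B0 where "x = Fract A0 B0" "B0 \<noteq> 0" by (cases x) auto
  then have "R (degree B0)" by (auto simp: R_def)
  then obtain n where n: "R n" "\<And>n'. n' < n \<Longrightarrow> \<not> R n'" by (metis exists_least_iff)
  then obtain A B where AB: "B \<noteq> 0" "degree B = n" "x = Fract A B" by (auto simp: R_def)
  have "n \<noteq> 0"
  proof
    assume "n = 0"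
    then obtain c where c: "B = [:c:]" "c \<noteq> 0" using AB by (metis degree_eq_zeroE pCons_0_0)
    have "x = to_fract (smult (inverse c) A)"
      unfolding AB(3) c(1) to_fract_def using c(2) by (simp add: eq_fract)
    then show False using assms by (auto simp: polynomials_def)
  qed
  then obtain P where P: "P \<in> finite_primes" "P dvd B" using exists_prime_factor AB(2) by blast
  then obtain B' where B': "B = P * B'" by (elim dvdE)
  have P0: "P \<noteq> 0" "degree P > 0" and B'0: "B' \<noteq> 0" using finite_primesD[OF P(1)] AB(1) B' by auto
  have ndvd: "\<not> P dvd A"
  proof
    assume "P dvd A"
    then obtain A' where A': "A = P * A'" by (elim dvdE)
    have "x = Fract A' B'" unfolding AB(3) A' B' using P0 B'0 by (simp add: eq_fract mult_ac)
    then have "R (degree B')" using B'0 by (auto simp: R_def)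
    moreover have "degree B' < n" using P0 B'0 unfolding AB(2)[symmetric] B' by (simp add: degree_mult_eq)
    ultimately show False using n(2) by blast
  qed
  then have A0: "A \<noteq> 0" by auto
  have "1 \<le> poly_multiplicity P B" using P(2) by (simp add: poly_multiplicity_ge_iff[OF P(1) AB(1)])
  then have "valuation (Fin P) x < 0"
    unfolding AB(3) valuation_Fin_Fract[OF P(1) A0 AB(1)] using poly_multiplicity_eq_0[OF P(1) ndvd] by simp
  moreover have "x \<noteq> 0" using A0 AB by (auto simp: Zero_fract_def eq_fract)
  ultimately have "x \<notin> valuation_ring (Fin P)"
    by (simp add: valuation_ring_def valuation_ge_def del: valuation.simps)
  then show ?thesis using P(1) by blast
qed

lemma Fin_odd_places_to_fract:
  assumes "Fin P \<in> odd_places (const_fract c * to_fract Q)" "Q \<in> finite_primes" "c \<noteq> 0"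
  shows "P = Q"
proof -
  have P: "P \<in> finite_primes" "odd (valuation (Fin P) (const_fract c * to_fract Q))"
    using assms(1) by (auto simp: odd_places_def places_def)
  have "odd (valuation (Fin P) (const_fract c * 1 ^ 2 * to_fract (\<Prod>R\<in>{Q}. R))) \<longleftrightarrow> P \<in> {Q}"
    by (rule odd_valuation_decomposition[OF P(1)]) (use assms in auto)
  then show ?thesis using P(2) by simp
qed

theorem theorem4p40:
  fixes S :: "'s set" and D :: "'s filter" and q :: "'s \<Rightarrow> nat" and F :: "'s \<Rightarrow> 'f ring"
    and \<epsilon> :: "'g::field"
  assumes "infinite S"
    and "nonprincipal_ultrafilter_on S D"
    and "\<And>s. s \<in> S \<Longrightarrow> primepow (q s)"
    and "\<And>N. \<forall>\<^sub>F s in D. N < q s"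
    and "\<And>s. s \<in> S \<Longrightarrow> field (F s)"
    and "\<And>s. s \<in> S \<Longrightarrow> card (carrier (F s)) = q s"
    and "ultraproduct S F D \<simeq> (ring_of_type_algebra :: 'g ring)"
    and "\<nexists>x. \<epsilon> = x ^ 2"
  shows "polynomials \<union> valuation_ring Infty = (\<Inter>(a, b) \<in> D_pairs \<epsilon>. R_tilde a b)"
proof (intro equalityI subsetI)
  fix x :: "'g poly fract" assume x: "x \<in> polynomials \<union> valuation_ring Infty"
  have "x \<in> R_tilde a b" if ab: "(a, b) \<in> D_pairs \<epsilon>" for a b
  proof (cases "x \<in> valuation_ring Infty")
    case True
    then show ?thesis using D_pairs_ramified(1)[OF assms(8) ab] unfolding R_tilde_def by blast
  next
    case False
    then obtain A where "x = to_fract A" using x by (auto simp: polynomials_def)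
    then show ?thesis
      using D_pairs_ramified(2)[OF assms(8) ab] polynomial_integral unfolding R_tilde_def by blast
  qed
  then show "x \<in> (\<Inter>(a, b) \<in> D_pairs \<epsilon>. R_tilde a b)" by blast
next
  fix x :: "'g poly fract" assume x: "x \<in> (\<Inter>(a, b) \<in> D_pairs \<epsilon>. R_tilde a b)"
  note k = ultraproduct_of_finite_fields[of S D q F \<epsilon>, OF assms(2) _ assms(4) _ _ assms(7,8)]
  have k1: "(2::'g) \<noteq> 0" by (rule k(1)) (use assms in auto)
  have k2: "\<exists>z. y * y' = z ^ 2" if "\<nexists>z. y = z ^ 2" "\<nexists>z. y' = z ^ 2" for y y' :: 'g
    by (rule k(2)) (use assms that in auto)
  have k3: "\<exists>T. Q = T ^ 2" if "degree Q \<le> 2 * m" "\<And>y. poly Q y \<noteq> 0 \<and> (\<exists>z. poly Q y = z ^ 2)"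
    for Q :: "'g poly" and m
    by (rule k(3)) (use assms that in auto)
  have \<epsilon>0: "\<epsilon> \<noteq> 0" using assms(8) by (metis zero_power2)
  show "x \<in> polynomials \<union> valuation_ring Infty"
  proof (rule ccontr)
    assume not: "x \<notin> polynomials \<union> valuation_ring Infty"
    then obtain Q where Q: "Q \<in> finite_primes" "x \<notin> valuation_ring (Fin Q)" using exists_pole by blast
    \<comment> \<open>Some place in the union must have \<open>x\<close> in its valuation ring, and
      \<open>x\<close> has poles at infinity and at \<open>Q\<close>.\<close>
    have place: "\<exists>p\<in>ramified_places a b \<inter> (odd_places a \<union> odd_places b). p \<noteq> Infty \<and> p \<noteq> Fin Q"
      if "(a, b) \<in> D_pairs \<epsilon>" for a b
    proof -
      have "x \<in> R_tilde a b" using x that by blast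
      then obtain p where p: "p \<in> ramified_places a b \<inter> (odd_places a \<union> odd_places b)"
        "x \<in> valuation_ring p" unfolding R_tilde_def by (rule UN_E)
      show ?thesis
      proof (rule bexI[OF _ p(1)], rule conjI)
        show "p \<noteq> Infty" using p(2) not by auto
        show "p \<noteq> Fin Q" using p(2) Q(2) by metis
      qed
    qed
    have Q0: "Q \<noteq> 0" "to_fract Q \<noteq> 0" using finite_primesD(4)[OF Q(1)] by (simp_all add: to_fract_eq_0_iff)
    show False
    proof (cases "even (degree Q)")
      case False
      \<comment> \<open>A constant has valuation 0 at every finite place, so \<open>Q\<close> is the
        only finite odd place of this pair.\<close>
      have "(const_fract \<epsilon> * 1, to_fract Q) \<in> D_pairs \<epsilon>"
      proof (rule D_pairsI)
        show "even (fract_degree (1 :: 'g poly fract)) \<longleftrightarrow> odd (fract_degree (to_fract Q))"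
          using False Q0 fract_degree_const_fract[of "1::'g"] by (simp add: const_fract_simps fract_degree_to_fract)
        show "square_at_infinity (1 :: 'g poly fract)"
          unfolding square_at_infinity_def fract_to_fls_1 by (intro exI[of _ 1]) simp
      qed (use Q0 in auto)
      from place[OF this] obtain p where p: "p \<noteq> Infty" "p \<noteq> Fin Q"
        "p \<in> odd_places (const_fract \<epsilon> * 1) \<union> odd_places (to_fract Q)" by blast
      then obtain P where P: "p = Fin P" by (cases p) auto
      have "Fin P \<notin> odd_places (const_fract \<epsilon> * 1)"
        using valuation_Fin_const_fract[OF _ \<epsilon>0] by (auto simp: odd_places_def places_def simp del: valuation.simps)
      then show False using p P Fin_odd_places_to_fract[of P 1 Q] Q(1) by (auto simp: const_fract_simps)
    next
      case True
      then obtain m where m: "degree Q = 2 * m" by (elim evenE)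
      have "\<nexists>T. Q = T ^ 2"
      proof
        assume "\<exists>T. Q = T ^ 2"
        then obtain T where T: "Q = T * T" by (auto simp: power2_eq_square)
        then have "is_unit T" using irreducibleD[OF finite_primesD(2)[OF Q(1)] T] by blast
        then have "is_unit Q" unfolding T by (metis is_unit_mult_iff)
        then show False using finite_primesD(2)[OF Q(1)] irreducible_not_unit by blast
      qed
      \<comment> \<open>\<open>Q\<close> is irreducible and so not a square; the square-value
        criterion must therefore fail at some \<open>l\<close>.\<close>
      then obtain l where l: "poly Q l = 0 \<or> (\<nexists>y. poly Q l = y ^ 2)"
        using k3[of Q m] m by auto
      have Ql: "poly Q l \<noteq> 0"
      proof
        assume "poly Q l = 0"
        then have "[:- l, 1:] dvd Q" by (simp add: poly_eq_0_iff_dvd)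
        from finite_primes_dvd_imp_eq[OF linear_finite_prime Q(1) this] have "degree Q = 1" by auto
        then show False using True by simp
      qed
      then obtain y where y: "\<epsilon> * poly Q l = y ^ 2" using k2[OF assms(8)] l by blast
      have y0: "y \<noteq> 0" using y Ql \<epsilon>0 by auto
      let ?L = "[:- l, 1:]"
      have L0: "to_fract ?L \<noteq> 0" by (simp add: to_fract_eq_0_iff)
      \<comment> \<open>The finite odd places are \<open>Q\<close> and \<open>?L\<close>. What
        remains is to exclude \<open>?L\<close>, where the first entry takes the nonzero square
        value y^2.\<close>
      have "(const_fract \<epsilon> * to_fract Q, to_fract ?L) \<in> D_pairs \<epsilon>"
      proof (rule D_pairsI)
        show "even (fract_degree (to_fract Q)) \<longleftrightarrow> odd (fract_degree (to_fract ?L))"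
          using True Q0 by (simp add: fract_degree_to_fract)
        show "square_at_infinity (to_fract Q)"
          by (rule square_at_infinity_monic_even[OF finite_primesD(1)[OF Q(1)] m k1])
      qed (use Q0 L0 in auto)
      from place[OF this] obtain p where p: "p \<noteq> Infty" "p \<noteq> Fin Q"
        "p \<in> ramified_places (const_fract \<epsilon> * to_fract Q) (to_fract ?L)"
        "p \<in> odd_places (const_fract \<epsilon> * to_fract Q) \<union> odd_places (to_fract ?L)" by blast
      then obtain P where P: "p = Fin P" by (cases p) auto
      have "P = ?L"
        using p P Fin_odd_places_to_fract[OF _ Q(1) \<epsilon>0, of P] Fin_odd_places_to_fract[OF _ linear_finite_prime, of P 1 l]
        by (auto simp: const_fract_simps)
      then have "quaternion_localization_is_division (to_fract ([:\<epsilon>:] * Q)) (to_fract ?L) (Fin ?L)"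
        using p(3) P unfolding ramified_places_def to_fract_mult by (simp add: const_fract_def const_fract_simps)
      moreover have "poly ([:\<epsilon>:] * Q) l = y ^ 2" using y by simp
      ultimately show False using not_ramified_at_root[OF _ y0 k1 L0] by blast
    qed
  qed
qed

end
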